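(* Let $\Omega\subset\mathbb{R}^n$ be a domain with $|\Omega|<\infty$, and let $1<p<n$, $1\leq\beta<\frac{n}{p}$, $\frac{1}{q}=\frac{1}{p}-\frac{\beta-1}{n}$, and $0\leq\gamma\leq n$. Then there exists a constant $C>0$, independent of $f$, such that for every $f\in W^{1,p}(\Omega)$ $$\|M_{\varphi,\beta,\Omega}f\|_{W^{1,q}(\Omega)}\leq C\|f\|_{W^{1,p}(\Omega)}.$$
   Context: For $\gamma\ge 0$ put $\varphi(t)=(1+t)^{\gamma}$ for $t\geq 0$. For $0\leq\beta<n$ and a domain $\Omega\subset\mathbb{R}^n$ with complement $\Omega^c=\mathbb{R}^n\setminus\Omega$, the local fractional new maximal operator is $$M_{\varphi,\beta,\Omega}f(x)=\sup_{0<r<\mathrm{dist}(x,\Omega^c)}\frac{r^{\beta}(1+r^n)^{\frac{\gamma\beta}{n}}}{\varphi(|B(x,r)|)\,|B(x,r)|}\int_{B(x,r)}|f(y)|\,dy,\qquad x\in\Omega,$$ where $B(x,r)$ is the ball with center $x$ and radius $r$ and $|\cdot|$ is Lebesgue measure. The Sobolev space $W^{1,p}(\Omega)$ consists of the functions $f:\Omega\to\mathbb{R}$ with $\|f\|_{W^{1,p}(\Omega)}=\|f\|_{L^p(\Omega)}+\|\nabla f\|_{L^p(\Omega)}<\infty$, where $\nabla f$ is the weak gradient. *)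

theory Defs
  imports "HOL-Analysis.Analysis"
begin

definition domain_Rn :: "(real^'n) set \<Rightarrow> bool" where
  "domain_Rn \<Omega> \<longleftrightarrow> open \<Omega> \<and> connected \<Omega> \<and> \<Omega> \<noteq> {}"

text \<open>Functions on \<open>\<Omega>\<close> are represented by total functions on the whole space whose values off
  \<open>\<Omega>\<close> are irrelevant: all integrals and measurability conditions refer to \<open>lebesgue_on \<Omega>\<close>.\<close>

definition in_Lp :: "real \<Rightarrow> (real^'n) set \<Rightarrow> (real^'n \<Rightarrow> 'b::euclidean_space) \<Rightarrow> bool" where
  "in_Lp p \<Omega> f \<longleftrightarrow> f \<in> borel_measurable (lebesgue_on \<Omega>) \<and>
     integrable (lebesgue_on \<Omega>) (\<lambda>x. norm (f x) powr p)"

definition Lp_norm :: "real \<Rightarrow> (real^'n) set \<Rightarrow> (real^'n \<Rightarrow> 'b::euclidean_space) \<Rightarrow> real" where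
  "Lp_norm p \<Omega> f = (\<integral>x. norm (f x) powr p \<partial>lebesgue_on \<Omega>) powr (1 / p)"

definition locally_integrable :: "(real^'n) set \<Rightarrow> (real^'n \<Rightarrow> 'b::euclidean_space) \<Rightarrow> bool" where
  "locally_integrable \<Omega> f \<longleftrightarrow> (\<forall>K. compact K \<and> K \<subseteq> \<Omega> \<longrightarrow> integrable (lebesgue_on K) f)"

definition partial_deriv :: "'n \<Rightarrow> (real^'n \<Rightarrow> real) \<Rightarrow> real^'n \<Rightarrow> real" where
  "partial_deriv i f x = frechet_derivative f (at x) (axis i 1)"

primrec C_k :: "nat \<Rightarrow> (real^'n \<Rightarrow> real) \<Rightarrow> bool" where
  "C_k 0 f \<longleftrightarrow> continuous_on UNIV f"
| "C_k (Suc k) f \<longleftrightarrow> (\<forall>x. f differentiable (at x)) \<and> (\<forall>i. C_k k (partial_deriv i f))"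

definition test_function :: "(real^'n) set \<Rightarrow> (real^'n \<Rightarrow> real) \<Rightarrow> bool" where
  "test_function \<Omega> \<psi> \<longleftrightarrow>
     (\<forall>k. C_k k \<psi>) \<and> compact (closure {x. \<psi> x \<noteq> 0}) \<and> closure {x. \<psi> x \<noteq> 0} \<subseteq> \<Omega>"

definition has_weak_gradient ::
  "(real^'n) set \<Rightarrow> (real^'n \<Rightarrow> real) \<Rightarrow> (real^'n \<Rightarrow> real^'n) \<Rightarrow> bool" where
  "has_weak_gradient \<Omega> f g \<longleftrightarrow> locally_integrable \<Omega> f \<and> locally_integrable \<Omega> g \<and>
     (\<forall>\<psi> i. test_function \<Omega> \<psi> \<longrightarrow>
        (\<integral>x. f x * partial_deriv i \<psi> x \<partial>lebesgue_on \<Omega>) =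
        - (\<integral>x. g x $ i * \<psi> x \<partial>lebesgue_on \<Omega>))"

text \<open>The weak gradient is determined only up to null sets; the choice made here does not affect
  the Sobolev norm. It is unspecified if no weak gradient exists.\<close>

definition weak_gradient ::
  "(real^'n) set \<Rightarrow> (real^'n \<Rightarrow> real) \<Rightarrow> real^'n \<Rightarrow> real^'n" where
  "weak_gradient \<Omega> f = (SOME g. has_weak_gradient \<Omega> f g)"

definition in_W1p :: "real \<Rightarrow> (real^'n) set \<Rightarrow> (real^'n \<Rightarrow> real) \<Rightarrow> bool" where
  "in_W1p p \<Omega> f \<longleftrightarrow> in_Lp p \<Omega> f \<and> (\<exists>g. has_weak_gradient \<Omega> f g \<and> in_Lp p \<Omega> g)"

definition W1p_norm :: "real \<Rightarrow> (real^'n) set \<Rightarrow> (real^'n \<Rightarrow> real) \<Rightarrow> real" where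
  "W1p_norm p \<Omega> f = Lp_norm p \<Omega> f + Lp_norm p \<Omega> (weak_gradient \<Omega> f)"

definition growth_phi :: "real \<Rightarrow> real \<Rightarrow> real" where
  "growth_phi \<gamma> t = (1 + t) powr \<gamma>"

text \<open>The supremum may be infinite at some points, so it is taken in \<^typ>\<open>ennreal\<close>.
  If \<open>\<Omega>\<close> is the whole space, then the distance to its complement is infinite, whereas
  \<open>infdist x {} = 0\<close>; hence the case distinction.\<close>

definition local_frac_maximal ::
  "real \<Rightarrow> real \<Rightarrow> (real^'n) set \<Rightarrow> (real^'n \<Rightarrow> real) \<Rightarrow> real^'n \<Rightarrow> ennreal" where
  "local_frac_maximal \<gamma> \<beta> \<Omega> f x =
     (SUP r \<in> {r. 0 < r \<and> (- \<Omega> = {} \<or> r < infdist x (- \<Omega>))}.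
        ennreal (r powr \<beta> * (1 + r ^ CARD('n)) powr (\<gamma> * \<beta> / real CARD('n)) /
                 (growth_phi \<gamma> (measure lebesgue (ball x r)) * measure lebesgue (ball x r))) *
        (\<integral>\<^sup>+ y \<in> ball x r. ennreal \<bar>f y\<bar> \<partial>lebesgue))"

end

theory Submission
  imports Defs
begin

text \<open>Put \<open>a = \<beta> - 1\<close> and let \<open>G\<close> be the sum of the fractional maximal functions of order \<open>a\<close> of \<open>\<bar>f\<bar>\<close> and
  \<open>\<bar>\<nabla>f\<bar>\<close>, both extended by zero. By Hedberg's inequality and the Hardy--Littlewood theorem, its \<open>L\<^sup>q\<close>
  norm is at most a constant times the \<open>W\<^bsup>1,p\<^esup>\<close> norm of \<open>f\<close>. Since \<open>\<Omega>\<close> has finite measure, only bounded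
  radii occur, so that the local maximal function \<open>v\<close> of \<open>f\<close> satisfies \<open>v \<le> C G\<close>. Comparing the ball \<open>B(x, r)\<close>
  with \<open>B(x', r - \<bar>x - x'\<bar>)\<close>, which lies inside it, one obtains the pointwise estimate
  \<open>\<bar>v(x) - v(x')\<bar> \<le> C \<bar>x - x'\<bar> (G(x) + G(x'))\<close>. The difference quotients of \<open>v\<close> are thus dominated by functions
  converging to \<open>2 C G\<close> in \<open>L\<^sup>1\<close>, and a weak limit of them is the weak gradient of \<open>v\<close>.\<close>

section \<open>Continuity of translations in the mean\<close>

text \<open>One order is gained because \<open>r powr \<beta>\<close> is
  \<open>r * r powr (\<beta> - 1)\<close>: differencing the weight leaves order \<beta> - 1 on f,
  and differencing the average costs a gradient whose extra factor r is absorbed by the bound on the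
  radii. Hence both maximal functions in G have the same order. The obstacle is the boundary. A
  radius admissible at x need not be admissible at x', and f extended by zero has in general no weak
  gradient on the whole space. The affine map between the two balls moves points only inside B(x,
  r), where the weak identity holds, and the radius lost is the loss allowed by the 1-Lipschitz
  distance function. The comparison is one-sided: each ball at x is measured against the supremum at
  x', and exchanging the points gives the absolute value. The weak limit is extracted in a finite
  measure with density proportional to G, using only that G is integrable and that translation is
  continuous in L^1. The L^q bound on the gradient is then pointwise domination, not weak
  compactness in L^q.\<close>

lemma norm_minus_triangle3:
  fixes a b c d :: "'b::real_normed_vector"
  shows "norm (a - d) \<le> norm (a - b) + norm (b - c) + norm (c - d)"
  using norm_triangle_ineq[of "a - b" "b - d"] norm_triangle_ineq[of "b - c" "c - d"] by simp

lemma integrable_translation: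
  fixes f :: "'a::euclidean_space \<Rightarrow> 'b::{banach, second_countable_topology}"
  assumes "integrable lborel f"
  shows "integrable lborel (\<lambda>x. f (x + h))"
proof -
  have "integrable (distr lborel borel ((+) h)) f"
    using assms by (simp add: lborel_distr_plus)
  then show ?thesis
    by (subst (asm) integrable_distr_eq) (use assms in \<open>auto simp: add.commute\<close>)
qed

lemma integral_translation:
  fixes f :: "'a::euclidean_space \<Rightarrow> 'b::{banach, second_countable_topology}"
  assumes "f \<in> borel_measurable borel"
  shows "(\<integral>x. f (x + h) \<partial>lborel) = (\<integral>x. f x \<partial>lborel)"
proof -
  have "(\<integral>x. f x \<partial>lborel) = (\<integral>x. f x \<partial>distr lborel borel ((+) h))"
    by (simp add: lborel_distr_plus)
  also have "\<dots> = (\<integral>x. f (h + x) \<partial>lborel)"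
    by (rule integral_distr) (use assms in auto)
  finally show ?thesis by (simp add: add.commute)
qed

lemma translation_L1_Lipschitz_compact:
  fixes f :: "'a::euclidean_space \<Rightarrow> 'b::{banach, second_countable_topology}"
  assumes lip: "\<And>x y. norm (f x - f y) \<le> L * dist x y" and supp: "\<And>x. R \<le> norm x \<Longrightarrow> f x = 0"
    and "e > 0" and int: "integrable lborel f"
  shows "\<exists>d>0. \<forall>h. norm h < d \<longrightarrow> (\<integral>x. norm (f (x + h) - f x) \<partial>lborel) < e"
proof -
  define m where "m = measure lborel (cball 0 (R + 1) :: 'a set)"
  have m: "m \<ge> 0" by (simp add: m_def)
  have L: "\<bar>L\<bar> \<ge> 0" by simp
  \<comment> \<open>The minimum with 1 keeps the translated support inside
    \<open>cball 0 (R + 1)\<close>; the summands 1 in the denominator cover \<open>L = 0\<close> and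
    \<open>m = 0\<close>.\<close>
  define d where "d = min 1 (e / ((\<bar>L\<bar> + 1) * (m + 1)))"
  have "d > 0" using \<open>e > 0\<close> m by (auto simp: d_def)
  moreover have "(\<integral>x. norm (f (x + h) - f x) \<partial>lborel) < e" if "norm h < d" for h
  proof -
    have "(\<integral>x. norm (f (x + h) - f x) \<partial>lborel)
        \<le> (\<integral>x. (\<bar>L\<bar> * norm h) * indicator (cball 0 (R + 1)) (x::'a) \<partial>lborel)"
    proof (rule Bochner_Integration.integral_mono)
      show "integrable lborel (\<lambda>x. norm (f (x + h) - f x))"
        using int integrable_translation[OF int] by auto
      show "integrable lborel (\<lambda>x::'a. (\<bar>L\<bar> * norm h) * indicator (cball 0 (R + 1)) x :: real)"
        using emeasure_lborel_cball_finite[of "0::'a" "R + 1"]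
        by (intro integrable_mult_right integrable_real_indicator) auto
    next
      fix x :: 'a
      show "norm (f (x + h) - f x) \<le> (\<bar>L\<bar> * norm h) * indicator (cball 0 (R + 1)) x"
      proof (cases "x \<in> cball 0 (R + 1)")
        case True
        have "norm (f (x + h) - f x) \<le> L * norm h"
          using lip[of "x + h" x] by (simp add: dist_norm)
        also have "\<dots> \<le> \<bar>L\<bar> * norm h" by (intro mult_right_mono) auto
        finally show ?thesis using True by simp
      next
        case False
        then have "R + 1 < norm x" by simp
        moreover have "norm h < 1" using that by (simp add: d_def)
        moreover have "norm x \<le> norm (x + h) + norm h"
          by (metis add_diff_cancel norm_triangle_ineq4)
        ultimately have "f x = 0" "f (x + h) = 0" by (auto intro!: supp)
        then show ?thesis by simp
      qed
    qed
    also have "\<dots> = \<bar>L\<bar> * norm h * m"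
      by (simp add: m_def)
    also have "\<dots> \<le> (\<bar>L\<bar> + 1) * norm h * (m + 1)"
      using m by (intro mult_mono) auto
    also have "\<dots> < (\<bar>L\<bar> + 1) * d * (m + 1)"
      using that m by (intro mult_strict_right_mono mult_strict_left_mono) auto
    also have "\<dots> \<le> (\<bar>L\<bar> + 1) * (e / ((\<bar>L\<bar> + 1) * (m + 1))) * (m + 1)"
      using m by (intro mult_right_mono mult_left_mono) (auto simp: d_def)
    also have "\<dots> = e" using m by (simp add: field_simps add_nonneg_eq_0_iff)
    finally show ?thesis .
  qed
  ultimately show ?thesis by blast
qed

text \<open>Translation preserves the L^1 norm, so the approximation error of \<open>s i\<close> is
  the same before and after translating. This three-epsilon argument closes the property under L^1
  limits.\<close>

lemma translation_L1_limit:
  fixes f :: "'a::euclidean_space \<Rightarrow> 'b::{banach, second_countable_topology}"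
  assumes s: "\<And>i. integrable lborel (s i)" and f: "integrable lborel f"
    and lim: "(\<lambda>i. \<integral>x. norm (s i x - f x) \<partial>lborel) \<longlonglongrightarrow> 0"
    and ts: "\<And>i e. e > 0 \<Longrightarrow> \<exists>d>0. \<forall>h. norm h < d \<longrightarrow> (\<integral>x. norm (s i (x + h) - s i x) \<partial>lborel) < e"
    and "e > 0"
  shows "\<exists>d>0. \<forall>h. norm h < d \<longrightarrow> (\<integral>x. norm (f (x + h) - f x) \<partial>lborel) < e"
proof -
  obtain i where i: "(\<integral>x. norm (s i x - f x) \<partial>lborel) < e / 3"
    using order_tendstoD(2)[OF lim, of "e / 3"] \<open>e > 0\<close>
    by (auto simp: eventually_sequentially)
  obtain d where d: "d > 0" "\<And>h. norm h < d \<Longrightarrow> (\<integral>x. norm (s i (x + h) - s i x) \<partial>lborel) < e / 3"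
    using ts[of "e / 3" i] \<open>e > 0\<close> by auto
  have int: "integrable lborel (\<lambda>x. norm (s i x - f x))"
    using s f by auto
  have "(\<integral>x. norm (f (x + h) - f x) \<partial>lborel) < e" if "norm h < d" for h
  proof -
    have si: "integrable lborel (\<lambda>x. norm (s i (x + h) - s i x))"
      using s integrable_translation[OF s] by auto
    have tr: "(\<integral>x. norm (s i (x + h) - f (x + h)) \<partial>lborel) = (\<integral>x. norm (s i x - f x) \<partial>lborel)"
      using int by (intro integral_translation[of "\<lambda>x. norm (s i x - f x)"]) auto
    have tri: "integrable lborel (\<lambda>x. norm (s i (x + h) - f (x + h)))"
      using integrable_translation[OF int] .
    have "(\<integral>x. norm (f (x + h) - f x) \<partial>lborel) \<le>
      (\<integral>x. norm (s i (x + h) - f (x + h)) + norm (s i (x + h) - s i x) + norm (s i x - f x) \<partial>lborel)"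
    proof (rule Bochner_Integration.integral_mono)
      show "integrable lborel (\<lambda>x. norm (f (x + h) - f x))"
        using f integrable_translation[OF f] by auto
      show "integrable lborel (\<lambda>x. norm (s i (x + h) - f (x + h)) + norm (s i (x + h) - s i x) + norm (s i x - f x))"
        using si tri int by auto
      show "norm (f (x + h) - f x) \<le> norm (s i (x + h) - f (x + h)) + norm (s i (x + h) - s i x) + norm (s i x - f x)" for x
        using norm_minus_triangle3[of "f (x + h)" "f x" "s i (x + h)" "s i x"]
        by (simp add: norm_minus_commute)
    qed
    also have "\<dots> = (\<integral>x. norm (s i x - f x) \<partial>lborel) + (\<integral>x. norm (s i (x + h) - s i x) \<partial>lborel)
       + (\<integral>x. norm (s i x - f x) \<partial>lborel)"
      using si tri int by (simp add: tr)
    also have "\<dots> < e" using i d(2)[OF that] by simp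
    finally show ?thesis .
  qed
  with d(1) show ?thesis by blast
qed

text \<open>Indicators of compact sets are reached from the Lipschitz case by tent functions of the
  distance to K, which decrease to the indicator.\<close>

lemma translation_L1_compact:
  fixes K :: "'a::euclidean_space set" and c :: "'b::{banach, second_countable_topology}"
  assumes K: "compact K" and "e > 0"
  shows "\<exists>d>0. \<forall>h. norm h < d \<longrightarrow>
    (\<integral>x. norm (indicator K (x + h) *\<^sub>R c - indicator K x *\<^sub>R c) \<partial>lborel) < e"
proof (cases "K = {}")
  case True
  then show ?thesis using \<open>e > 0\<close> by (auto intro!: exI[of _ 1])
next
  case False
  \<comment> \<open>For \<open>i = 0\<close> this is the constant \<open>c\<close>, in general not
    integrable; from \<open>Suc i\<close> on, the support lies within distance 1 of K.\<close>
  define s where "s = (\<lambda>i::nat. \<lambda>x. max 0 (1 - real i * infdist x K) *\<^sub>R c)"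
  obtain R where R: "\<And>x. x \<in> K \<Longrightarrow> norm x \<le> R" 
    using compact_imp_bounded[OF K] by (auto simp: bounded_iff)
  have meas: "s i \<in> borel_measurable borel" for i
    unfolding s_def by (intro borel_measurable_continuous_onI continuous_intros)
  have cl: "closed K" using K by (rule compact_imp_closed)
  have supp: "s (Suc i) x = 0" if "R + 1 \<le> norm x" for i x
  proof -
    obtain y where y: "y \<in> K" "infdist x K = dist x y"
      using infdist_attains_inf[OF cl False, of x] by blast
    have "1 \<le> dist x y"
      using norm_triangle_ineq2[of x y] R[OF y(1)] that by (simp add: dist_norm)
    then have "1 \<le> real (Suc i) * infdist x K"
      using y(2) mult_mono[of 1 "real (Suc i)" 1 "dist x y"] by simp
    then show ?thesis by (simp add: s_def)
  qed
  have bnd: "norm (s (Suc i) x) \<le> indicator (cball 0 (R + 1)) x *\<^sub>R norm c" for i x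
  proof (cases "R + 1 \<le> norm x")
    case True
    then show ?thesis using supp by auto
  next
    case False
    then show ?thesis
      by (auto simp: s_def infdist_nonneg intro!: mult_left_le_one_le)
  qed
  have intc: "integrable lborel (\<lambda>x::'a. indicator (cball 0 r) x *\<^sub>R norm c :: real)" for r :: real
    using emeasure_lborel_cball_finite[of "0::'a" r]
    by (intro integrable_scaleR_left integrable_real_indicator) auto
  have ints: "integrable lborel (s (Suc i))" for i
    by (rule Bochner_Integration.integrable_bound[OF intc[of "R + 1"]])
       (use meas[of "Suc i"] bnd in \<open>auto simp: abs_mult\<close>)
  have intK: "integrable lborel (\<lambda>x. indicator K x *\<^sub>R c)"
    using emeasure_compact_finite[OF K] by (auto simp: cl borel_closed intro!: integrable_scaleR_left integrable_real_indicator)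
  have lim: "(\<lambda>i. s (Suc i) x) \<longlonglongrightarrow> indicator K x *\<^sub>R c" for x
  proof (cases "x \<in> K")
    case True
    then show ?thesis by (simp add: s_def)
  next
    case nK: False
    then have pos: "infdist x K > 0"
      using in_closed_iff_infdist_zero[OF cl False, of x] infdist_nonneg[of x K] by simp
    obtain N where N: "1 < real N * infdist x K"
      using reals_Archimedean3[OF pos] by blast
    have "s (Suc i) x = 0" if "i \<ge> N" for i
    proof -
      have "real N * infdist x K \<le> real (Suc i) * infdist x K"
        using that pos by (intro mult_right_mono) auto
      then show ?thesis using N by (simp add: s_def)
    qed
    then have "eventually (\<lambda>i. s (Suc i) x = 0) sequentially"
      by (auto simp: eventually_sequentially)
    then show ?thesis using nK by (simp add: tendsto_eventually)
  qed
  show ?thesis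
  proof (rule translation_L1_limit[where s = "\<lambda>i. s (Suc i)", OF ints intK _ _ \<open>e > 0\<close>])
    have "(\<lambda>i. \<integral>x. norm (s (Suc i) x - indicator K x *\<^sub>R c) \<partial>lborel) \<longlonglongrightarrow> (\<integral>x. 0 \<partial>(lborel :: 'a measure))"
    proof (rule integral_dominated_convergence[where w = "\<lambda>x. 2 * (indicator (cball 0 (R + 1)) x *\<^sub>R norm c)"])
      show "AE x in lborel. (\<lambda>i. norm (s (Suc i) x - indicator K x *\<^sub>R c)) \<longlonglongrightarrow> 0"
        using lim by (auto intro!: AE_I2 tendsto_norm_zero simp: LIM_zero)
      show "AE x in lborel. norm (norm (s (Suc i) x - indicator K x *\<^sub>R c)) \<le> 2 * (indicator (cball 0 (R + 1)) x *\<^sub>R norm c)" for i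
      proof (rule AE_I2)
        fix x :: 'a
        have "norm (indicator K x *\<^sub>R c) \<le> indicator (cball 0 (R + 1)) x *\<^sub>R norm c"
          using R[of x] by (auto simp: indicator_def)
        then show "norm (norm (s (Suc i) x - indicator K x *\<^sub>R c)) \<le> 2 * (indicator (cball 0 (R + 1)) x *\<^sub>R norm c)"
          using bnd[of i x] norm_triangle_ineq4[of "s (Suc i) x" "indicator K x *\<^sub>R c"] by simp
      qed
      show "integrable lborel (\<lambda>x::'a. 2 * (indicator (cball 0 (R + 1)) x *\<^sub>R norm c))"
        using intc by (rule integrable_mult_right)
    qed (use meas cl in auto)
    then show "(\<lambda>i. \<integral>x. norm (s (Suc i) x - indicator K x *\<^sub>R c) \<partial>lborel) \<longlonglongrightarrow> 0"
      by simp
  next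
    fix i and e :: real assume "e > 0"
    have "norm (s (Suc i) x - s (Suc i) y) \<le> (real (Suc i) * norm c) * dist x y" for x y
    proof -
      have "\<bar>max 0 (1 - real (Suc i) * infdist x K) - max 0 (1 - real (Suc i) * infdist y K)\<bar>
         \<le> \<bar>real (Suc i) * infdist x K - real (Suc i) * infdist y K\<bar>" by linarith
      also have "\<dots> = real (Suc i) * \<bar>infdist x K - infdist y K\<bar>"
        by (simp add: abs_mult right_diff_distrib[symmetric])
      also have "\<dots> \<le> real (Suc i) * dist x y"
        using infdist_triangle_abs[of x K y] by (intro mult_left_mono) auto
      finally show ?thesis
        unfolding s_def scaleR_left_diff_distrib[symmetric] norm_scaleR real_norm_def
        by (metis (no_types, lifting) mult.commute mult.left_commute mult_right_mono norm_ge_zero)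
    qed
    from translation_L1_Lipschitz_compact[OF this supp \<open>e > 0\<close> ints]
    show "\<exists>d>0. \<forall>h. norm h < d \<longrightarrow> (\<integral>x. norm (s (Suc i) (x + h) - s (Suc i) x) \<partial>lborel) < e" .
  qed
qed

text \<open>The property passes to sums and dominated limits, and an indicator of finite measure is
  an L^1 limit of indicators of compact subsets.\<close>

theorem translation_L1:
  fixes f :: "'a::euclidean_space \<Rightarrow> 'b::{banach, second_countable_topology}"
  assumes "integrable lborel f" and "e > 0"
  shows "\<exists>d>0. \<forall>h. norm h < d \<longrightarrow> (\<integral>x. norm (f (x + h) - f x) \<partial>lborel) < e"
  using assms
proof (induction arbitrary: e rule: integrable_induct)
  case (base A c)
  have fin: "emeasure lebesgue A < \<infinity>" using base by simp
  have A: "A \<in> sets borel" using base by simp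
  have "\<exists>K. compact K \<and> K \<subseteq> A \<and> emeasure lborel (A - K) < ennreal (inverse (Suc i))" for i
  proof -
    \<comment> \<open>Inner regularity gives closed sets; intersecting with large balls makes them
      compact, at a cost tending to 0 because A has finite measure.\<close>
    obtain T where T: "closed T" "T \<subseteq> A" "emeasure lebesgue (A - T) < ennreal (inverse (Suc i))"
      by (rule sets_lebesgue_inner_closed[of A "inverse (Suc i)"]) (use A in auto)
    have mT: "(\<lambda>N::nat. emeasure lborel (A - (T \<inter> cball 0 (real N)))) \<longlonglongrightarrow> emeasure lborel (\<Inter>N. A - (T \<inter> cball 0 (real N)))"
    proof (rule Lim_emeasure_decseq)
      show "range (\<lambda>N::nat. A - T \<inter> cball 0 (real N)) \<subseteq> sets lborel"
        using A T(1) by auto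
      show "decseq (\<lambda>N::nat. A - T \<inter> cball 0 (real N))"
        by (auto simp: decseq_def)
      show "emeasure lborel (A - T \<inter> cball 0 (real i)) \<noteq> \<infinity>" for i
      proof -
        have "emeasure lborel (A - T \<inter> cball 0 (real i)) \<le> emeasure lborel A"
          using A by (intro emeasure_mono) auto
        then show ?thesis using base by auto
      qed
    qed
    have "(\<Inter>N::nat. A - (T \<inter> cball 0 (real N))) = A - T"
    proof -
      have "\<exists>N::nat. x \<in> cball 0 (real N)" for x :: 'a
        using real_arch_simple[of "norm x"] by auto
      then show ?thesis by fastforce
    qed
    moreover have "emeasure lborel (A - T) < ennreal (inverse (Suc i))"
      using T A by (simp add: borel_closed)
    ultimately obtain N :: nat where "emeasure lborel (A - (T \<inter> cball 0 (real N))) < ennreal (inverse (Suc i))"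
      using order_tendstoD(2)[OF mT, of "ennreal (inverse (Suc i))"] by (auto simp: eventually_sequentially)
    then show ?thesis using T by (intro exI[of _ "T \<inter> cball 0 (real N)"]) (auto simp: closed_Int_compact)
  qed
  then obtain K where K: "\<And>i. compact (K i)" "\<And>i. K i \<subseteq> A"
    "\<And>i. emeasure lborel (A - K i) < ennreal (inverse (Suc i))" by metis
  have KB: "K i \<in> sets borel" for i using K(1)[of i] by (simp add: borel_compact)
  show ?case
  proof (rule translation_L1_limit[where s = "\<lambda>i x. indicator (K i) x *\<^sub>R c"])
    show "integrable lborel (\<lambda>x. indicator (K i) x *\<^sub>R c)" for i
      using emeasure_compact_finite[OF K(1)] KB by (intro integrable_scaleR_left integrable_real_indicator) auto
    show "integrable lborel (\<lambda>x. indicator A x *\<^sub>R c)"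
      using base by (intro integrable_scaleR_left integrable_real_indicator) auto
    show "(\<lambda>i. \<integral>x. norm (indicator (K i) x *\<^sub>R c - indicator A x *\<^sub>R c) \<partial>lborel) \<longlonglongrightarrow> 0"
    proof (rule tendsto_sandwich[where f = "\<lambda>_. 0" and h = "\<lambda>i. inverse (real (Suc i)) * norm c"])
      show "(\<lambda>i. inverse (real (Suc i)) * norm c) \<longlonglongrightarrow> 0"
        by (intro tendsto_mult_left_zero LIMSEQ_inverse_real_of_nat)
      have "(\<integral>x. norm (indicator (K i) x *\<^sub>R c - indicator A x *\<^sub>R c) \<partial>lborel) \<le> inverse (real (Suc i)) * norm c" for i
      proof -
        have "(\<integral>x. norm (indicator (K i) x *\<^sub>R c - indicator A x *\<^sub>R c) \<partial>lborel)
           = (\<integral>x. indicator (A - K i) x * norm c \<partial>lborel)"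
          using K(2)[of i] by (intro Bochner_Integration.integral_cong) (auto simp: indicator_def)
        also have "\<dots> = measure lborel (A - K i) * norm c"
          by simp
        also have "measure lborel (A - K i) \<le> inverse (Suc i)"
          using K(3)[of i] by (simp add: measure_def enn2real_leI order_less_imp_le)
        finally show ?thesis by (simp add: mult_right_mono)
      qed
      then show "eventually (\<lambda>i. (\<integral>x. norm (indicator (K i) x *\<^sub>R c - indicator A x *\<^sub>R c) \<partial>lborel) \<le> inverse (real (Suc i)) * norm c) sequentially"
        by (intro always_eventually allI)
    qed (auto intro!: always_eventually Bochner_Integration.integral_nonneg)
    show "\<exists>d>0. \<forall>h. norm h < d \<longrightarrow> (\<integral>x. norm (indicator (K i) (x + h) *\<^sub>R c - indicator (K i) x *\<^sub>R c) \<partial>lborel) < e"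
      if "e > 0" for i e
      using translation_L1_compact[OF K(1) that] .
  qed (use base in auto)
next
  case (add f g)
  obtain d1 where d1: "d1 > 0" "\<And>h. norm h < d1 \<Longrightarrow> (\<integral>x. norm (f (x + h) - f x) \<partial>lborel) < e / 2"
    using add(3)[of "e / 2"] add.prems by auto
  obtain d2 where d2: "d2 > 0" "\<And>h. norm h < d2 \<Longrightarrow> (\<integral>x. norm (g (x + h) - g x) \<partial>lborel) < e / 2"
    using add(4)[of "e / 2"] add.prems by auto
  have "(\<integral>x. norm (f (x + h) + g (x + h) - (f x + g x)) \<partial>lborel) < e" if h: "norm h < min d1 d2" for h
  proof -
    have i: "integrable lborel (\<lambda>x. f (x + h) - f x)" "integrable lborel (\<lambda>x. g (x + h) - g x)"
      by (intro conjI Bochner_Integration.integrable_diff integrable_translation add)+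
    have "(\<integral>x. norm (f (x + h) + g (x + h) - (f x + g x)) \<partial>lborel) \<le>
       (\<integral>x. norm (f (x + h) - f x) + norm (g (x + h) - g x) \<partial>lborel)"
    proof (rule Bochner_Integration.integral_mono)
      have "integrable lborel (\<lambda>x. norm ((f (x + h) - f x) + (g (x + h) - g x)))"
        using i by auto
      then show "integrable lborel (\<lambda>x. norm (f (x + h) + g (x + h) - (f x + g x)))"
        by (simp add: algebra_simps)
      show "norm (f (x + h) + g (x + h) - (f x + g x)) \<le> norm (f (x + h) - f x) + norm (g (x + h) - g x)" for x
        using norm_triangle_ineq[of "f (x + h) - f x" "g (x + h) - g x"] by (simp add: algebra_simps)
    qed (use i in auto)
    also have "\<dots> = (\<integral>x. norm (f (x + h) - f x) \<partial>lborel) + (\<integral>x. norm (g (x + h) - g x) \<partial>lborel)"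
      using i by (intro Bochner_Integration.integral_add) auto
    also have "\<dots> < e" using d1(2)[of h] d2(2)[of h] h by simp
    finally show ?thesis .
  qed
  then show ?case using d1(1) d2(1) by (intro exI[of _ "min d1 d2"]) auto
next
  case (lim f s)
  show ?case
  proof (rule translation_L1_limit[where s = s])
    have "(\<lambda>i. \<integral>x. norm (s i x - f x) \<partial>lborel) \<longlonglongrightarrow> (\<integral>x. 0 \<partial>(lborel :: 'a measure))"
    \<comment> \<open>The induction supplies \<open>norm (s i x) \<le> 2 * norm (f x)\<close>,
      whence the factor 3.\<close>
    proof (rule integral_dominated_convergence[where w = "\<lambda>x. 3 * norm (f x)"])
      show "AE x in lborel. (\<lambda>i. norm (s i x - f x)) \<longlonglongrightarrow> 0"
        using lim(2) by (auto intro!: AE_I2 tendsto_norm_zero LIM_zero)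
      show "AE x in lborel. norm (norm (s i x - f x)) \<le> 3 * norm (f x)" for i
      proof (rule AE_I2)
        fix x
        show "norm (norm (s i x - f x)) \<le> 3 * norm (f x)"
          using norm_triangle_ineq4[of "s i x" "f x"] lim(3)[of x i] by simp
      qed
    qed (use lim(1,4) in auto)
    then show "(\<lambda>i. \<integral>x. norm (s i x - f x) \<partial>lborel) \<longlonglongrightarrow> 0" by simp
  qed (use lim in auto)
qed

section \<open>Fractional maximal functions\<close>

lemma ball_emeasure_scale:
  fixes x :: "'a::euclidean_space"
  assumes "r \<ge> 0"
  shows "emeasure lborel (ball x r) = ennreal (r ^ DIM('a)) * emeasure lborel (ball (0::'a) 1)"
  using assms by (simp add: emeasure_ball ennreal_mult' mult.commute)

text \<open>The Vitali selection is indexed by a countable set of centres, so subadditivity is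
  phrased with the counting measure; it is Tonelli applied to indicators.\<close>

lemma emeasure_UN_le_countable:
  assumes sets[measurable]: "\<And>i. i \<in> I \<Longrightarrow> X i \<in> sets M" and I: "countable I"
  shows "emeasure M (\<Union>(X ` I)) \<le> (\<integral>\<^sup>+i. emeasure M (X i) \<partial>count_space I)"
proof -
  have le: "indicator (\<Union>(X ` I)) x \<le> (\<integral>\<^sup>+ i. indicator (X i) x \<partial>count_space I)" for x
  proof (cases "x \<in> \<Union>(X ` I)")
    case True
    then obtain j where j: "x \<in> X j" "j \<in> I" by auto
    have "indicator (X j) x \<le> (\<integral>\<^sup>+ i. indicator (X i) x \<partial>count_space I)"
      by (rule nn_integral_ge_point[OF j(2)])
    then show ?thesis using j True by simp
  qed simp
  note sets.countable_UN'[unfolded subset_eq, measurable]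
  have "\<Union>(X ` I) \<in> sets M" using I sets by auto
  then have "emeasure M (\<Union>(X ` I)) = (\<integral>\<^sup>+x. indicator (\<Union>(X ` I)) x \<partial>M)"
    by simp
  also have "\<dots> \<le> (\<integral>\<^sup>+x. \<integral>\<^sup>+i. indicator (X i) x \<partial>count_space I \<partial>M)"
    by (intro nn_integral_mono le)
  also have "\<dots> = (\<integral>\<^sup>+i. \<integral>\<^sup>+x. indicator (X i) x \<partial>M \<partial>count_space I)"
    by (intro nn_integral_count_space_nn_integral I) auto
  also have "\<dots> = (\<integral>\<^sup>+i. emeasure M (X i) \<partial>count_space I)"
    by (intro nn_integral_cong) simp
  finally show ?thesis .
qed

text \<open>By continuity from below a slightly smaller ball already has measure above c, and it is
  contained in the balls of radius r with nearby centres. This lower semicontinuity makes suprema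
  over uncountably many radii measurable, here and in
  \<open>borel_measurable_radius_sup\<close>.\<close>

lemma open_ball_emeasure_gt:
  fixes M :: "'a::euclidean_space measure"
  assumes "sets M = sets borel"
  shows "open {x. c < emeasure M (ball x r)}"
proof (subst open_dist, safe)
  fix x assume c: "c < emeasure M (ball x r)"
  have "(SUP k. emeasure M (ball x (r - inverse (real (Suc k))))) = emeasure M (\<Union>k. ball x (r - inverse (real (Suc k))))"
  proof (rule SUP_emeasure_incseq)
    show "incseq (\<lambda>k. ball x (r - inverse (real (Suc k))))"
    proof (intro monoI subset_ball)
      fix i j :: nat assume "i \<le> j"
      then have "inverse (real (Suc j)) \<le> inverse (real (Suc i))" by (simp add: le_imp_inverse_le)
      then show "r - inverse (real (Suc i)) \<le> r - inverse (real (Suc j))" by simp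
    qed
    show "range (\<lambda>k. ball x (r - inverse (real (Suc k)))) \<subseteq> sets M"
      unfolding assms by (rule image_subsetI) simp
  qed
  also have "(\<Union>k. ball x (r - inverse (real (Suc k)))) = ball x r"
  proof (intro equalityI subsetI)
    fix y assume "y \<in> ball x r"
    then have "0 < r - dist x y" by simp
    then obtain k where "inverse (real (Suc k)) < r - dist x y"
      using reals_Archimedean by blast
    then show "y \<in> (\<Union>k. ball x (r - inverse (real (Suc k))))" by (auto intro!: exI[of _ k])
  next
    fix y assume "y \<in> (\<Union>k. ball x (r - inverse (real (Suc k))))"
    then obtain k where k: "dist x y < r - inverse (real (Suc k))" by auto
    have "0 < inverse (real (Suc k))" by simp
    with k have "dist x y < r" by linarith
    then show "y \<in> ball x r" by simp
  qed
  finally have sup: "(SUP k. emeasure M (ball x (r - inverse (real (Suc k))))) = emeasure M (ball x r)" .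
  obtain k where k: "c < emeasure M (ball x (r - inverse (real (Suc k))))"
    using c[folded sup] unfolding less_SUP_iff by blast
  show "\<exists>e>0. \<forall>y. dist y x < e \<longrightarrow> y \<in> {x. c < emeasure M (ball x r)}"
  proof (intro exI[of _ "inverse (real (Suc k))"] conjI allI impI CollectI)
    fix y assume d: "dist y x < inverse (real (Suc k))"
    have "ball x (r - inverse (real (Suc k))) \<subseteq> ball y r"
    proof
      fix z assume "z \<in> ball x (r - inverse (real (Suc k)))"
      then show "z \<in> ball y r" using d dist_triangle[of y z x] by (auto simp: dist_commute)
    qed
    then have "emeasure M (ball x (r - inverse (real (Suc k)))) \<le> emeasure M (ball y r)"
      using assms by (intro emeasure_mono) auto
    with k show "c < emeasure M (ball y r)" by order
  qed simp
qed

section \<open>The Hardy-Littlewood maximal function: weak type\<close>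

definition hl_maximal :: "('a::euclidean_space \<Rightarrow> ennreal) \<Rightarrow> 'a \<Rightarrow> ennreal" where
  "hl_maximal F x = (SUP r \<in> {0<..}. (\<integral>\<^sup>+ y \<in> ball x r. F y \<partial>lborel) / emeasure lborel (ball x r))"

lemma emeasure_ball_pos_finite:
  fixes x :: "'a::euclidean_space"
  assumes "r > 0"
  shows "emeasure lborel (ball x r) \<noteq> 0" "emeasure lborel (ball x r) \<noteq> \<infinity>"
  using assms by (auto simp: emeasure_ball ennreal_eq_0_iff not_le)

lemma less_divide_ennreal_iff:
  fixes a b c :: ennreal
  assumes "c \<noteq> 0" "c \<noteq> \<infinity>"
  shows "a < b / c \<longleftrightarrow> a * c < b"
proof -
  obtain c' where c: "c = ennreal c'" "0 < c'"
    using assms by (cases c) auto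
  show ?thesis
  proof (cases "a = \<infinity>")
    case True
    then show ?thesis using c by (simp add: ennreal_top_mult)
  next
    case False
    then obtain a' where a: "a = ennreal a'" "0 \<le> a'" by (cases a) auto
    show ?thesis
    proof (cases "b = \<infinity>")
      case True
      then show ?thesis using a c by (simp add: ennreal_top_divide ennreal_mult[symmetric])
    next
      case False
      then obtain b' where b: "b = ennreal b'" "0 \<le> b'" by (cases b) auto
      show ?thesis
        using a b c by (simp add: divide_ennreal ennreal_mult[symmetric] ennreal_less_iff field_simps)
    qed
  qed
qed

text \<open>Writing the level sets through the measure with density F yields their openness and, in
  the weak-type estimate, a radius for each of their points.\<close>

lemma hl_maximal_gt_eq:
  fixes F :: "'a::euclidean_space \<Rightarrow> ennreal"
  assumes F: "F \<in> borel_measurable borel"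
  shows "{x. t < hl_maximal F x} =
    (\<Union>r\<in>{0<..}. {x. t * emeasure lborel (ball (0::'a) r) < emeasure (density lborel F) (ball x r)})"
proof -
  have "(t < (\<integral>\<^sup>+ y \<in> ball x r. F y \<partial>lborel) / emeasure lborel (ball x r)) \<longleftrightarrow>
    t * emeasure lborel (ball (0::'a) r) < emeasure (density lborel F) (ball x r)" if "r > 0" for r and x :: 'a
  proof -
    have "emeasure lborel (ball x r) = emeasure lborel (ball (0::'a) r)"
      using that by (simp add: emeasure_ball)
    moreover have "(\<integral>\<^sup>+ y \<in> ball x r. F y \<partial>lborel) = emeasure (density lborel F) (ball x r)"
      using F by (subst emeasure_density) auto
    ultimately show ?thesis
      using less_divide_ennreal_iff emeasure_ball_pos_finite[OF that, of x] by simp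
  qed
  then show ?thesis
    unfolding hl_maximal_def less_SUP_iff by auto
qed

lemma open_hl_maximal_gt:
  assumes F: "F \<in> borel_measurable borel"
  shows "open {x. t < hl_maximal F x}"
  unfolding hl_maximal_gt_eq[OF F] by (intro open_UN ballI open_ball_emeasure_gt) simp

lemma borel_measurable_hl_maximal [measurable]:
  assumes F: "F \<in> borel_measurable borel"
  shows "hl_maximal F \<in> borel_measurable borel"
  by (rule borel_measurableI_greater) (use open_hl_maximal_gt[OF F] in auto)

text \<open>Each point of the level set is the centre of a ball on which the mean of F exceeds t.
  Vitali selects disjoint ones whose 5-fold enlargements cover the set; the selected balls have
  total volume at most the integral of F divided by t.\<close>

lemma hl_maximal_weak_type:
  fixes F :: "'a::euclidean_space \<Rightarrow> ennreal"
  assumes F: "F \<in> borel_measurable borel" and t: "t > 0"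
  shows "emeasure lborel {x. ennreal t < hl_maximal F x} \<le> ennreal (5 ^ DIM('a) / t) * (\<integral>\<^sup>+x. F x \<partial>lborel)"
proof (cases "(\<integral>\<^sup>+x. F x \<partial>lborel) = \<infinity>")
  case True
  then show ?thesis using t by (simp add: ennreal_mult_top)
next
  case False
  define \<mu> where "\<mu> = density lborel F"
  have sets: "sets \<mu> = sets borel" by (simp add: \<mu>_def)
  define \<omega> where "\<omega> = measure lborel (ball (0::'a) 1)"
  have \<omega>: "\<omega> > 0" unfolding \<omega>_def by (rule content_ball_pos) simp
  have e\<omega>: "emeasure lborel (ball (0::'a) 1) = ennreal \<omega>"
    unfolding \<omega>_def using emeasure_lborel_ball_finite[of "0::'a" 1] by (simp add: emeasure_eq_ennreal_measure)
  obtain I where I: "(\<integral>\<^sup>+x. F x \<partial>lborel) = ennreal I" "I \<ge> 0"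
    using False by (cases "\<integral>\<^sup>+x. F x \<partial>lborel") auto
  have space: "emeasure \<mu> UNIV = ennreal I"
    using F I by (simp add: \<mu>_def emeasure_density)
  define E where "E = {x. ennreal t < hl_maximal F x}"
  have "\<forall>x\<in>E. \<exists>r>0. ennreal t * emeasure lborel (ball (0::'a) r) < emeasure \<mu> (ball x r)"
    unfolding E_def hl_maximal_gt_eq[OF F] \<mu>_def by auto
  then obtain r where r: "\<And>x. x \<in> E \<Longrightarrow> r x > 0"
    "\<And>x. x \<in> E \<Longrightarrow> ennreal t * emeasure lborel (ball (0::'a) (r x)) < emeasure \<mu> (ball x (r x))"
    by metis
  have r': "ennreal (t * \<omega> * r x ^ DIM('a)) < emeasure \<mu> (ball x (r x))" if "x \<in> E" for x
    using r[OF that] ball_emeasure_scale[of "r x" "0::'a"] \<omega> t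
    by (simp add: e\<omega> ennreal_mult mult_ac)
  \<comment> \<open>Vitali's lemma needs bounded radii. For \<open>r x > 1\<close> the radius is at
    most its power \<open>DIM('a)\<close>, and t times the volume of the ball is below the finite
    integral I.\<close>
  have bound: "r x \<le> max 1 (I / (t * \<omega>))" if "x \<in> E" for x
  proof (rule ccontr)
    assume "\<not> r x \<le> max 1 (I / (t * \<omega>))"
    then have 1: "1 < r x" "I / (t * \<omega>) < r x" by auto
    have "emeasure \<mu> (ball x (r x)) \<le> emeasure \<mu> UNIV"
      by (intro emeasure_mono) (auto simp: sets)
    then have "ennreal (t * \<omega> * r x ^ DIM('a)) < ennreal I"
      using r'[OF that] space by simp
    then have "t * \<omega> * r x ^ DIM('a) < I"
      using t \<omega> r(1)[OF that] by (subst (asm) ennreal_less_iff) auto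
    moreover have "r x \<le> r x ^ DIM('a)"
      using 1(1) by (intro self_le_power) auto
    ultimately have "t * \<omega> * r x < I"
      using t \<omega> by (smt (verit) mult_left_mono mult_pos_pos)
    with 1(2) t \<omega> show False by (simp add: field_simps)
  qed
  obtain C where C: "countable C" "C \<subseteq> E"
     "pairwise (\<lambda>i j. disjnt (cball i (r i)) (cball j (r j))) C"
     "E \<subseteq> (\<Union>i\<in>C. cball i (5 * r i))"
    by (rule Vitali_covering_lemma_cballs[where S = E and K = E and a = "\<lambda>x. x" and r = r and B = "max 1 (I / (t * \<omega>))"])
       (use r(1) bound in \<open>force+\<close>)
  have openE: "open E" unfolding E_def by (rule open_hl_maximal_gt[OF F])
  have rp: "r i > 0" if "i \<in> C" for i using r(1) C(2) that by auto
  have "emeasure lborel E \<le> emeasure lborel (\<Union>i\<in>C. cball i (5 * r i))"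
    using C(1,4) openE by (intro emeasure_mono) auto
  also have "\<dots> \<le> (\<integral>\<^sup>+i. emeasure lborel (cball i (5 * r i)) \<partial>count_space C)"
    by (rule emeasure_UN_le_countable) (use C(1) in auto)
  also have "\<dots> \<le> (\<integral>\<^sup>+i. ennreal (5 ^ DIM('a) / t) * emeasure \<mu> (ball i (r i)) \<partial>count_space C)"
  proof (intro nn_integral_mono)
    fix i assume "i \<in> space (count_space C)"
    then have i: "i \<in> C" by simp
    have w: "\<omega> = unit_ball_vol (real DIM('a))"
      by (simp add: \<omega>_def content_ball)
    have "emeasure lborel (cball i (5 * r i)) = ennreal (\<omega> * (5 * r i) ^ DIM('a))"
      using rp[OF i] by (subst emeasure_cball) (auto simp: w)
    also have "\<dots> = ennreal (5 ^ DIM('a) / t) * ennreal (t * \<omega> * r i ^ DIM('a))"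
      using rp[OF i] \<omega> t by (subst ennreal_mult[symmetric]) (auto simp: power_mult_distrib)
    also have "\<dots> \<le> ennreal (5 ^ DIM('a) / t) * emeasure \<mu> (ball i (r i))"
      using r'[of i] C(2) i by (intro mult_left_mono) auto
    finally show "emeasure lborel (cball i (5 * r i)) \<le> ennreal (5 ^ DIM('a) / t) * emeasure \<mu> (ball i (r i))" .
  qed
  also have "\<dots> = ennreal (5 ^ DIM('a) / t) * (\<integral>\<^sup>+i. emeasure \<mu> (ball i (r i)) \<partial>count_space C)"
    by (intro nn_integral_cmult) simp
  also have "(\<integral>\<^sup>+i. emeasure \<mu> (ball i (r i)) \<partial>count_space C) = emeasure \<mu> (\<Union>i\<in>C. ball i (r i))"
  proof (rule emeasure_UN_countable[symmetric])
    show "disjoint_family_on (\<lambda>i. ball i (r i)) C"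
      unfolding disjoint_family_on_def
    proof (intro ballI impI)
      fix m n assume "m \<in> C" "n \<in> C" "m \<noteq> n"
      then have "disjnt (cball m (r m)) (cball n (r n))"
        using C(3) by (auto simp: pairwise_def)
      then show "ball m (r m) \<inter> ball n (r n) = {}"
        using ball_subset_cball unfolding disjnt_def by blast
    qed
  qed (use C(1) in \<open>auto simp: sets\<close>)
  also have "emeasure \<mu> (\<Union>i\<in>C. ball i (r i)) \<le> emeasure \<mu> UNIV"
    by (intro emeasure_mono) (auto simp: sets)
  also have "\<dots> = (\<integral>\<^sup>+x. F x \<partial>lborel)" by (simp add: space I)
  finally show ?thesis unfolding E_def by (simp add: mult_left_mono)
qed

text \<open>The set of infinite values lies in every level set, and the weak-type bounds tend to 0
  as the level grows.\<close>

lemma hl_maximal_finite_AE: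
  fixes F :: "'a::euclidean_space \<Rightarrow> ennreal"
  assumes F: "F \<in> borel_measurable borel" and fin: "(\<integral>\<^sup>+x. F x \<partial>lborel) < \<infinity>"
  shows "AE x in lborel. hl_maximal F x < \<infinity>"
proof -
  obtain I where I: "(\<integral>\<^sup>+x. F x \<partial>lborel) = ennreal I" "I \<ge> 0"
    using fin by (cases "\<integral>\<^sup>+x. F x \<partial>lborel") auto
  let ?N = "{x. hl_maximal F x = \<infinity>}"
  have N: "?N \<in> sets lborel"
    using borel_measurable_hl_maximal[OF F] by simp
  have le: "emeasure lborel ?N \<le> ennreal (5 ^ DIM('a) / t * I)" if "t > 0" for t
  proof -
    have "emeasure lborel ?N \<le> emeasure lborel {x. ennreal t < hl_maximal F x}"
      using open_hl_maximal_gt[OF F] by (intro emeasure_mono) auto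
    also have "\<dots> \<le> ennreal (5 ^ DIM('a) / t * I)"
      using hl_maximal_weak_type[OF F that] I that by (simp add: ennreal_mult'[symmetric])
    finally show ?thesis .
  qed
  have "emeasure lborel ?N \<le> ennreal e" if "e > 0" for e
  proof -
    \<comment> \<open>The level \<open>t\<close> is chosen to make the bound at most
      \<open>e\<close>; the added 1 keeps it positive when \<open>I = 0\<close>.\<close>
    have "emeasure lborel ?N \<le> ennreal (5 ^ DIM('a) / ((5 ^ DIM('a) * I + 1) / e) * I)"
      using that I by (intro le) (auto intro!: divide_pos_pos add_nonneg_pos)
    also have "\<dots> \<le> ennreal e"
    proof (rule ennreal_leI)
      have "5 ^ DIM('a) * I * e \<le> (5 ^ DIM('a) * I + 1) * e"
        using that by (intro mult_right_mono) auto
      moreover have "5 ^ DIM('a) * I + 1 > 0" using I by (intro add_nonneg_pos) auto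
      ultimately show "5 ^ DIM('a) / ((5 ^ DIM('a) * I + 1) / e) * I \<le> e"
        by (simp add: divide_le_eq mult_ac)
    qed
    finally show ?thesis .
  qed
  then have "emeasure lborel ?N = 0"
    by (metis ennreal_le_epsilon add_0 le_zero_eq)
  then have "AE x in lborel. \<not> hl_maximal F x = \<infinity>"
    using N by (intro AE_I'[of ?N]) (auto simp: null_sets_def)
  then show ?thesis by (auto simp: less_top)
qed

section \<open>The Hardy-Littlewood maximal function: strong type\<close>

lemma hl_maximal_le_add:
  fixes F F' :: "'a::euclidean_space \<Rightarrow> ennreal"
  assumes F[measurable]: "F' \<in> borel_measurable borel"
    and le: "\<And>x. F x \<le> F' x + ennreal c" and "c \<ge> 0"
  shows "hl_maximal F x \<le> hl_maximal F' x + ennreal c"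
  unfolding hl_maximal_def
proof (rule SUP_least)
  fix r :: real assume "r \<in> {0<..}"
  then have r: "r > 0" by simp
  let ?B = "emeasure lborel (ball x r)"
  have [measurable]: "ball x r \<in> sets borel" by simp
  have "(\<integral>\<^sup>+ y \<in> ball x r. F y \<partial>lborel) \<le> (\<integral>\<^sup>+ y \<in> ball x r. (F' y + ennreal c) \<partial>lborel)"
    by (intro nn_integral_mono mult_right_mono le) simp
  also have "\<dots> = (\<integral>\<^sup>+ y \<in> ball x r. F' y \<partial>lborel) + (\<integral>\<^sup>+ y \<in> ball x r. ennreal c \<partial>lborel)"
    unfolding distrib_right by (rule nn_integral_add) measurable
  also have "(\<integral>\<^sup>+ y \<in> ball x r. ennreal c \<partial>lborel) = ennreal c * ?B"
    by (simp add: nn_integral_cmult_indicator)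
  finally have "(\<integral>\<^sup>+ y \<in> ball x r. F y \<partial>lborel) / ?B \<le> ((\<integral>\<^sup>+ y \<in> ball x r. F' y \<partial>lborel) + ennreal c * ?B) / ?B"
    by (rule divide_right_mono_ennreal)
  also have "\<dots> = (\<integral>\<^sup>+ y \<in> ball x r. F' y \<partial>lborel) / ?B + ennreal c"
    using emeasure_ball_pos_finite[OF r, of x]
    by (simp add: add_divide_distrib_ennreal ennreal_mult_divide_eq)
  also have "\<dots> \<le> (SUP r\<in>{0<..}. (\<integral>\<^sup>+ y \<in> ball x r. F' y \<partial>lborel) / emeasure lborel (ball x r)) + ennreal c"
    using r by (intro add_right_mono SUP_upper) auto
  finally show "(\<integral>\<^sup>+ y \<in> ball x r. F y \<partial>lborel) / ?B \<le>
     (SUP r\<in>{0<..}. (\<integral>\<^sup>+ y \<in> ball x r. F' y \<partial>lborel) / emeasure lborel (ball x r)) + ennreal c" .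
qed

text \<open>The exponent may be negative: the strong-type proof uses \<open>p - 1\<close> and also
  \<open>p - 2\<close>, which exceeds only -1.\<close>

lemma nn_integral_powr_Ioo:
  assumes a: "a \<ge> 0" and s: "s > - 1"
  shows "(\<integral>\<^sup>+t. ennreal (if 0 < t \<and> t < a then t powr s else 0) \<partial>lborel) = ennreal (a powr (s + 1) / (s + 1))"
proof -
  have "(\<integral>\<^sup>+t. ennreal (if 0 < t \<and> t < a then t powr s else 0) \<partial>lborel)
     = (\<integral>\<^sup>+t. ennreal (if t \<in> {0..a} then t powr s else 0) \<partial>lborel)"
  proof (rule nn_integral_cong_AE)
    show "AE t in lborel. ennreal (if 0 < t \<and> t < a then t powr s else 0) = ennreal (if t \<in> {0..a} then t powr s else 0)"
      using AE_lborel_singleton[of "0::real"] AE_lborel_singleton[of a] by eventually_elim auto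
  qed
  also have "\<dots> = ennreal (a powr (s + 1) / (s + 1))"
  proof (rule nn_integral_has_integral_lborel)
    show "((\<lambda>t. if t \<in> {0..a} then t powr s else 0) has_integral (a powr (s + 1) / (s + 1))) UNIV"
      using has_integral_powr_from_0[OF s a] by (subst has_integral_restrict_UNIV)
  qed auto
  finally show ?thesis .
qed

text \<open>Marcinkiewicz interpolation: the p-th power is written as an integral over levels t, at
  each level the part of f up to t/2 is discarded, the weak-type bound is applied to the rest, and
  Tonelli exchanges the integrals.\<close>

theorem hl_maximal_strong_type:
  fixes f :: "'a::euclidean_space \<Rightarrow> real"
  assumes f[measurable]: "f \<in> borel_measurable borel" and nn: "\<And>x. f x \<ge> 0" and p: "1 < p"
  shows "(\<integral>\<^sup>+x. ennreal (enn2real (hl_maximal (\<lambda>x. ennreal (f x)) x) powr p) \<partial>lborel)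
     \<le> ennreal (p / (p - 1) * 2 powr p * 5 ^ DIM('a)) * (\<integral>\<^sup>+x. ennreal (f x powr p) \<partial>lborel)"
proof -
  define H where "H = hl_maximal (\<lambda>x. ennreal (f x))"
  have H[measurable]: "H \<in> borel_measurable borel"
    unfolding H_def by measurable
  \<comment> \<open>\<open>enn2real\<close> sends an infinite value to 0, so \<open>t < m x\<close>
    implies \<open>t < H x\<close> but not conversely; the proof uses this direction.\<close>
  define m where "m x = enn2real (H x)" for x
  have [measurable]: "m \<in> borel_measurable borel" unfolding m_def by measurable
  have m0: "m x \<ge> 0" for x by (simp add: m_def)
  \<comment> \<open>The weak-type constant \<open>5 ^ DIM('a)\<close>, taken at level t/2.\<close>
  define K :: real where "K = 2 * 5 ^ DIM('a)"
  have K: "K > 0" by (simp add: K_def)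
  have level: "emeasure lborel {x. t < m x} \<le> (\<integral>\<^sup>+x. ennreal (if t < 2 * f x then K / t * f x else 0) \<partial>lborel)"
    if t: "t > 0" for t
  proof -
    \<comment> \<open>Cutting f to 0 where it is at most t/2 lowers the maximal function by at most
      t/2 (\<open>hl_maximal_le_add\<close>), so level t for f forces level t/2 for the
      truncation.\<close>
    let ?F = "\<lambda>x. ennreal (if t < 2 * f x then f x else 0)"
    have "{x. t < m x} \<subseteq> {x. ennreal (t / 2) < hl_maximal ?F x}"
    proof safe
      fix x assume x: "t < m x"
      have "ennreal t < H x"
        using x t by (cases "H x") (auto simp: m_def ennreal_less_iff)
      also have "H x \<le> hl_maximal ?F x + ennreal (t / 2)"
        unfolding H_def
      proof (rule hl_maximal_le_add)
        show "ennreal (f x) \<le> ?F x + ennreal (t / 2)" for x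
          using t nn[of x] by (auto simp: ennreal_plus[symmetric] simp del: ennreal_plus intro!: ennreal_leI)
      qed (use t in auto)
      finally have "ennreal t < hl_maximal ?F x + ennreal (t / 2)" .
      then show "ennreal (t / 2) < hl_maximal ?F x"
      proof (rule contrapos_pp)
        assume "\<not> ennreal (t / 2) < hl_maximal ?F x"
        then have "hl_maximal ?F x + ennreal (t / 2) \<le> ennreal (t / 2) + ennreal (t / 2)"
          by (intro add_right_mono) auto
        also have "\<dots> = ennreal t" using t by (simp add: ennreal_plus[symmetric] del: ennreal_plus)
        finally show "\<not> ennreal t < hl_maximal ?F x + ennreal (t / 2)" by auto
      qed
    qed
    then have "emeasure lborel {x. t < m x} \<le> emeasure lborel {x. ennreal (t / 2) < hl_maximal ?F x}"
      by (intro emeasure_mono) measurable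
    also have "\<dots> \<le> ennreal (5 ^ DIM('a) / (t / 2)) * (\<integral>\<^sup>+x. ?F x \<partial>lborel)"
      by (rule hl_maximal_weak_type) (use t in auto)
    also have "\<dots> = (\<integral>\<^sup>+x. ennreal (5 ^ DIM('a) / (t / 2)) * ?F x \<partial>lborel)"
      by (rule nn_integral_cmult[symmetric]) measurable
    also have "\<dots> = (\<integral>\<^sup>+x. ennreal (if t < 2 * f x then K / t * f x else 0) \<partial>lborel)"
      using t nn by (intro nn_integral_cong) (auto simp: K_def ennreal_mult[symmetric] mult_ac)
    finally show ?thesis .
  qed
  have "(\<integral>\<^sup>+x. ennreal (m x powr p) \<partial>lborel)
      = (\<integral>\<^sup>+x. \<integral>\<^sup>+t. ennreal p * ennreal (if 0 < t \<and> t < m x then t powr (p - 1) else 0) \<partial>lborel \<partial>lborel)"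
  proof (rule nn_integral_cong)
    fix x
    have "(\<integral>\<^sup>+t. ennreal p * ennreal (if 0 < t \<and> t < m x then t powr (p - 1) else 0) \<partial>lborel)
       = ennreal p * ennreal (m x powr (p - 1 + 1) / (p - 1 + 1))"
      using p m0 by (subst nn_integral_cmult) (auto simp: nn_integral_powr_Ioo)
    also have "\<dots> = ennreal (m x powr p)"
      using p by (simp add: ennreal_mult'[symmetric])
    finally show "ennreal (m x powr p) = (\<integral>\<^sup>+t. ennreal p * ennreal (if 0 < t \<and> t < m x then t powr (p - 1) else 0) \<partial>lborel)" ..
  qed
  also have "\<dots> = (\<integral>\<^sup>+t. \<integral>\<^sup>+x. ennreal p * ennreal (if 0 < t \<and> t < m x then t powr (p - 1) else 0) \<partial>lborel \<partial>lborel)"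
    by (rule lborel_pair.Fubini') measurable
  also have "\<dots> \<le> (\<integral>\<^sup>+t. \<integral>\<^sup>+x. ennreal (p * K * f x) * ennreal (if 0 < t \<and> t < 2 * f x then t powr (p - 2) else 0) \<partial>lborel \<partial>lborel)"
  proof (rule nn_integral_mono)
    fix t :: real
    show "(\<integral>\<^sup>+x. ennreal p * ennreal (if 0 < t \<and> t < m x then t powr (p - 1) else 0) \<partial>lborel)
       \<le> (\<integral>\<^sup>+x. ennreal (p * K * f x) * ennreal (if 0 < t \<and> t < 2 * f x then t powr (p - 2) else 0) \<partial>lborel)"
    proof (cases "t > 0")
      case t: True
      have "(\<integral>\<^sup>+x. ennreal p * ennreal (if 0 < t \<and> t < m x then t powr (p - 1) else 0) \<partial>lborel)
         = (\<integral>\<^sup>+x. ennreal (p * t powr (p - 1)) * indicator {x. t < m x} x \<partial>lborel)"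
        using t p by (intro nn_integral_cong) (auto simp: ennreal_mult' indicator_def)
      also have "\<dots> = ennreal (p * t powr (p - 1)) * emeasure lborel {x. t < m x}"
        by (rule nn_integral_cmult_indicator) measurable
      also have "\<dots> \<le> ennreal (p * t powr (p - 1)) * (\<integral>\<^sup>+x. ennreal (if t < 2 * f x then K / t * f x else 0) \<partial>lborel)"
        by (intro mult_left_mono level t) simp
      also have "\<dots> = (\<integral>\<^sup>+x. ennreal (p * t powr (p - 1)) * ennreal (if t < 2 * f x then K / t * f x else 0) \<partial>lborel)"
        by (rule nn_integral_cmult[symmetric]) measurable
      also have "\<dots> = (\<integral>\<^sup>+x. ennreal (p * K * f x) * ennreal (if 0 < t \<and> t < 2 * f x then t powr (p - 2) else 0) \<partial>lborel)"
      proof (rule nn_integral_cong)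
        fix x
        \<comment> \<open>The factor 1/t of the weak-type bound lowers the exponent from
          \<open>p - 1\<close> to \<open>p - 2\<close>.\<close>
        have "t powr (p - 1) = t powr (p - 2) * t"
          using t powr_mult_base[of t "p - 2"] by (simp add: mult.commute)
        then show "ennreal (p * t powr (p - 1)) * ennreal (if t < 2 * f x then K / t * f x else 0)
           = ennreal (p * K * f x) * ennreal (if 0 < t \<and> t < 2 * f x then t powr (p - 2) else 0)"
          using t p K nn[of x] by (auto simp: ennreal_mult'[symmetric] mult_ac)
      qed
      finally show ?thesis .
    qed simp
  qed
  also have "\<dots> = (\<integral>\<^sup>+x. \<integral>\<^sup>+t. ennreal (p * K * f x) * ennreal (if 0 < t \<and> t < 2 * f x then t powr (p - 2) else 0) \<partial>lborel \<partial>lborel)"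
    by (rule lborel_pair.Fubini') measurable
  also have "\<dots> = (\<integral>\<^sup>+x. ennreal (p / (p - 1) * 2 powr p * 5 ^ DIM('a)) * ennreal (f x powr p) \<partial>lborel)"
  proof (rule nn_integral_cong)
    fix x
    have "(\<integral>\<^sup>+t. ennreal (p * K * f x) * ennreal (if 0 < t \<and> t < 2 * f x then t powr (p - 2) else 0) \<partial>lborel)
      = ennreal (p * K * f x) * ennreal ((2 * f x) powr (p - 2 + 1) / (p - 2 + 1))"
      using p nn[of x] by (subst nn_integral_cmult) (auto simp: nn_integral_powr_Ioo)
    also have "\<dots> = ennreal ((p * K * f x) * ((2 * f x) powr (p - 1) / (p - 1)))"
      using p K nn[of x] by (subst ennreal_mult[symmetric]) auto
    \<comment> \<open>\<open>K * 2 powr (p - 1)\<close> equals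
      \<open>2 powr p * 5 ^ DIM('a)\<close>, which gives the constant of the theorem.\<close>
    also have "(p * K * f x) * ((2 * f x) powr (p - 1) / (p - 1)) = (p / (p - 1) * 2 powr p * 5 ^ DIM('a)) * f x powr p"
    proof (cases "f x = 0")
      case False
      then have "f x > 0" using nn[of x] by simp
      then have "f x powr p = f x powr (p - 1) * f x" "2 powr p = 2 powr (p - 1) * (2::real)"
        using powr_mult_base[of "f x" "p - 1"] powr_mult_base[of "2::real" "p - 1"] by (simp_all add: mult.commute)
      then show ?thesis by (simp add: powr_mult K_def mult_ac)
    qed (use p in auto)
    also have "ennreal \<dots> = ennreal (p / (p - 1) * 2 powr p * 5 ^ DIM('a)) * ennreal (f x powr p)"
      using p by (subst ennreal_mult[symmetric]) auto
    finally show "(\<integral>\<^sup>+t. ennreal (p * K * f x) * ennreal (if 0 < t \<and> t < 2 * f x then t powr (p - 2) else 0) \<partial>lborel)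
      = ennreal (p / (p - 1) * 2 powr p * 5 ^ DIM('a)) * ennreal (f x powr p)" .
  qed
  also have "\<dots> = ennreal (p / (p - 1) * 2 powr p * 5 ^ DIM('a)) * (\<integral>\<^sup>+x. ennreal (f x powr p) \<partial>lborel)"
    by (rule nn_integral_cmult) measurable
  finally show ?thesis by (simp add: m_def H_def)
qed

section \<open>Ball averages and Hedberg's inequality\<close>

definition ball_avg :: "('a::euclidean_space \<Rightarrow> real) \<Rightarrow> 'a \<Rightarrow> real \<Rightarrow> real" where
  "ball_avg f x r = (\<integral>y. indicator (ball x r) y * f y \<partial>lborel) / measure lborel (ball x r)"

lemma ball_avg_le_hl_maximal:
  fixes f :: "'a::euclidean_space \<Rightarrow> real"
  assumes f: "integrable lborel f" and nn: "\<And>x. f x \<ge> 0" and r: "r > 0"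
    and fin: "hl_maximal (\<lambda>x. ennreal (f x)) x < \<infinity>"
  shows "ball_avg f x r \<le> enn2real (hl_maximal (\<lambda>x. ennreal (f x)) x)"
proof -
  have i: "integrable lborel (\<lambda>y. indicator (ball x r) y * f y)"
    using f integrable_mult_indicator[of "ball x r" lborel f] by simp
  have b: "emeasure lborel (ball x r) = ennreal (measure lborel (ball x r))" "0 < measure lborel (ball x r)"
    using r content_ball_pos[OF r, of x] emeasure_lborel_ball_finite[of x r]
    by (auto simp: emeasure_eq_ennreal_measure)
  have "ennreal (ball_avg f x r) = ennreal (\<integral>y. indicator (ball x r) y * f y \<partial>lborel) / emeasure lborel (ball x r)"
    unfolding ball_avg_def b(1) using b(2) nn by (subst divide_ennreal) auto
  also have "ennreal (\<integral>y. indicator (ball x r) y * f y \<partial>lborel) = (\<integral>\<^sup>+y. ennreal (indicator (ball x r) y * f y) \<partial>lborel)"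
    by (rule nn_integral_eq_integral[symmetric, OF i]) (use nn in auto)
  also have "\<dots> = (\<integral>\<^sup>+ y \<in> ball x r. ennreal (f y) \<partial>lborel)"
    by (intro nn_integral_cong) (auto simp: indicator_def)
  also have "\<dots> / emeasure lborel (ball x r) \<le> hl_maximal (\<lambda>x. ennreal (f x)) x"
    unfolding hl_maximal_def using r by (intro SUP_upper) auto
  finally have "enn2real (ennreal (ball_avg f x r)) \<le> enn2real (hl_maximal (\<lambda>x. ennreal (f x)) x)"
    using fin by (intro enn2real_mono) auto
  then show ?thesis
    using nn by (subst (asm) enn2real_ennreal) (auto simp: ball_avg_def intro!: divide_nonneg_nonneg)
qed

text \<open>Hoelder's inequality up to a factor 2, by cutting at a height s: f is at most s where it
  does not exceed s, and at most \<open>s powr (1 - p) * f x powr p\<close> elsewhere.\<close>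

lemma ball_avg_le_powr:
  fixes f :: "'a::euclidean_space \<Rightarrow> real"
  assumes f: "integrable lborel f" and nn: "\<And>x. f x \<ge> 0" and r: "r > 0" and p: "p > 1"
    and fp: "integrable lborel (\<lambda>x. f x powr p)"
  shows "ball_avg f x r \<le> 2 * ((\<integral>x. f x powr p \<partial>lborel) / measure lborel (ball x r)) powr (1 / p)"
proof -
  define V where "V = measure lborel (ball x r)"
  have V: "V > 0" unfolding V_def using r by (rule content_ball_pos)
  define I where "I = (\<integral>x. f x powr p \<partial>lborel)"
  have I: "I \<ge> 0" unfolding I_def by (intro Bochner_Integration.integral_nonneg) auto
  have i: "integrable lborel (\<lambda>y. indicator (ball x r) y * f y)"
    using f integrable_mult_indicator[of "ball x r" lborel f] by simp
  have ii: "integrable lborel (\<lambda>y. indicator (ball x r) y :: real)"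
    using emeasure_lborel_ball_finite[of x r] by (intro integrable_real_indicator) auto
  have bd: "ball_avg f x r \<le> s + s powr (1 - p) * (I / V)" if s: "s > 0" for s
  proof -
    have "(\<integral>y. indicator (ball x r) y * f y \<partial>lborel) \<le> (\<integral>y. s * indicator (ball x r) y + s powr (1 - p) * f y powr p \<partial>lborel)"
    proof (rule Bochner_Integration.integral_mono[OF i])
      show "integrable lborel (\<lambda>y. s * indicator (ball x r) y + s powr (1 - p) * f y powr p)"
        using ii fp by auto
      fix y
      show "indicator (ball x r) y * f y \<le> s * indicator (ball x r) y + s powr (1 - p) * f y powr p"
      proof (cases "y \<in> ball x r \<and> s < f y")
        case True
        then have fy: "f y > 0" using s by linarith
        have "f y = f y powr (1 - p) * f y powr p" using fy by (simp add: powr_add[symmetric])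
        also have "\<dots> \<le> s powr (1 - p) * f y powr p"
          using True s p by (intro mult_right_mono powr_mono2') auto
        finally show ?thesis using True s by simp
      next
        case False
        then show ?thesis using s by (auto simp: indicator_def intro: add_increasing2)
      qed
    qed
    also have "\<dots> = s * V + s powr (1 - p) * I"
      using ii fp unfolding V_def I_def by simp
    finally have "ball_avg f x r \<le> (s * V + s powr (1 - p) * I) / V"
      unfolding ball_avg_def V_def[symmetric] using V by (intro divide_right_mono) auto
    also have "\<dots> = s + s powr (1 - p) * (I / V)" using V by (simp add: field_simps)
    finally show ?thesis .
  qed
  show ?thesis
  \<comment> \<open>For \<open>I = 0\<close> the bound tends to 0 with s; otherwise
    \<open>s = (I / V) powr (1 / p)\<close> makes the two terms equal.\<close>
  proof (cases "I = 0")
    case True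
    then have "ball_avg f x r \<le> 0 + s" if "s > 0" for s
      using bd[OF that] by simp
    then have "ball_avg f x r \<le> 0" by (rule field_le_epsilon)
    then show ?thesis using True by (simp add: I_def)
  next
    case False
    define s where "s = (I / V) powr (1 / p)"
    have IV: "I / V > 0" using False I V by simp
    have s: "s > 0" unfolding s_def using IV by (subst powr_gt_zero) linarith
    have "s powr p = (I / V) powr 1" using p by (simp only: s_def powr_powr) simp
    then have "s powr (1 - p) * (I / V) = s powr (1 - p) * s powr p"
      using IV by (simp only: powr_one)
    also have "\<dots> = s" using s by (simp add: powr_add[symmetric])
    finally show ?thesis using bd[OF s] unfolding s_def I_def V_def by simp
  qed
qed

text \<open>Hedberg's trick: \<open>r\<^sup>a\<close> times the average is an interpolation between the maximal function and
  the Hoelder bound of the average by the \<open>L\<^sup>p\<close> norm.\<close>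

theorem fractional_maximal_bound:
  fixes p q a :: real
  assumes p: "1 < p" and a: "0 \<le> a" and q: "1 / q = 1 / p - a / DIM('a)" "0 < q"
  shows "\<exists>C>0. \<forall>f :: 'a::euclidean_space \<Rightarrow> real.
    (\<forall>x. 0 \<le> f x) \<and> integrable lborel f \<and> integrable lborel (\<lambda>x. f x powr p) \<longrightarrow>
    (\<exists>G. G \<in> borel_measurable borel \<and> (\<forall>x. 0 \<le> G x) \<and>
      (AE x in lborel. \<forall>r>0. r powr a * ball_avg f x r \<le> G x) \<and>
      integrable lborel (\<lambda>x. G x powr q) \<and>
      (\<integral>x. G x powr q \<partial>lborel) powr (1 / q) \<le> C * (\<integral>x. f x powr p \<partial>lborel) powr (1 / p))"
proof -
  define n where "n = real DIM('a)"
  have n: "n > 0" by (simp add: n_def)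
  \<comment> \<open>The exponent makes \<open>r powr a\<close> cancel the power of r in the Hoelder
    bound, which after interpolation is r^(-n \<theta> / p) = r^(-a); the relation between p and q
    turns 1 - \<theta> into p / q.\<close>
  define \<theta> where "\<theta> = a * p / n"
  have th1: "1 - \<theta> = p / q" using q p n unfolding \<theta>_def n_def by (simp add: field_simps)
  have th0: "\<theta> \<ge> 0" using a p n by (simp add: \<theta>_def)
  have th2: "\<theta> < 1" using th1 p q by (smt (verit) divide_pos_pos)
  have pq: "p * (1 / q) = p / q" by simp
  define \<omega> where "\<omega> = measure lborel (ball (0::'a) 1)"
  have \<omega>: "\<omega> > 0" unfolding \<omega>_def by (rule content_ball_pos) simp
  define K where "K = p / (p - 1) * 2 powr p * 5 ^ DIM('a)"
  have K: "K > 0" using p by (simp add: K_def)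
  \<comment> \<open>Obtained from \<open>c * (K * I) powr (1 / q)\<close> with c defined below; the
    powers of I combine to \<open>I powr (1 / p)\<close> because \<theta> / p + 1 / q = 1 /
    p.\<close>
  define C where "C = 2 powr \<theta> * (1 / \<omega>) powr (\<theta> / p) * K powr (1 / q)"
  have "C > 0" using \<omega> K by (simp add: C_def)
  moreover have "\<exists>G. G \<in> borel_measurable borel \<and> (\<forall>x. 0 \<le> G x) \<and>
      (AE x in lborel. \<forall>r>0. r powr a * ball_avg f x r \<le> G x) \<and>
      integrable lborel (\<lambda>x. G x powr q) \<and>
      (\<integral>x. G x powr q \<partial>lborel) powr (1 / q) \<le> C * (\<integral>x. f x powr p \<partial>lborel) powr (1 / p)"
    if nn: "\<And>x. 0 \<le> f x" and f: "integrable lborel f" and fp: "integrable lborel (\<lambda>x. f x powr p)"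
    for f :: "'a \<Rightarrow> real"
  proof -
    define I where "I = (\<integral>x. f x powr p \<partial>lborel)"
    have I: "I \<ge> 0" unfolding I_def by (intro Bochner_Integration.integral_nonneg) auto
    have fm[measurable]: "f \<in> borel_measurable borel" using f by auto
    define H where "H = hl_maximal (\<lambda>x. ennreal (f x))"
    have [measurable]: "H \<in> borel_measurable borel" unfolding H_def by measurable
    define m where "m x = enn2real (H x)" for x
    have [measurable]: "m \<in> borel_measurable borel" unfolding m_def by measurable
    have m0: "m x \<ge> 0" for x by (simp add: m_def)
    define c where "c = 2 powr \<theta> * (I / \<omega>) powr (\<theta> / p)"
    have c: "c \<ge> 0" by (simp add: c_def)
    \<comment> \<open>A majorant independent of r. Where H is infinite, \<open>m\<close> is 0 and
      the bound may fail, but this exceptional set is null and the same for all r.\<close>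
    define G where "G x = c * m x powr (p / q)" for x
    have G0: "G x \<ge> 0" for x using c by (simp add: G_def)
    have Gm[measurable]: "G \<in> borel_measurable borel" unfolding G_def by measurable
    have fin: "AE x in lborel. H x < \<infinity>"
      unfolding H_def
    proof (rule hl_maximal_finite_AE)
      show "(\<integral>\<^sup>+x. ennreal (f x) \<partial>lborel) < \<infinity>"
        using nn_integral_eq_integral[OF f] nn by simp
    qed measurable
    have bound: "r powr a * ball_avg f x r \<le> G x" if r: "r > 0" and x: "H x < \<infinity>" for r x
    proof -
      define A where "A = ball_avg f x r"
      have A0: "A \<ge> 0" unfolding A_def ball_avg_def using nn
        by (intro divide_nonneg_nonneg Bochner_Integration.integral_nonneg) auto
      have A1: "A \<le> m x"
        unfolding A_def m_def H_def using ball_avg_le_hl_maximal[OF f nn r] x by (simp add: H_def)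
      have V: "measure lborel (ball x r) = \<omega> * r powr n"
        using content_ball_conv_unit_ball[of r x] r by (simp add: \<omega>_def n_def powr_realpow)
      have A2: "A \<le> 2 * (I / (\<omega> * r powr n)) powr (1 / p)"
        unfolding A_def I_def V[symmetric] by (rule ball_avg_le_powr[OF f nn r p fp])
      have "r powr a * A = r powr a * (A powr \<theta> * A powr (1 - \<theta>))"
        using A0 by (cases "A = 0") (auto simp: powr_add[symmetric])
      also have "\<dots> \<le> r powr a * ((2 * (I / (\<omega> * r powr n)) powr (1 / p)) powr \<theta> * m x powr (1 - \<theta>))"
        using A0 A1 A2 th0 th2 by (intro mult_left_mono mult_mono powr_mono2) auto
      also have "\<dots> = G x"
      proof -
        have "(2 * (I / (\<omega> * r powr n)) powr (1 / p)) powr \<theta> = 2 powr \<theta> * (I / (\<omega> * r powr n)) powr (\<theta> / p)"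
          by (simp add: powr_mult powr_powr)
        also have "I / (\<omega> * r powr n) = (I / \<omega>) * r powr (- n)"
          using r by (simp add: powr_minus divide_simps)
        also have "((I / \<omega>) * r powr (- n)) powr (\<theta> / p) = (I / \<omega>) powr (\<theta> / p) * r powr (- a)"
        proof -
          have "- n * (\<theta> / p) = - a" using n p by (simp add: \<theta>_def)
          then show ?thesis using I \<omega> by (subst powr_mult) (auto simp: powr_powr)
        qed
        finally show ?thesis
          using r by (simp add: G_def c_def th1 powr_minus field_simps)
      qed
      finally show ?thesis by (simp add: A_def)
    qed
    have AEb: "AE x in lborel. \<forall>r>0. r powr a * ball_avg f x r \<le> G x"
      using fin by eventually_elim (use bound in auto)
    have Gq: "G x powr q = c powr q * m x powr p" for x
      using c m0[of x] q(2) by (simp add: G_def powr_mult powr_powr)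
    have "(\<integral>\<^sup>+x. ennreal (G x powr q) \<partial>lborel) = (\<integral>\<^sup>+x. ennreal (c powr q) * ennreal (m x powr p) \<partial>lborel)"
      by (intro nn_integral_cong) (simp add: Gq ennreal_mult)
    also have "\<dots> = ennreal (c powr q) * (\<integral>\<^sup>+x. ennreal (m x powr p) \<partial>lborel)"
      by (rule nn_integral_cmult) measurable
    also have "\<dots> \<le> ennreal (c powr q) * (ennreal K * (\<integral>\<^sup>+x. ennreal (f x powr p) \<partial>lborel))"
      unfolding m_def H_def K_def by (intro mult_left_mono hl_maximal_strong_type fm nn p) auto
    also have "(\<integral>\<^sup>+x. ennreal (f x powr p) \<partial>lborel) = ennreal I"
      unfolding I_def by (rule nn_integral_eq_integral[OF fp]) auto
    also have "ennreal (c powr q) * (ennreal K * ennreal I) = ennreal (c powr q * (K * I))"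
      using K I by (simp add: ennreal_mult)
    finally have le: "(\<integral>\<^sup>+x. ennreal (G x powr q) \<partial>lborel) \<le> ennreal (c powr q * (K * I))" .
    have Gi: "integrable lborel (\<lambda>x. G x powr q)"
    proof (rule integrableI_bounded)
      show "(\<integral>\<^sup>+x. ennreal (norm (G x powr q)) \<partial>lborel) < \<infinity>"
        using le by (simp add: le_less_trans)
    qed measurable
    have "(\<integral>x. G x powr q \<partial>lborel) \<le> c powr q * (K * I)"
      using le nn_integral_eq_integral[OF Gi] K I by (auto simp: ennreal_le_iff)
    then have "(\<integral>x. G x powr q \<partial>lborel) powr (1 / q) \<le> (c powr q * (K * I)) powr (1 / q)"
      using q(2) by (intro powr_mono2) (auto intro: Bochner_Integration.integral_nonneg)
    also have "\<dots> = c * (K powr (1 / q) * I powr (1 / q))"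
      using K I c q(2) by (simp add: powr_mult powr_powr)
    also have "\<dots> = C * (I powr (\<theta> / p) * I powr (1 / q))"
    proof -
      have "(I / \<omega>) powr (\<theta> / p) = I powr (\<theta> / p) * (1 / \<omega>) powr (\<theta> / p)"
        using I \<omega> powr_mult[of I "1 / \<omega>" "\<theta> / p"] by simp
      then show ?thesis by (simp add: c_def C_def mult_ac)
    qed
    also have "I powr (\<theta> / p) * I powr (1 / q) = I powr (1 / p)"
    proof -
      have "\<theta> / p + 1 / q = 1 / p" using q(1) p unfolding \<theta>_def n_def by simp
      then show ?thesis by (simp add: powr_add[symmetric])
    qed
    finally show ?thesis
      using Gm G0 AEb Gi unfolding I_def by blast
  qed
  ultimately show ?thesis by blast
qed

section \<open>Weak limits of bounded functions\<close>

text \<open>Instead of weak-* compactness of the unit ball of \<open>L\<^sup>\<infinity>\<close>: the candidates \<open>S m\<close> form a decreasing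
  sequence of convex sets, and by the parallelogram law elements of nearly minimal \<open>L\<^sup>2\<close> norm form a Cauchy
  sequence.\<close>

theorem bounded_weak_limit:
  fixes c :: "nat \<Rightarrow> 'a \<Rightarrow> real" and N :: "'a measure" and T :: "('a \<Rightarrow> real) set"
  assumes "finite_measure N" and c[measurable]: "\<And>k. c k \<in> borel_measurable N"
    and c1: "\<And>k x. \<bar>c k x\<bar> \<le> 1"
    and Tm: "\<And>\<psi>. \<psi> \<in> T \<Longrightarrow> \<psi> \<in> borel_measurable N"
    and Tb: "\<And>\<psi>. \<psi> \<in> T \<Longrightarrow> \<exists>B. \<forall>x. \<bar>\<psi> x\<bar> \<le> B"
    and lim: "\<And>\<psi>. \<psi> \<in> T \<Longrightarrow> (\<lambda>k. \<integral>x. c k x * \<psi> x \<partial>N) \<longlonglongrightarrow> L \<psi>"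
  shows "\<exists>w. w \<in> borel_measurable N \<and> (\<forall>x. \<bar>w x\<bar> \<le> 1) \<and> (\<forall>\<psi>\<in>T. (\<integral>x. w x * \<psi> x \<partial>N) = L \<psi>)"
proof -
  interpret finite_measure N by fact
  have bint: "integrable N f" if "f \<in> borel_measurable N" "\<And>x. \<bar>f x\<bar> \<le> B" for f :: "'a \<Rightarrow> real" and B
    by (rule integrable_const_bound[of f B]) (use that in auto)
  \<comment> \<open>A member of \<open>S m\<close> satisfies every estimate around
    \<open>L \<psi>\<close> that the whole tail of c from index m satisfies. This plays the role of
    the closed convex hull of the tail.\<close>
  define S where "S m = {y \<in> borel_measurable N. (\<forall>x. \<bar>y x\<bar> \<le> 1) \<and>
     (\<forall>\<psi>\<in>T. \<forall>b. (\<forall>k\<ge>m. \<bar>(\<integral>x. c k x * \<psi> x \<partial>N) - L \<psi>\<bar> \<le> b) \<longrightarrow> \<bar>(\<integral>x. y x * \<psi> x \<partial>N) - L \<psi>\<bar> \<le> b)}" for m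
  have Sm[measurable_dest]: "y \<in> borel_measurable N" if "y \<in> S m" for y m using that by (simp add: S_def)
  have S1: "\<bar>y x\<bar> \<le> 1" if "y \<in> S m" for y m x using that by (simp add: S_def)
  have cS: "c m \<in> S m" for m by (auto simp: S_def c1)
  have Santi: "S j \<subseteq> S m" if "m \<le> j" for m j
  proof
    fix y assume y: "y \<in> S j"
    have "\<bar>(\<integral>x. y x * \<psi> x \<partial>N) - L \<psi>\<bar> \<le> b" if "\<psi> \<in> T" "\<forall>k\<ge>m. \<bar>(\<integral>x. c k x * \<psi> x \<partial>N) - L \<psi>\<bar> \<le> b" for \<psi> b
      using y that \<open>m \<le> j\<close> unfolding S_def by (auto dest: order_trans)
    then show "y \<in> S m" using y by (simp add: S_def)
  qed
  have prodint: "integrable N (\<lambda>x. y x * \<psi> x)" if y: "y \<in> S m" and \<psi>: "\<psi> \<in> T" for y \<psi> m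
  proof -
    obtain B where B: "\<And>x. \<bar>\<psi> x\<bar> \<le> B" using Tb[OF \<psi>] by blast
    have "\<bar>y x * \<psi> x\<bar> \<le> B" for x
      using mult_mono[OF S1[OF y, of x] B[of x]] by (simp add: abs_mult)
    then show ?thesis using Sm[OF y] Tm[OF \<psi>] by (intro bint) auto
  qed
  have sqint: "integrable N (\<lambda>x. (y x)\<^sup>2)" if y: "y \<in> S m" for y m
  proof (rule bint[of _ 1])
    show "(\<lambda>x. (y x)\<^sup>2) \<in> borel_measurable N" using Sm[OF y] by measurable
    show "\<bar>(y x)\<^sup>2\<bar> \<le> 1" for x using S1[OF y, of x] by (simp add: abs_square_le_1)
  qed
  have conv: "(\<lambda>x. (y x + z x) / 2) \<in> S m" if y: "y \<in> S m" and z: "z \<in> S m" for y z m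
  proof -
    have m: "(\<lambda>x. (y x + z x) / 2) \<in> borel_measurable N"
      using Sm[OF y] Sm[OF z] by measurable
    have b: "\<bar>(y x + z x) / 2\<bar> \<le> 1" for x
      using S1[OF y, of x] S1[OF z, of x] unfolding abs_le_iff by simp
    have "\<bar>(\<integral>x. (y x + z x) / 2 * \<psi> x \<partial>N) - L \<psi>\<bar> \<le> b" if "\<psi> \<in> T" "\<forall>k\<ge>m. \<bar>(\<integral>x. c k x * \<psi> x \<partial>N) - L \<psi>\<bar> \<le> b" for \<psi> b
    proof -
      have "(\<integral>x. (y x + z x) / 2 * \<psi> x \<partial>N) = (\<integral>x. (y x * \<psi> x + z x * \<psi> x) / 2 \<partial>N)"
        by (intro Bochner_Integration.integral_cong) (auto simp: field_simps)
      also have "\<dots> = ((\<integral>x. y x * \<psi> x \<partial>N) + (\<integral>x. z x * \<psi> x \<partial>N)) / 2"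
        using prodint[OF y that(1)] prodint[OF z that(1)] by simp
      finally have eq: "(\<integral>x. (y x + z x) / 2 * \<psi> x \<partial>N) = ((\<integral>x. y x * \<psi> x \<partial>N) + (\<integral>x. z x * \<psi> x \<partial>N)) / 2" .
      have "\<bar>(\<integral>x. y x * \<psi> x \<partial>N) - L \<psi>\<bar> \<le> b" "\<bar>(\<integral>x. z x * \<psi> x \<partial>N) - L \<psi>\<bar> \<le> b"
        using y z that unfolding S_def by auto
      then show ?thesis unfolding eq by (simp add: field_simps abs_le_iff)
    qed
    with m b show ?thesis by (simp add: S_def)
  qed
  define E where "E y = (\<integral>x. (y x)\<^sup>2 \<partial>N)" for y :: "'a \<Rightarrow> real"
  have E0: "E y \<ge> 0" for y unfolding E_def by (intro Bochner_Integration.integral_nonneg) auto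
  define a where "a m = Inf (E ` S m)" for m
  have bdd: "bdd_below (E ` S m)" for m using E0 by (auto intro!: bdd_belowI[of _ 0])
  have ne: "E ` S m \<noteq> {}" for m using cS by auto
  have aE: "a m \<le> E y" if "y \<in> S m" for m y unfolding a_def using that bdd by (intro cInf_lower) auto
  \<comment> \<open>The sets \<open>S m\<close> decrease, so their minimal energies increase; being
    bounded by the total mass, they converge.\<close>
  have "incseq a"
    unfolding incseq_def a_def using Santi by (intro allI impI cInf_superset_mono[OF ne bdd]) auto
  moreover have aub: "a m \<le> measure N (space N)" for m
  proof -
    have "a m \<le> E (c m)" by (rule aE[OF cS])
    also have "\<dots> \<le> (\<integral>x. 1 \<partial>N)"
      unfolding E_def using sqint[OF cS, of m] c1
      by (intro Bochner_Integration.integral_mono) (auto simp: abs_square_le_1)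
    finally show ?thesis by simp
  qed
  ultimately obtain A where A: "a \<longlonglongrightarrow> A" "\<And>m. a m \<le> A"
    using incseq_convergent[of a "measure N (space N)"] by blast
  have "\<exists>y\<in>S m. E y < a m + inverse (Suc m)" for m
  proof -
    have "Inf (E ` S m) < a m + inverse (Suc m)" by (simp add: a_def)
    then show ?thesis using cInf_lessD[OF ne] by blast
  qed
  then obtain y where y: "\<And>m. y m \<in> S m" "\<And>m. E (y m) < a m + inverse (Suc m)" by metis
  \<comment> \<open>The midpoint of \<open>y m\<close> and \<open>y j\<close> lies in
    \<open>S m\<close> by convexity, so its energy is at least \<open>a m\<close>; the parallelogram
    identity then bounds the energy of the difference.\<close>
  have cauchy: "E (\<lambda>x. y m x - y j x) \<le> 4 * (A - a m) + 4 * inverse (Suc m)" if "m \<le> j" for m j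
  proof -
    have yj: "y j \<in> S m" using y(1) Santi[OF that] by blast
    have "E (\<lambda>x. y m x - y j x) = (\<integral>x. 2 * (y m x)\<^sup>2 + 2 * (y j x)\<^sup>2 - 4 * ((y m x + y j x) / 2)\<^sup>2 \<partial>N)"
      unfolding E_def by (intro Bochner_Integration.integral_cong) (auto simp: power2_eq_square field_simps)
    also have "\<dots> = 2 * E (y m) + 2 * E (y j) - 4 * E (\<lambda>x. (y m x + y j x) / 2)"
      unfolding E_def using sqint[OF y(1)] sqint[OF yj] sqint[OF conv[OF y(1) yj]] by simp
    also have "\<dots> \<le> 2 * (a m + inverse (Suc m)) + 2 * (a j + inverse (Suc j)) - 4 * a m"
      using y(2)[of m] y(2)[of j] aE[OF conv[OF y(1) yj]] by argo
    also have "\<dots> \<le> 2 * (a m + inverse (Suc m)) + 2 * (A + inverse (Suc m)) - 4 * a m"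
      proof -
      have "inverse (real (Suc j)) \<le> inverse (real (Suc m))" using that by (intro le_imp_inverse_le) auto
      then show ?thesis using A(2)[of j] by argo
    qed
    also have "\<dots> \<le> 4 * (A - a m) + 4 * inverse (Suc m)" using A(2)[of m] by argo
    finally show ?thesis .
  qed
  have "(\<lambda>m. 4 * (A - a m) + 4 * inverse (Suc m)) \<longlonglongrightarrow> 4 * (A - A) + 4 * 0"
    by (intro tendsto_intros A LIMSEQ_inverse_real_of_nat)
  then have to0: "(\<lambda>m. 4 * (A - a m) + 4 * inverse (Suc m)) \<longlonglongrightarrow> 0" by simp
  have "\<exists>M. \<forall>m\<ge>M. 4 * (A - a m) + 4 * inverse (Suc m) < (1 / 4) ^ k" for k
    using order_tendstoD(2)[OF to0, of "(1 / 4) ^ k"] by (simp add: eventually_sequentially)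
  then obtain M where M: "\<And>k m. m \<ge> M k \<Longrightarrow> 4 * (A - a m) + 4 * inverse (Suc m) < (1 / 4) ^ k" by metis
  \<comment> \<open>The partial sums make the indices nondecreasing and at least \<open>M k\<close>;
    the summand k makes them tend to infinity.\<close>
  define r where "r k = (\<Sum>i\<le>k. M i) + k" for k
  have rM: "r k \<ge> M k" for k unfolding r_def by (simp add: member_le_sum trans_le_add1)
  have rk: "r k \<ge> k" for k by (simp add: r_def)
  have rS: "r k \<le> r (Suc k)" for k by (simp add: r_def)
  define z where "z k x = y (r k) x - y (r (Suc k)) x" for k x
  have ym[measurable]: "y m \<in> borel_measurable N" for m using Sm[OF y(1)] .
  have zm[measurable]: "z k \<in> borel_measurable N" for k unfolding z_def by measurable
  have zE: "E (z k) \<le> (1 / 4) ^ k" for k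
    using cauchy[OF rS[of k]] M[OF rM[of k]] by (simp add: z_def[abs_def])
  have zi: "integrable N (\<lambda>x. (z k x)\<^sup>2)" for k
  proof (rule bint[of _ 4])
    show "\<bar>(z k x)\<^sup>2\<bar> \<le> 4" for x
    proof -
      have "\<bar>z k x\<bar> \<le> 2" using S1[OF y(1), of "r k" x] S1[OF y(1), of "r (Suc k)" x] unfolding z_def abs_le_iff by argo
      then have "\<bar>z k x\<bar>\<^sup>2 \<le> 2\<^sup>2" by (intro power_mono) auto
      then show ?thesis by simp
    qed
  qed measurable
  \<comment> \<open>Since \<open>E (z k)\<close> is at most 4^(-k), the weight 2^k still leaves a
    convergent series, so the weighted sum of squares is finite almost everywhere.\<close>
  have "(\<integral>\<^sup>+x. (\<Sum>k. ennreal (2 ^ k * (z k x)\<^sup>2)) \<partial>N) = (\<Sum>k. \<integral>\<^sup>+x. ennreal (2 ^ k * (z k x)\<^sup>2) \<partial>N)"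
    by (rule nn_integral_suminf) measurable
  also have "\<dots> \<le> (\<Sum>k. ennreal ((1 / 2) ^ k))"
  proof (intro suminf_le allI)
    fix k
    have "(\<integral>\<^sup>+x. ennreal (2 ^ k * (z k x)\<^sup>2) \<partial>N) = ennreal (\<integral>x. 2 ^ k * (z k x)\<^sup>2 \<partial>N)"
      using zi by (intro nn_integral_eq_integral) auto
    also have "(\<integral>x. 2 ^ k * (z k x)\<^sup>2 \<partial>N) = 2 ^ k * E (z k)" by (simp add: E_def)
    also have "ennreal (2 ^ k * E (z k)) \<le> ennreal (2 ^ k * (1 / 4) ^ k)"
      using zE by (intro ennreal_leI mult_left_mono) auto
    also have "(2 ^ k * (1 / 4) ^ k :: real) = (1 / 2) ^ k" by (simp add: power_mult_distrib[symmetric])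
    finally show "(\<integral>\<^sup>+x. ennreal (2 ^ k * (z k x)\<^sup>2) \<partial>N) \<le> ennreal ((1 / 2) ^ k)" .
  qed auto
  also have "\<dots> < \<infinity>"
    by (subst suminf_ennreal_eq[where x = 2]) (use geometric_sums[of "1 / 2 :: real"] in auto)
  finally have "AE x in N. (\<Sum>k. ennreal (2 ^ k * (z k x)\<^sup>2)) \<noteq> \<infinity>"
    by (intro nn_integral_noteq_infinite) auto
  then have convAE: "AE x in N. convergent (\<lambda>k. y (r k) x)"
  proof eventually_elim
    case (elim x)
    have sq: "summable (\<lambda>k. 2 ^ k * (z k x)\<^sup>2)"
      by (rule summable_suminf_not_top) (use elim in auto)
    have "summable (\<lambda>k. (1 / 2) ^ k + 2 ^ k * (z k x)\<^sup>2)"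
      by (intro summable_add sq summable_geometric) auto
    then have "summable (\<lambda>k. z k x)"
    proof (rule summable_comparison_test')
      fix k :: nat assume "k \<ge> 0"
      \<comment> \<open>From squares to absolute values: if \<open>\<bar>z k x\<bar>\<close> exceeds
        2^(-k), then it is at most 2^k times its square.\<close>
      show "norm (z k x) \<le> (1 / 2) ^ k + 2 ^ k * (z k x)\<^sup>2"
      proof (cases "\<bar>z k x\<bar> \<le> (1 / 2) ^ k")
        case True
        then show ?thesis by (simp add: add_increasing2)
      next
        case False
        have "\<bar>z k x\<bar> = 2 ^ k * ((1 / 2) ^ k * \<bar>z k x\<bar>)"
          by (simp add: power_one_over)
        also have "\<dots> \<le> 2 ^ k * (\<bar>z k x\<bar> * \<bar>z k x\<bar>)"
          using False by (intro mult_left_mono mult_right_mono) auto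
        finally show ?thesis by (simp add: power2_eq_square add_increasing)
      qed
    qed
    then have "convergent (\<lambda>n. \<Sum>k<n. z k x)" by (simp only: summable_iff_convergent)
    moreover have "(\<Sum>k<n. z k x) = y (r 0) x - y (r n) x" for n
      by (induction n) (auto simp: z_def)
    ultimately have "convergent (\<lambda>n. y (r 0) x - y (r n) x)" by simp
    then have "convergent (\<lambda>n. y (r 0) x - (y (r 0) x - y (r n) x))"
      by (rule convergent_diff[OF convergent_const])
    then show ?case by simp
  qed
  \<comment> \<open>Clamping to [-1, 1] gives the bound at every point, including those where the
    sequence diverges; where it converges, the limit is unchanged.\<close>
  define w where "w x = max (- 1) (min 1 (lim (\<lambda>k. y (r k) x)))" for x
  have wm: "w \<in> borel_measurable N"
    unfolding w_def by measurable
  have w1: "\<bar>w x\<bar> \<le> 1" for x by (auto simp: w_def)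
  have wlim: "AE x in N. (\<lambda>k. y (r k) x) \<longlonglongrightarrow> w x"
    using convAE
  proof eventually_elim
    case (elim x)
    then have l: "(\<lambda>k. y (r k) x) \<longlonglongrightarrow> lim (\<lambda>k. y (r k) x)" by (simp add: convergent_LIMSEQ_iff)
    have "\<bar>lim (\<lambda>k. y (r k) x)\<bar> \<le> 1"
      by (rule tendsto_upperbound[OF tendsto_rabs[OF l]]) (use S1[OF y(1)] in auto)
    then have "w x = lim (\<lambda>k. y (r k) x)" by (auto simp: w_def)
    with l show ?case by simp
  qed
  have "(\<integral>x. w x * \<psi> x \<partial>N) = L \<psi>" if \<psi>: "\<psi> \<in> T" for \<psi>
  proof -
    obtain B where B: "\<And>x. \<bar>\<psi> x\<bar> \<le> B" using Tb[OF \<psi>] by blast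
    have [measurable]: "\<psi> \<in> borel_measurable N" by (rule Tm[OF \<psi>])
    have 1: "(\<lambda>k. \<integral>x. y (r k) x * \<psi> x \<partial>N) \<longlonglongrightarrow> (\<integral>x. w x * \<psi> x \<partial>N)"
    proof (rule integral_dominated_convergence[where w = "\<lambda>_. B"])
      show "AE x in N. (\<lambda>k. y (r k) x * \<psi> x) \<longlonglongrightarrow> w x * \<psi> x"
        using wlim by eventually_elim (intro tendsto_intros)
      show "AE x in N. norm (y (r k) x * \<psi> x) \<le> B" for k
        using mult_mono[OF S1[OF y(1)] B] by (auto simp: abs_mult)
    qed (use wm in measurable)
    \<comment> \<open>\<open>y (r k)\<close> belongs to \<open>S (r k)\<close>, hence its test
      integral is as close to \<open>L \<psi>\<close> as the tail of c from index \<open>r k\<close>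
      is.\<close>
    have 2: "(\<lambda>k. \<integral>x. y (r k) x * \<psi> x \<partial>N) \<longlonglongrightarrow> L \<psi>"
    proof (rule LIMSEQ_I)
      fix e :: real assume e: "e > 0"
      from LIMSEQ_D[OF lim[OF \<psi>], of "e / 2"] e
      obtain n0 where n0: "\<And>n. n \<ge> n0 \<Longrightarrow> norm ((\<integral>x. c n x * \<psi> x \<partial>N) - L \<psi>) < e / 2" by auto
      have "norm ((\<integral>x. y (r k) x * \<psi> x \<partial>N) - L \<psi>) < e" if "k \<ge> n0" for k
      proof -
        have "r k \<ge> n0" using rk[of k] that by simp
        then have "\<forall>n\<ge>r k. \<bar>(\<integral>x. c n x * \<psi> x \<partial>N) - L \<psi>\<bar> \<le> e / 2"
          using n0 by (auto intro!: less_imp_le)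
        then have "\<bar>(\<integral>x. y (r k) x * \<psi> x \<partial>N) - L \<psi>\<bar> \<le> e / 2"
          using y(1)[of "r k"] \<psi> unfolding S_def by blast
        then show ?thesis using e by simp
      qed
      then show "\<exists>n0. \<forall>k\<ge>n0. norm ((\<integral>x. y (r k) x * \<psi> x \<partial>N) - L \<psi>) < e" by blast
    qed
    show ?thesis by (rule LIMSEQ_unique[OF 1 2])
  qed
  with wm w1 show ?thesis by blast
qed

section \<open>Mollifiers\<close>

text \<open>This family is closed under differentiation and contains the standard bump
  \<open>bump1 1 0\<close>, so smoothness reduces to one derivative formula.\<close>

definition bump1 :: "real poly \<Rightarrow> nat \<Rightarrow> real \<Rightarrow> real" where
  "bump1 p m t = (if \<bar>t\<bar> < 1 then poly p t / (1 - t\<^sup>2) ^ m * exp (- 1 / (1 - t\<^sup>2)) else 0)"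

text \<open>The numerator of the derivative over the common denominator (1 - t^2)^(m + 2):
  \<open>[:1, 0, -1:]\<close> is 1 - t^2, and the last term stems from the derivative -2 t / (1 -
  t^2)^2 of the exponent.\<close>

definition bump1_deriv_poly :: "real poly \<Rightarrow> nat \<Rightarrow> real poly" where
  "bump1_deriv_poly p m = pderiv p * [:1, 0, -1:]\<^sup>2 + smult (2 * real m) ([:0, 1:] * p * [:1, 0, -1:]) - smult 2 ([:0, 1:] * p)"

text \<open>This is (1 + x / N)^N \<le> exp x with x = 1 / s and N = k + 1.\<close>

lemma exp_minus_inverse_le:
  fixes s :: real
  assumes "s > 0"
  shows "exp (- 1 / s) \<le> real (Suc k) ^ Suc k * s ^ Suc k"
proof -
  have "(1 / s / real (Suc k)) ^ Suc k \<le> (1 + 1 / s / real (Suc k)) ^ Suc k"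
    using assms by (intro power_mono) auto
  also have "\<dots> \<le> exp (1 / s)"
    using assms by (intro exp_ge_one_plus_x_over_n_power_n) (auto intro: order_trans[of _ 0])
  finally have "1 \<le> exp (1 / s) * (real (Suc k) ^ Suc k * s ^ Suc k)"
    using assms by (simp add: power_divide divide_le_eq power_mult_distrib mult_ac del: power_Suc of_nat_Suc)
  then have "exp (- (1 / s)) * 1 \<le> exp (- (1 / s)) * (exp (1 / s) * (real (Suc k) ^ Suc k * s ^ Suc k))"
    by (intro mult_left_mono) auto
  then show ?thesis
    by (simp only: mult.assoc[symmetric] exp_add[symmetric]) (simp del: power_Suc of_nat_Suc)
qed

text \<open>The exponential is at most a multiple of the power m + 2 of 1 - t^2, which cancels the
  denominator and leaves a square. Quadratic vanishing is what gives derivative 0 at 1 and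
  -1.\<close>

lemma bump1_bound: "\<exists>C. \<forall>t. \<bar>bump1 p m t\<bar> \<le> C * (max 0 (1 - t\<^sup>2))\<^sup>2"
proof -
  have "compact ((\<lambda>t. poly p t) ` {-1..1})"
    by (intro compact_continuous_image continuous_intros) auto
  then have "\<exists>B. \<forall>t\<in>{-1..1}. \<bar>poly p t\<bar> \<le> B"
    by (auto dest!: compact_imp_bounded simp: bounded_iff)
  then obtain B where B: "\<And>t. t \<in> {-1..1} \<Longrightarrow> \<bar>poly p t\<bar> \<le> B"
    by blast
  have B0: "B \<ge> 0" using order_trans[OF abs_ge_zero B[of 0]] by simp
  define k where "k = Suc m"
  have "\<bar>bump1 p m t\<bar> \<le> B * real (Suc k) ^ Suc k * (max 0 (1 - t\<^sup>2))\<^sup>2" for t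
  proof (cases "\<bar>t\<bar> < 1")
    case True
    then have s: "1 - t\<^sup>2 > 0" by (simp add: abs_square_less_1)
    have "\<bar>bump1 p m t\<bar> = \<bar>poly p t\<bar> * (exp (- 1 / (1 - t\<^sup>2)) / (1 - t\<^sup>2) ^ m)"
      using True s by (simp add: bump1_def abs_mult)
    also have "\<dots> \<le> B * ((real (Suc k) ^ Suc k * (1 - t\<^sup>2) ^ Suc k) / (1 - t\<^sup>2) ^ m)"
      using True s B0 by (intro mult_mono B divide_right_mono exp_minus_inverse_le) auto
    also have "\<dots> = B * real (Suc k) ^ Suc k * (1 - t\<^sup>2)\<^sup>2"
      using s by (simp add: k_def power2_eq_square)
    finally show ?thesis using s by simp
  qed (use B0 in \<open>simp add: bump1_def\<close>)
  then show ?thesis by blast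
qed

text \<open>Inside the interval this is the quotient rule. At all other points, endpoints included,
  the function is 0 and \<open>bump1_bound\<close> makes the difference quotient at most a multiple
  of \<open>\<bar>s - t\<bar>\<close>.\<close>

lemma bump1_has_derivative:
  "(bump1 p m has_real_derivative bump1 (bump1_deriv_poly p m) (m + 2) t) (at t)"
proof (cases "\<bar>t\<bar> < 1")
  case True
  then have s: "1 - t\<^sup>2 > 0" by (simp add: abs_square_less_1)
  then have s0: "1 - t\<^sup>2 \<noteq> 0" by simp
  define S where "S = 1 - t\<^sup>2"
  have S: "S \<noteq> 0" "S > 0" using s s0 by (auto simp: S_def)
  have "((\<lambda>t. poly p t * inverse ((1 - t\<^sup>2) ^ m) * exp (- inverse (1 - t\<^sup>2))) has_real_derivative
     (poly (pderiv p) t * inverse (S ^ m) + poly p t * (real m * S ^ (m - 1) * (2 * t) * (inverse (S ^ m))\<^sup>2)) * exp (- inverse S)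
     + poly p t * inverse (S ^ m) * (exp (- inverse S) * (- (2 * t) * (inverse S)\<^sup>2))) (at t)"
    unfolding S_def using s0
    by (auto intro!: derivative_eq_intros simp: power2_eq_square algebra_simps)
  also have "(poly (pderiv p) t * inverse (S ^ m) + poly p t * (real m * S ^ (m - 1) * (2 * t) * (inverse (S ^ m))\<^sup>2)) * exp (- inverse S)
     + poly p t * inverse (S ^ m) * (exp (- inverse S) * (- (2 * t) * (inverse S)\<^sup>2))
     = bump1 (bump1_deriv_poly p m) (m + 2) t"
  proof -
    have q: "poly (bump1_deriv_poly p m) t = poly (pderiv p) t * S\<^sup>2 + 2 * real m * (t * poly p t * S) - 2 * (t * poly p t)"
      by (simp add: bump1_deriv_poly_def S_def power2_eq_square algebra_simps)
    have "real m * S ^ (m - 1) * (inverse (S ^ m))\<^sup>2 = real m * (inverse (S ^ m) * inverse S)"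
      using S by (cases m) (auto simp: power2_eq_square field_simps)
    then have *: "real m * S ^ (m - 1) * (2 * t) * (inverse (S ^ m))\<^sup>2 = (2 * t) * (real m * (inverse (S ^ m) * inverse S))"
      by (metis (no_types, lifting) mult.assoc mult.commute)
    have **: "bump1 (bump1_deriv_poly p m) (m + 2) t =
      (poly (pderiv p) t * S\<^sup>2 + 2 * real m * (t * poly p t * S) - 2 * (t * poly p t)) * (inverse (S ^ m) * (inverse S)\<^sup>2) * exp (- inverse S)"
      using True unfolding bump1_def q S_def[symmetric] by (simp add: inverse_eq_divide power_add power2_eq_square)
    have "S * inverse S = 1" using S by simp
    then show ?thesis
      unfolding * ** by algebra
  qed
  finally have *: "((\<lambda>t. poly p t * inverse ((1 - t\<^sup>2) ^ m) * exp (- inverse (1 - t\<^sup>2))) has_real_derivative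
     bump1 (bump1_deriv_poly p m) (m + 2) t) (at t)" .
  show ?thesis
    by (rule has_field_derivative_transform_within_open[OF *, of "{-1<..<1}"])
       (use True in \<open>auto simp: bump1_def divide_inverse\<close>)
next
  case False
  obtain C where C: "\<And>t. \<bar>bump1 p m t\<bar> \<le> C * (max 0 (1 - t\<^sup>2))\<^sup>2"
    using bump1_bound[of p m] by blast
  have C0: "C \<ge> 0" using C[of 0] by (auto intro: order_trans[OF abs_ge_zero])
  have bd: "\<bar>bump1 p m s\<bar> \<le> C * (2 * \<bar>s - t\<bar>)\<^sup>2" for s
  proof -
    \<comment> \<open>As \<open>\<bar>t\<bar> \<ge> 1\<close>, a point s of the interval has
      distance at least 1 - |s| from t, and 1 - s^2 is at most twice 1 - |s|.\<close>
    have "max 0 (1 - s\<^sup>2) \<le> 2 * \<bar>s - t\<bar>"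
    proof (cases "\<bar>s\<bar> < 1")
      case True
      have "1 - s\<^sup>2 = (1 - \<bar>s\<bar>) * (1 + \<bar>s\<bar>)"
        by (simp add: power2_eq_square algebra_simps)
      also have "\<dots> \<le> (1 - \<bar>s\<bar>) * 2" using True by (intro mult_left_mono) auto
      finally have "1 - s\<^sup>2 \<le> (1 - \<bar>s\<bar>) * 2" .
      moreover have "1 - \<bar>s\<bar> \<le> \<bar>s - t\<bar>" using False by linarith
      then have "(1 - \<bar>s\<bar>) * 2 \<le> \<bar>s - t\<bar> * 2" by (rule mult_right_mono) simp
      ultimately show ?thesis by (intro max.boundedI) (simp_all only: mult.commute[of _ 2], auto)
    next
      case False
      then have "1 \<le> s\<^sup>2" by (simp add: abs_square_less_1 not_less[symmetric])
      then show ?thesis by simp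
    qed
    then have "C * (max 0 (1 - s\<^sup>2))\<^sup>2 \<le> C * (2 * \<bar>s - t\<bar>)\<^sup>2"
      using C0 by (intro mult_left_mono power_mono) auto
    with C[of s] show ?thesis by linarith
  qed
  have z: "bump1 q k t = 0" for q k using False by (simp add: bump1_def)
  have "((\<lambda>s. (bump1 p m s - bump1 p m t) / (s - t)) \<longlongrightarrow> 0) (at t)"
  proof (rule Lim_null_comparison)
    show "eventually (\<lambda>s. norm ((bump1 p m s - bump1 p m t) / (s - t)) \<le> 4 * C * \<bar>s - t\<bar>) (at t)"
    proof (rule eventually_at_filter[THEN iffD2], rule always_eventually, intro allI impI)
      fix s assume "s \<noteq> t"
      then show "norm ((bump1 p m s - bump1 p m t) / (s - t)) \<le> 4 * C * \<bar>s - t\<bar>"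
        using bd[of s] unfolding power2_eq_square
        by (simp add: z abs_divide divide_le_eq mult_ac del: abs_mult_self_eq abs_mult_self)
    qed
    show "((\<lambda>s. 4 * C * \<bar>s - t\<bar>) \<longlongrightarrow> 0) (at t)"
      by (auto intro!: tendsto_eq_intros)
  qed
  then show ?thesis by (simp add: has_field_derivative_iff z)
qed

lemma bump1_pos_iff: "bump1 1 0 t > 0 \<longleftrightarrow> \<bar>t\<bar> < 1" and bump1_nonneg: "bump1 1 0 t \<ge> 0"
  by (auto simp: bump1_def)

text \<open>A product of one-dimensional bumps rather than a radial function keeps all partial
  derivatives in one family. The factor c absorbs the chain-rule factor a; negative a and the shifts
  b cover reflected translates.\<close>

definition bump_prod :: "real \<Rightarrow> ('n \<Rightarrow> real poly) \<Rightarrow> ('n \<Rightarrow> nat) \<Rightarrow> real \<Rightarrow> ('n \<Rightarrow> real) \<Rightarrow> real^'n \<Rightarrow> real" where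
  "bump_prod c P m a b \<xi> = c * (\<Prod>j\<in>UNIV. bump1 (P j) (m j) (a * \<xi> $ j + b j))"

lemma bump_prod_has_derivative:
  fixes P :: "'n::finite \<Rightarrow> real poly"
  shows "(bump_prod c P m a b has_derivative
     (\<lambda>h. \<Sum>i\<in>UNIV. h $ i * bump_prod (c * a) (P(i := bump1_deriv_poly (P i) (m i))) (m(i := m i + 2)) a b \<xi>)) (at \<xi>)"
proof -
  have d: "((\<lambda>\<xi>::real^'n. bump1 (P j) (m j) (a * \<xi> $ j + b j)) has_derivative
     (\<lambda>h. h $ j * a * bump1 (bump1_deriv_poly (P j) (m j)) (m j + 2) (a * \<xi> $ j + b j))) (at \<xi>)" for j
  proof -
    have "((\<lambda>\<xi>::real^'n. a * \<xi> $ j + b j) has_derivative (\<lambda>h. a * h $ j)) (at \<xi>)"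
      by (auto intro!: derivative_eq_intros bounded_linear_imp_has_derivative bounded_linear_vec_nth)
    from has_derivative_compose[OF this
      bump1_has_derivative[of "P j" "m j" "a * \<xi> $ j + b j", unfolded has_field_derivative_def]]
    show ?thesis by (simp add: mult_ac)
  qed
  have "((\<lambda>\<xi>. c * (\<Prod>j\<in>UNIV. bump1 (P j) (m j) (a * \<xi> $ j + b j))) has_derivative
    (\<lambda>h. c * (\<Sum>i\<in>UNIV. (h $ i * a * bump1 (bump1_deriv_poly (P i) (m i)) (m i + 2) (a * \<xi> $ i + b i)) *
        (\<Prod>j\<in>UNIV - {i}. bump1 (P j) (m j) (a * \<xi> $ j + b j))))) (at \<xi>)"
    by (intro has_derivative_mult_right has_derivative_prod d)
  moreover have "c * (\<Sum>i\<in>UNIV. (h $ i * a * bump1 (bump1_deriv_poly (P i) (m i)) (m i + 2) (a * \<xi> $ i + b i)) *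
        (\<Prod>j\<in>UNIV - {i}. bump1 (P j) (m j) (a * \<xi> $ j + b j)))
    = (\<Sum>i\<in>UNIV. h $ i * bump_prod (c * a) (P(i := bump1_deriv_poly (P i) (m i))) (m(i := m i + 2)) a b \<xi>)" for h
  proof -
    have "(\<Prod>j\<in>UNIV. bump1 ((P(i := bump1_deriv_poly (P i) (m i))) j) ((m(i := m i + 2)) j) (a * \<xi> $ j + b j))
       = bump1 (bump1_deriv_poly (P i) (m i)) (m i + 2) (a * \<xi> $ i + b i) *
         (\<Prod>j\<in>UNIV - {i}. bump1 (P j) (m j) (a * \<xi> $ j + b j))" for i
      by (subst prod.remove[of _ i]) auto
    then show ?thesis
      by (simp add: bump_prod_def sum_distrib_left mult_ac)
  qed
  ultimately show ?thesis
    unfolding bump_prod_def[abs_def] by simp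
qed

lemma partial_deriv_bump_prod:
  "partial_deriv i (bump_prod c P m a b) = bump_prod (c * a) (P(i := bump1_deriv_poly (P i) (m i))) (m(i := m i + 2)) a b"
proof
  fix \<xi>
  show "partial_deriv i (bump_prod c P m a b) \<xi> = bump_prod (c * a) (P(i := bump1_deriv_poly (P i) (m i))) (m(i := m i + 2)) a b \<xi>"
    unfolding partial_deriv_def frechet_derivative_at[OF bump_prod_has_derivative, symmetric]
    by (simp add: axis_def if_distrib[of "\<lambda>x. x * _"] cong: if_cong)
qed

lemma bump_prod_differentiable: "bump_prod c P m a b differentiable (at \<xi>)"
  using bump_prod_has_derivative unfolding differentiable_def by blast

lemma continuous_bump_prod: "continuous_on UNIV (bump_prod c P m a b)"
  by (intro continuous_at_imp_continuous_on ballI differentiable_imp_continuous_within bump_prod_differentiable)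

lemma C_k_bump_prod: "C_k k (bump_prod c P m a b)"
  by (induction k arbitrary: c P m) (simp_all add: continuous_bump_prod bump_prod_differentiable partial_deriv_bump_prod)

lemma integrable_continuous_cball_support:
  fixes f :: "'a::euclidean_space \<Rightarrow> 'b::euclidean_space"
  assumes "continuous_on UNIV f" and "\<And>x. e \<le> norm x \<Longrightarrow> f x = 0"
  shows "integrable lborel f"
proof -
  have "integrable lborel (\<lambda>x. indicator (cball 0 e) x *\<^sub>R f x)"
    by (rule borel_integrable_compact) (auto intro: continuous_on_subset[OF assms(1)])
  also have "(\<lambda>x. indicator (cball 0 e) x *\<^sub>R f x) = f"
    using assms(2) by (fastforce simp: indicator_def)
  finally show ?thesis .
qed

text \<open>The smoothness of \<xi> \<mapsto> \<eta> (y - \<xi>) is part of the conclusion because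
  mollification at y tests with exactly this function; it is again a \<open>bump_prod\<close>, with
  a = -1 / d.\<close>

lemma mollifier_exists:
  assumes e: "e > 0"
  shows "\<exists>\<eta> :: real^'n \<Rightarrow> real. (\<forall>x. 0 \<le> \<eta> x) \<and> (\<forall>x. e \<le> norm x \<longrightarrow> \<eta> x = 0) \<and> integrable lborel \<eta> \<and>
     (\<integral>x. \<eta> x \<partial>lborel) = 1 \<and> (\<forall>k. C_k k \<eta>) \<and> (\<forall>k y. C_k k (\<lambda>\<xi>. \<eta> (y - \<xi>)))"
proof -
  \<comment> \<open>If \<open>norm x \<ge> e\<close>, the l^1 norm is at least e, so one of the
    coordinates is at least e / n and its bump vanishes.\<close>
  define d where "d = e / real CARD('n)"
  have d: "d > 0" using e by (simp add: d_def)
  define f where "f = (bump_prod 1 (\<lambda>_. 1) (\<lambda>_. 0) (1 / d) (\<lambda>_. 0) :: real^'n \<Rightarrow> real)"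
  have feq: "f x = (\<Prod>j\<in>UNIV. bump1 1 0 (x $ j / d))" for x
    by (simp add: f_def bump_prod_def)
  have fnn: "f x \<ge> 0" for x unfolding feq by (intro prod_nonneg ballI bump1_nonneg)
  have cont: "continuous_on UNIV f" unfolding f_def by (rule continuous_bump_prod)
  have supp: "f x = 0" if "e \<le> norm x" for x
  proof -
    have "\<exists>j. \<bar>x $ j\<bar> \<ge> d"
    proof (rule ccontr)
      assume "\<nexists>j. d \<le> \<bar>x $ j\<bar>"
      then have "(\<Sum>j\<in>UNIV. \<bar>x $ j\<bar>) < (\<Sum>j\<in>(UNIV::'n set). d)"
        by (intro sum_strict_mono) (auto simp: not_le)
      then show False using norm_le_l1_cart[of x] that by (simp add: d_def)
    qed
    then obtain j where "\<bar>x $ j\<bar> \<ge> d" by blast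
    then have "bump1 1 0 (x $ j / d) = 0" using d by (simp add: bump1_def)
    then show ?thesis unfolding feq by (intro prod_zero) auto
  qed
  have int: "integrable lborel f"
    by (rule integrable_continuous_cball_support[OF cont supp])
  have pos: "(\<integral>x. f x \<partial>lborel) > 0"
  proof (rule ccontr)
    assume "\<not> (\<integral>x. f x \<partial>lborel) > 0"
    moreover have "(\<integral>x. f x \<partial>lborel) \<ge> 0"
      using fnn by (intro Bochner_Integration.integral_nonneg) auto
    ultimately have "(\<integral>x. f x \<partial>lborel) = 0" by linarith
    then have AE: "AE x in lborel. f x = 0"
      using integral_nonneg_eq_0_iff_AE[OF int] fnn by simp
    have "AE x in lborel. x \<notin> ball (0::real^'n) d"
      using AE
    proof eventually_elim
      case (elim x)
      show ?case
      proof
        assume x: "x \<in> ball 0 d"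
        have "\<bar>x $ j / d\<bar> < 1" for j
          using x component_le_norm_cart[of x j] d by (simp add: divide_less_eq)
        then have "f x > 0" unfolding feq by (intro prod_pos) (auto simp: bump1_pos_iff)
        with elim show False by simp
      qed
    qed
    moreover have "ball (0::real^'n) d = {x. norm x < d}" by auto
    ultimately have "emeasure lborel (ball (0::real^'n) d) = 0"
      by (subst (asm) AE_iff_measurable[OF _ refl]) auto
    moreover have "measure lborel (ball (0::real^'n) d) > 0"
      using d by (rule content_ball_pos)
    ultimately show False by (simp add: measure_def)
  qed
  define c where "c = 1 / (\<integral>x. f x \<partial>lborel)"
  define \<eta> where "\<eta> x = c * f x" for x
  have eq: "\<eta> = bump_prod c (\<lambda>_. 1) (\<lambda>_. 0) (1 / d) (\<lambda>_. 0)"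
    by (auto simp: \<eta>_def f_def bump_prod_def)
  have eq': "(\<lambda>\<xi>. \<eta> (y - \<xi>)) = bump_prod c (\<lambda>_. 1) (\<lambda>_. 0) (- 1 / d) (\<lambda>j. y $ j / d)" for y
    by (auto simp: eq bump_prod_def diff_divide_distrib intro!: prod.cong)
  have "(\<forall>x. 0 \<le> \<eta> x) \<and> (\<forall>x. e \<le> norm x \<longrightarrow> \<eta> x = 0) \<and> integrable lborel \<eta> \<and>
     (\<integral>x. \<eta> x \<partial>lborel) = 1 \<and> (\<forall>k. C_k k \<eta>) \<and> (\<forall>k y. C_k k (\<lambda>\<xi>. \<eta> (y - \<xi>)))"
  proof (intro conjI allI impI)
    show "integrable lborel \<eta>" unfolding \<eta>_def[abs_def] using int by simp
    show "C_k k \<eta>" for k unfolding eq by (rule C_k_bump_prod)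
    show "C_k k (\<lambda>\<xi>. \<eta> (y - \<xi>))" for k y unfolding eq' by (rule C_k_bump_prod)
  qed (use fnn supp int pos in \<open>auto simp: \<eta>_def c_def\<close>)
  then show ?thesis by blast
qed

section \<open>Mollification\<close>

definition mollify :: "('a::euclidean_space \<Rightarrow> real) \<Rightarrow> ('a \<Rightarrow> 'b::{banach, second_countable_topology}) \<Rightarrow> 'a \<Rightarrow> 'b" where
  "mollify \<eta> u y = (\<integral>\<xi>. \<eta> (y - \<xi>) *\<^sub>R u \<xi> \<partial>lborel)"

lemma lborel_reflect: "distr lborel borel (\<lambda>x. y - x) = (lborel :: 'a::euclidean_space measure)"
  using lborel_affine[of "-1" y] by (simp add: density_1)

lemma integral_reflect_lborel:
  fixes f :: "'a::euclidean_space \<Rightarrow> 'b::{banach, second_countable_topology}"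
  assumes "f \<in> borel_measurable borel"
  shows "(\<integral>x. f (y - x) \<partial>lborel) = (\<integral>x. f x \<partial>lborel)"
  by (subst (2) lborel_reflect[symmetric, of y], subst integral_distr) (use assms in auto)

lemma integrable_reflect_lborel:
  fixes f :: "'a::euclidean_space \<Rightarrow> 'b::{banach, second_countable_topology}"
  assumes "integrable lborel f"
  shows "integrable lborel (\<lambda>x. f (y - x))"
proof -
  have "integrable (distr lborel borel (\<lambda>x. y - x)) f" using assms by (simp add: lborel_reflect)
  then show ?thesis by (subst (asm) integrable_distr_eq) (use assms in auto)
qed

lemma mollify_reflect:
  assumes [measurable]: "\<eta> \<in> borel_measurable borel" "u \<in> borel_measurable borel"
  shows "mollify \<eta> u y = (\<integral>z. \<eta> z *\<^sub>R u (y - z) \<partial>lborel)"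
  unfolding mollify_def using integral_reflect_lborel[of "\<lambda>z. \<eta> z *\<^sub>R u (y - z)" y] by simp

lemma borel_measurable_mollify [measurable]:
  assumes [measurable]: "\<eta> \<in> borel_measurable borel" "u \<in> borel_measurable borel"
  shows "mollify \<eta> u \<in> borel_measurable borel"
  unfolding mollify_def[abs_def] by measurable

text \<open>A mollification is a weighted mean of translates of u by vectors shorter than e, so
  Tonelli reduces the L^1 error to the modulus of continuity of translation.\<close>

lemma mollify_L1_le:
  fixes u :: "'a::euclidean_space \<Rightarrow> 'b::{banach, second_countable_topology}"
  assumes \<eta>: "integrable lborel \<eta>" and nn: "\<And>x. 0 \<le> \<eta> x" and bdd: "\<And>x. \<eta> x \<le> B"
    and supp: "\<And>x. e \<le> norm x \<Longrightarrow> \<eta> x = 0"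
    and one: "(\<integral>x. \<eta> x \<partial>lborel) = 1" and u: "integrable lborel u"
    and tr: "\<And>h. norm h < e \<Longrightarrow> (\<integral>x. norm (u (x + h) - u x) \<partial>lborel) \<le> \<delta>"
  shows "(\<integral>\<^sup>+y. norm (mollify \<eta> u y - u y) \<partial>lborel) \<le> ennreal \<delta>"
proof -
  have \<eta>m[measurable]: "\<eta> \<in> borel_measurable borel" and um[measurable]: "u \<in> borel_measurable borel"
    using \<eta> u by auto
  have pt: "ennreal (norm (mollify \<eta> u y - u y)) \<le> (\<integral>\<^sup>+z. ennreal (\<eta> z) * norm (u (y - z) - u y) \<partial>lborel)" for y
  proof -
    have i1: "integrable lborel (\<lambda>z. \<eta> z *\<^sub>R u (y - z))"
    proof (rule Bochner_Integration.integrable_bound)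
      show "integrable lborel (\<lambda>z. B *\<^sub>R u (y - z))"
        using integrable_reflect_lborel[OF u] by simp
      have "\<bar>\<eta> z\<bar> * norm (u (y - z)) \<le> \<bar>B\<bar> * norm (u (y - z))" for z
        using nn[of z] bdd[of z] by (intro mult_right_mono) auto
      then show "AE z in lborel. norm (\<eta> z *\<^sub>R u (y - z)) \<le> norm (B *\<^sub>R u (y - z))"
        by auto
    qed measurable
    have i2: "integrable lborel (\<lambda>z. \<eta> z *\<^sub>R u y)" using \<eta> by simp
    have "mollify \<eta> u y - u y = (\<integral>z. \<eta> z *\<^sub>R u (y - z) \<partial>lborel) - (\<integral>z. \<eta> z *\<^sub>R u y \<partial>lborel)"
      using \<eta> one by (simp add: mollify_reflect)
    also have "\<dots> = (\<integral>z. \<eta> z *\<^sub>R u (y - z) - \<eta> z *\<^sub>R u y \<partial>lborel)"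
      by (rule Bochner_Integration.integral_diff[symmetric, OF i1 i2])
    finally have eq: "mollify \<eta> u y - u y = (\<integral>z. \<eta> z *\<^sub>R u (y - z) - \<eta> z *\<^sub>R u y \<partial>lborel)" .
    have "ennreal (norm (mollify \<eta> u y - u y)) \<le> (\<integral>\<^sup>+z. norm (\<eta> z *\<^sub>R u (y - z) - \<eta> z *\<^sub>R u y) \<partial>lborel)"
      unfolding eq by (rule integral_norm_bound_ennreal) (use i1 i2 in auto)
    also have "\<dots> = (\<integral>\<^sup>+z. ennreal (\<eta> z) * norm (u (y - z) - u y) \<partial>lborel)"
      using nn by (intro nn_integral_cong) (simp add: scaleR_diff_right[symmetric] ennreal_mult)
    finally show ?thesis .
  qed
  have "(\<integral>\<^sup>+y. norm (mollify \<eta> u y - u y) \<partial>lborel) \<le> (\<integral>\<^sup>+y. \<integral>\<^sup>+z. ennreal (\<eta> z) * norm (u (y - z) - u y) \<partial>lborel \<partial>lborel)"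
    by (intro nn_integral_mono pt)
  also have "\<dots> = (\<integral>\<^sup>+z. \<integral>\<^sup>+y. ennreal (\<eta> z) * norm (u (y - z) - u y) \<partial>lborel \<partial>lborel)"
    by (rule lborel_pair.Fubini') measurable
  also have "\<dots> \<le> (\<integral>\<^sup>+z. ennreal (\<eta> z) * ennreal \<delta> \<partial>lborel)"
  proof (intro nn_integral_mono)
    fix z
    show "(\<integral>\<^sup>+y. ennreal (\<eta> z) * norm (u (y - z) - u y) \<partial>lborel) \<le> ennreal (\<eta> z) * ennreal \<delta>"
    proof (cases "norm z < e")
      case True
      have i: "integrable lborel (\<lambda>x. norm (u (x + (- z)) - u x))"
        using u by (intro integrable_norm Bochner_Integration.integrable_diff integrable_translation)
      have "(\<integral>\<^sup>+y. norm (u (y - z) - u y) \<partial>lborel) = ennreal (\<integral>y. norm (u (y + (- z)) - u y) \<partial>lborel)"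
        using nn_integral_eq_integral[OF i] by simp
      also have "\<dots> \<le> ennreal \<delta>" using True by (intro ennreal_leI tr) simp
      finally show ?thesis by (subst nn_integral_cmult) (auto intro: mult_left_mono)
    next
      case False
      then show ?thesis using supp[of z] by simp
    qed
  qed
  also have "\<dots> = (\<integral>\<^sup>+z. ennreal (\<eta> z) \<partial>lborel) * ennreal \<delta>"
    by (rule nn_integral_multc) measurable
  also have "(\<integral>\<^sup>+z. ennreal (\<eta> z) \<partial>lborel) = 1"
    using nn_integral_eq_integral[OF \<eta>] nn one by simp
  finally show ?thesis by simp
qed

lemma partial_deriv_reflect:
  fixes \<eta> :: "real^'n \<Rightarrow> real"
  assumes "\<And>x. \<eta> differentiable (at x)"
  shows "partial_deriv i (\<lambda>\<xi>. \<eta> (z - \<xi>)) \<xi> = - partial_deriv i \<eta> (z - \<xi>)"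
proof -
  have d: "(\<eta> has_derivative frechet_derivative \<eta> (at (z - \<xi>))) (at (z - \<xi>))"
    using assms by (simp add: frechet_derivative_works[symmetric])
  have "((\<lambda>\<xi>. z - \<xi>) has_derivative (\<lambda>h. - h)) (at \<xi>)"
    by (auto intro!: derivative_eq_intros)
  from has_derivative_compose[OF this d]
  have "frechet_derivative (\<lambda>\<xi>. \<eta> (z - \<xi>)) (at \<xi>) = (\<lambda>h. frechet_derivative \<eta> (at (z - \<xi>)) (- h))"
    by (rule frechet_derivative_at[symmetric])
  moreover have "linear (frechet_derivative \<eta> (at (z - \<xi>)))"
    using d by (rule has_derivative_linear)
  ultimately show ?thesis
    by (simp add: partial_deriv_def linear_neg)
qed

lemma frechet_derivative_partial_deriv:
  fixes \<eta> :: "real^'n \<Rightarrow> real"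
  assumes "\<eta> differentiable (at x)"
  shows "frechet_derivative \<eta> (at x) w = (\<Sum>i\<in>UNIV. w $ i * partial_deriv i \<eta> x)"
proof -
  have l: "linear (frechet_derivative \<eta> (at x))"
    using assms by (simp add: linear_frechet_derivative)
  have "frechet_derivative \<eta> (at x) w = frechet_derivative \<eta> (at x) (\<Sum>i\<in>UNIV. w $ i *\<^sub>R axis i 1)"
    using basis_expansion[of w] by (simp add: scalar_mult_eq_scaleR)
  also have "\<dots> = (\<Sum>i\<in>UNIV. w $ i * partial_deriv i \<eta> x)"
    by (simp add: linear_sum[OF l] linear_cmul[OF l] partial_deriv_def)
  finally show ?thesis .
qed

lemma C_k_all_partial_deriv:
  assumes "\<And>k. C_k k \<eta>"
  shows "\<eta> differentiable (at x)" "continuous_on UNIV \<eta>" "continuous_on UNIV (partial_deriv i \<eta>)"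
  using assms[of 1] assms[of 0] by auto

lemma bounded_continuous_vanishing:
  fixes f :: "'a::euclidean_space \<Rightarrow> real"
  assumes "continuous_on UNIV f" and "\<And>x. e \<le> norm x \<Longrightarrow> f x = 0"
  shows "\<exists>B. \<forall>x. \<bar>f x\<bar> \<le> B"
proof -
  have "compact (f ` cball 0 e)"
    by (intro compact_continuous_image continuous_on_subset[OF assms(1)]) auto
  then have "\<exists>B. \<forall>x\<in>cball 0 e. \<bar>f x\<bar> \<le> B"
    by (auto dest!: compact_imp_bounded simp: bounded_iff)
  then obtain B where "\<forall>x\<in>cball 0 e. \<bar>f x\<bar> \<le> B" by blast
  then have "\<bar>f x\<bar> \<le> max 0 B" for x
    using assms(2)[of x] by (cases "norm x \<le> e") (auto simp: max_def dest!: bspec[of _ _ x])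
  then show ?thesis by blast
qed

lemma partial_deriv_vanish:
  fixes f :: "real^'n \<Rightarrow> real"
  assumes "\<And>x. e \<le> norm x \<Longrightarrow> f x = 0" and "e < norm x"
  shows "partial_deriv i f x = 0"
proof -
  have "(f has_derivative (\<lambda>_. 0)) (at x)"
  proof (rule has_derivative_transform_within_open[of "\<lambda>_. 0" _ _ _ "- cball 0 e"])
    show "0 = f y" if "y \<in> - cball 0 e" for y using assms(1)[of y] that by simp
  qed (use assms in auto)
  then show ?thesis
    unfolding partial_deriv_def by (simp add: frechet_derivative_at[symmetric])
qed

lemma test_function_reflect:
  fixes \<eta> :: "real^'n \<Rightarrow> real"
  assumes C: "\<And>k y. C_k k (\<lambda>\<xi>. \<eta> (y - \<xi>))" and supp: "\<And>x. e \<le> norm x \<Longrightarrow> \<eta> x = 0"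
    and sub: "cball z e \<subseteq> \<Omega>"
  shows "test_function \<Omega> (\<lambda>\<xi>. \<eta> (z - \<xi>))"
proof -
  have "{\<xi>. \<eta> (z - \<xi>) \<noteq> 0} \<subseteq> cball z e"
    using supp by (auto simp: dist_norm) (metis nle_le)
  then have cl: "closure {\<xi>. \<eta> (z - \<xi>) \<noteq> 0} \<subseteq> cball z e"
    by (intro closure_minimal) auto
  then have "compact (closure {\<xi>. \<eta> (z - \<xi>) \<noteq> 0})"
    by (meson bounded_cball bounded_subset closed_closure compact_eq_bounded_closed)
  then show ?thesis
    using C cl sub unfolding test_function_def by auto
qed

text \<open>As long as the balls of radius e along the segment stay in \<Omega>, the gradient of the
  mollified u is the mollified g. The fundamental theorem of calculus is applied to \<eta> for each
  fixed \<xi> and Fubini follows, which avoids differentiating under the integral sign.\<close>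

lemma mollify_segment:
  fixes u :: "real^'n \<Rightarrow> real" and g :: "real^'n \<Rightarrow> real^'n"
  assumes C: "\<And>k. C_k k \<eta>" "\<And>k y. C_k k (\<lambda>\<xi>. \<eta> (y - \<xi>))"
    and supp: "\<And>x. e \<le> norm x \<Longrightarrow> \<eta> x = 0"
    and u: "integrable lborel u" and g: "integrable lborel g"
    and weak: "\<And>\<psi> i. test_function \<Omega> \<psi> \<Longrightarrow>
       (\<integral>x. u x * partial_deriv i \<psi> x \<partial>lborel) = - (\<integral>x. g x $ i * \<psi> x \<partial>lborel)"
    and sub: "\<And>s. s \<in> {0..1} \<Longrightarrow> cball (y + s *\<^sub>R w) e \<subseteq> \<Omega>"
  shows "ennreal \<bar>mollify \<eta> u (y + w) - mollify \<eta> u y\<bar> \<le>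
     (\<integral>\<^sup>+s \<in> {0..1}. ennreal (norm w * norm (mollify \<eta> g (y + s *\<^sub>R w))) \<partial>lborel)"
proof -
  note C' = C_k_all_partial_deriv[OF C(1)]
  have um[measurable]: "u \<in> borel_measurable borel" and gm[measurable]: "g \<in> borel_measurable borel"
    using u g by auto
  have \<eta>m[measurable]: "\<eta> \<in> borel_measurable borel"
    using C'(2) by (rule borel_measurable_continuous_onI)
  have pm[measurable]: "partial_deriv i \<eta> \<in> borel_measurable borel" for i
    using C'(3) by (rule borel_measurable_continuous_onI)
  have gim[measurable]: "(\<lambda>x. g x $ i) \<in> borel_measurable borel" for i
    by (rule measurable_compose[OF gm borel_measurable_continuous_onI]) (intro continuous_intros)
  obtain B where B: "\<And>x. \<bar>\<eta> x\<bar> \<le> B"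
    using bounded_continuous_vanishing[OF C'(2) supp] by blast
  define D where "D x = (\<Sum>i\<in>UNIV. w $ i * partial_deriv i \<eta> x)" for x
  have Dm[measurable]: "D \<in> borel_measurable borel" unfolding D_def by measurable
  have Dc: "continuous_on UNIV D" unfolding D_def by (intro continuous_intros C'(3))
  \<comment> \<open>\<open>partial_deriv_vanish\<close> asks for a strict inequality, since the
    derivative sees a neighbourhood; hence \<open>e + 1\<close>.\<close>
  have "D x = 0" if "e + 1 \<le> norm x" for x :: "real^'n"
    unfolding D_def using partial_deriv_vanish[where e = e and f = \<eta> and x = x] supp that by (intro sum.neutral) auto
  from bounded_continuous_vanishing[OF Dc this] obtain B' where B': "\<And>x. \<bar>D x\<bar> \<le> B'" by blast
  define \<phi> where "\<phi> \<xi> s = u \<xi> * (indicator {0..1} s * D (y + s *\<^sub>R w - \<xi>))" for \<xi> and s :: real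
  have \<phi>m[measurable]: "case_prod \<phi> \<in> borel_measurable (lborel \<Otimes>\<^sub>M lborel)"
    unfolding \<phi>_def[abs_def] split_beta' by measurable
  have i01: "integrable lborel (\<lambda>s. indicator {0..1::real} s :: real)"
    by (intro integrable_real_indicator) auto
  have isi: "integrable lborel (\<phi> \<xi>)" for \<xi>
  proof (rule Bochner_Integration.integrable_bound)
    show "integrable lborel (\<lambda>s. \<bar>u \<xi>\<bar> * B' * indicator {0..1::real} s)" using i01 by simp
    show "AE s in lborel. norm (\<phi> \<xi> s) \<le> norm (\<bar>u \<xi>\<bar> * B' * indicator {0..1::real} s)"
      using B' order_trans[OF abs_ge_zero B'[of 0]] unfolding \<phi>_def
      by (auto simp: abs_mult indicator_def intro!: mult_left_mono)
  qed (unfold \<phi>_def, measurable)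
  have ftc: "(\<integral>s. \<phi> \<xi> s \<partial>lborel) = u \<xi> * (\<eta> (y + w - \<xi>) - \<eta> (y - \<xi>))" for \<xi>
  proof -
    have "(\<integral>s. indicator {0..1} s *\<^sub>R D (y + s *\<^sub>R w - \<xi>) \<partial>lborel) = \<eta> (y + 1 *\<^sub>R w - \<xi>) - \<eta> (y + 0 *\<^sub>R w - \<xi>)"
    proof (rule integral_FTC_atLeastAtMost)
      fix s :: real
      have d: "(\<eta> has_derivative frechet_derivative \<eta> (at (y + s *\<^sub>R w - \<xi>))) (at (y + s *\<^sub>R w - \<xi>))"
        using C'(1) by (simp add: frechet_derivative_works[symmetric])
      have "((\<lambda>s. y + s *\<^sub>R w - \<xi>) has_derivative (\<lambda>h. h *\<^sub>R w)) (at s within {0..1})"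
        by (auto intro!: derivative_eq_intros)
      from has_derivative_compose[OF this d]
      have "((\<lambda>s. \<eta> (y + s *\<^sub>R w - \<xi>)) has_derivative (\<lambda>h. frechet_derivative \<eta> (at (y + s *\<^sub>R w - \<xi>)) (h *\<^sub>R w))) (at s within {0..1})" .
      moreover have "frechet_derivative \<eta> (at (y + s *\<^sub>R w - \<xi>)) (h *\<^sub>R w) = h *\<^sub>R D (y + s *\<^sub>R w - \<xi>)" for h
        unfolding frechet_derivative_partial_deriv[OF C'(1)] D_def by (simp add: sum_distrib_left mult.assoc)
      ultimately show "((\<lambda>s. \<eta> (y + s *\<^sub>R w - \<xi>)) has_vector_derivative D (y + s *\<^sub>R w - \<xi>)) (at s within {0..1})"
        by (simp add: has_vector_derivative_def)
    next
      show "continuous_on {0..1} (\<lambda>s. D (y + s *\<^sub>R w - \<xi>))"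
        by (rule continuous_on_compose2[OF Dc]) (auto intro!: continuous_intros)
    qed simp
    then show ?thesis unfolding \<phi>_def by simp
  qed
  have pair: "integrable (lborel \<Otimes>\<^sub>M lborel) (case_prod \<phi>)"
  proof (rule lborel_pair.Fubini_integrable[OF \<phi>m])
    show "AE \<xi> in lborel. integrable lborel (\<lambda>s. case_prod \<phi> (\<xi>, s))" using isi by simp
    show "integrable lborel (\<lambda>\<xi>. \<integral>s. norm (case_prod \<phi> (\<xi>, s)) \<partial>lborel)"
    proof (rule Bochner_Integration.integrable_bound)
      show "integrable lborel (\<lambda>\<xi>. \<bar>u \<xi>\<bar> * B')" using u by auto
      have "(\<integral>s. norm (\<phi> \<xi> s) \<partial>lborel) \<le> (\<integral>s. (\<bar>u \<xi>\<bar> * B') * indicator {0..1::real} s \<partial>lborel)" for \<xi>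
      proof (rule Bochner_Integration.integral_mono)
        show "norm (\<phi> \<xi> s) \<le> \<bar>u \<xi>\<bar> * B' * indicator {0..1} s" for s
          using B' order_trans[OF abs_ge_zero B'[of 0]] unfolding \<phi>_def
          by (auto simp: abs_mult indicator_def intro!: mult_left_mono)
      qed (use isi i01 in auto)
      also have "(\<integral>s. (\<bar>u \<xi>\<bar> * B') * indicator {0..1::real} s \<partial>lborel) = \<bar>u \<xi>\<bar> * B'" for \<xi>
        by simp
      finally show "AE \<xi> in lborel. norm (\<integral>s. norm (case_prod \<phi> (\<xi>, s)) \<partial>lborel) \<le> norm (\<bar>u \<xi>\<bar> * B')"
        by (auto intro!: AE_I2 order_trans[OF _ abs_ge_self])
    qed measurable
  qed
  have ib: "integrable lborel (\<lambda>\<xi>. u \<xi> * f \<xi>)" if [measurable]: "f \<in> borel_measurable borel" and "\<And>x. \<bar>f x\<bar> \<le> K" for f and K :: real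
  proof (rule Bochner_Integration.integrable_bound[of _ "\<lambda>\<xi>. K * u \<xi>"])
    have "\<bar>u \<xi>\<bar> * \<bar>f \<xi>\<bar> \<le> \<bar>u \<xi>\<bar> * \<bar>K\<bar>" for \<xi>
      by (intro mult_left_mono order_trans[OF that(2) abs_ge_self]) auto
    then show "AE \<xi> in lborel. norm (u \<xi> * f \<xi>) \<le> norm (K * u \<xi>)"
      by (simp add: abs_mult mult.commute[of "\<bar>K\<bar>"])
  qed (use u in auto)
  have "mollify \<eta> u (y + w) - mollify \<eta> u y = (\<integral>\<xi>. u \<xi> * \<eta> (y + w - \<xi>) - u \<xi> * \<eta> (y - \<xi>) \<partial>lborel)"
    unfolding mollify_def
    by (subst Bochner_Integration.integral_diff) (auto intro!: ib B simp: mult.commute)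
  also have "\<dots> = (\<integral>\<xi>. \<integral>s. \<phi> \<xi> s \<partial>lborel \<partial>lborel)"
    by (simp add: ftc right_diff_distrib)
  also have "\<dots> = (\<integral>s. \<integral>\<xi>. \<phi> \<xi> s \<partial>lborel \<partial>lborel)"
    by (rule lborel_pair.Fubini_integral[symmetric, OF pair])
  also have "\<dots> = (\<integral>s. indicator {0..1} s * (w \<bullet> mollify \<eta> g (y + s *\<^sub>R w)) \<partial>lborel)"
  proof (rule Bochner_Integration.integral_cong[OF refl])
    fix s :: real
    show "(\<integral>\<xi>. \<phi> \<xi> s \<partial>lborel) = indicator {0..1} s * (w \<bullet> mollify \<eta> g (y + s *\<^sub>R w))"
    proof (cases "s \<in> {0..1}")
      case True
      define z where "z = y + s *\<^sub>R w"
      have tf: "test_function \<Omega> (\<lambda>\<xi>. \<eta> (z - \<xi>))"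
        using sub[OF True] by (intro test_function_reflect C(2) supp) (simp_all add: z_def)
      \<comment> \<open>Two minus signs cancel here, one from the weak formulation and one from
        reflecting \<eta>.\<close>
      have comp: "(\<integral>\<xi>. u \<xi> * partial_deriv i \<eta> (z - \<xi>) \<partial>lborel) = mollify \<eta> g z $ i" for i
      proof -
        have "integrable lborel (\<lambda>\<xi>. \<eta> (z - \<xi>) *\<^sub>R g \<xi>)"
        proof (rule Bochner_Integration.integrable_bound[of _ "\<lambda>\<xi>. B *\<^sub>R g \<xi>"])
          show "AE \<xi> in lborel. norm (\<eta> (z - \<xi>) *\<^sub>R g \<xi>) \<le> norm (B *\<^sub>R g \<xi>)"
            using B by (auto intro!: AE_I2 mult_right_mono order_trans[OF _ abs_ge_self])
        qed (use g in auto)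
        then have "mollify \<eta> g z $ i = (\<integral>\<xi>. (\<eta> (z - \<xi>) *\<^sub>R g \<xi>) $ i \<partial>lborel)"
          unfolding mollify_def by (rule integral_bounded_linear[OF bounded_linear_vec_nth, symmetric])
        then show ?thesis
          using weak[OF tf, of i] unfolding partial_deriv_reflect[OF C'(1)] by (simp add: mult.commute)
      qed
      have bi: "integrable lborel (\<lambda>\<xi>. u \<xi> * partial_deriv i \<eta> (z - \<xi>))" for i
      proof -
        have "partial_deriv i \<eta> x = 0" if "e + 1 \<le> norm x" for x :: "real^'n"
          using partial_deriv_vanish[where e = e and f = \<eta> and x = x] supp that by auto
        from bounded_continuous_vanishing[OF C'(3) this] obtain K where "\<And>x. \<bar>partial_deriv i \<eta> x\<bar> \<le> K" by blast
        then show ?thesis by (intro ib) auto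
      qed
      have "(\<integral>\<xi>. \<phi> \<xi> s \<partial>lborel) = (\<integral>\<xi>. (\<Sum>i\<in>UNIV. w $ i * (u \<xi> * partial_deriv i \<eta> (z - \<xi>))) \<partial>lborel)"
        using True by (simp add: \<phi>_def D_def z_def sum_distrib_left mult_ac)
      also have "\<dots> = (\<Sum>i\<in>UNIV. w $ i * mollify \<eta> g z $ i)"
        using bi by (subst Bochner_Integration.integral_sum) (auto simp: comp)
      finally show ?thesis using True by (simp add: inner_vec_def z_def)
    qed (simp add: \<phi>_def)
  qed
  finally have eq: "mollify \<eta> u (y + w) - mollify \<eta> u y = (\<integral>s. indicator {0..1} s * (w \<bullet> mollify \<eta> g (y + s *\<^sub>R w)) \<partial>lborel)" .
  have "ennreal \<bar>mollify \<eta> u (y + w) - mollify \<eta> u y\<bar> \<le> (\<integral>\<^sup>+s. ennreal \<bar>indicator {0..1} s * (w \<bullet> mollify \<eta> g (y + s *\<^sub>R w))\<bar> \<partial>lborel)"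
  \<comment> \<open>If the integrand were not integrable, the Bochner integral would be 0 by
    convention and the inequality trivial.\<close>
  proof (cases "integrable lborel (\<lambda>s. indicator {0..1} s * (w \<bullet> mollify \<eta> g (y + s *\<^sub>R w)))")
    case True
    show ?thesis unfolding eq using integral_norm_bound_ennreal[OF True] by simp
  next
    case False
    then show ?thesis unfolding eq by (simp add: not_integrable_integral_eq)
  qed
  also have "\<dots> \<le> (\<integral>\<^sup>+s \<in> {0..1}. ennreal (norm w * norm (mollify \<eta> g (y + s *\<^sub>R w))) \<partial>lborel)"
    by (intro nn_integral_mono) (auto simp: indicator_def intro!: ennreal_leI Cauchy_Schwarz_ineq2)
  finally show ?thesis .
qed

section \<open>Averages over shrinking balls\<close>

lemma ball_sets_borel [measurable]: "ball x r \<in> sets borel"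
  by simp

lemma nn_integral_affine:
  fixes F :: "'a::euclidean_space \<Rightarrow> ennreal"
  assumes [measurable]: "F \<in> borel_measurable borel" and c: "c > 0"
  shows "(\<integral>\<^sup>+y. F (t + c *\<^sub>R y) \<partial>lborel) = ennreal (1 / c ^ DIM('a)) * (\<integral>\<^sup>+y. F y \<partial>lborel)"
proof -
  have "(\<integral>\<^sup>+y. F y \<partial>lborel) = (\<integral>\<^sup>+y. F y \<partial>density (distr lborel borel (\<lambda>x. t + c *\<^sub>R x)) (\<lambda>_. \<bar>c\<bar> ^ DIM('a)))"
    using lborel_affine[of c t] c by simp
  also have "\<dots> = ennreal (c ^ DIM('a)) * (\<integral>\<^sup>+y. F (t + c *\<^sub>R y) \<partial>lborel)"
    using c by (subst nn_integral_density) (auto simp: nn_integral_distr nn_integral_cmult ennreal_power)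
  finally have eq: "(\<integral>\<^sup>+y. F y \<partial>lborel) = ennreal (c ^ DIM('a)) * (\<integral>\<^sup>+y. F (t + c *\<^sub>R y) \<partial>lborel)" .
  show ?thesis
    unfolding eq mult.assoc[symmetric] using c by (simp add: ennreal_mult[symmetric])
qed

lemma nn_integral_ball_affine:
  fixes F :: "'a::euclidean_space \<Rightarrow> ennreal"
  assumes [measurable]: "F \<in> borel_measurable borel" and c: "c > 0"
  shows "(\<integral>\<^sup>+y \<in> ball x r. F (z + c *\<^sub>R (y - x)) \<partial>lborel) =
     ennreal (1 / c ^ DIM('a)) * (\<integral>\<^sup>+y \<in> ball z (c * r). F y \<partial>lborel)"
proof -
  have "indicator (ball x r) y = (indicator (ball z (c * r)) ((z - c *\<^sub>R x) + c *\<^sub>R y) :: ennreal)" for y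
  proof -
    have "dist z ((z - c *\<^sub>R x) + c *\<^sub>R y) = norm (c *\<^sub>R (x - y))"
      by (simp add: dist_norm algebra_simps)
    also have "\<dots> = c * dist x y" using c by (simp add: dist_norm)
    finally show ?thesis using c by (simp add: indicator_def)
  qed
  then have "(\<integral>\<^sup>+y \<in> ball x r. F (z + c *\<^sub>R (y - x)) \<partial>lborel) =
    (\<integral>\<^sup>+y. (\<lambda>y. F y * indicator (ball z (c * r)) y) ((z - c *\<^sub>R x) + c *\<^sub>R y) \<partial>lborel)"
    by (intro nn_integral_cong) (simp add: algebra_simps)
  also have "\<dots> = ennreal (1 / c ^ DIM('a)) * (\<integral>\<^sup>+y \<in> ball z (c * r). F y \<partial>lborel)"
    by (rule nn_integral_affine[OF _ c]) measurable
  finally show ?thesis .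
qed

text \<open>For a scaling factor of at least 1/2 the Jacobian factor 1 / c^n is at most 2^n; hence
  the condition \<open>2 * norm h \<le> r\<close> further on.\<close>

lemma nn_integral_ball_affine_le:
  fixes F :: "'a::euclidean_space \<Rightarrow> ennreal"
  assumes F[measurable]: "F \<in> borel_measurable borel" and c: "c \<ge> 1 / 2"
    and sub: "ball z (c * r) \<subseteq> ball x r"
  shows "(\<integral>\<^sup>+y \<in> ball x r. F (z + c *\<^sub>R (y - x)) \<partial>lborel) \<le>
     ennreal (2 ^ DIM('a)) * (\<integral>\<^sup>+y \<in> ball x r. F y \<partial>lborel)"
proof -
  have "1 / c ^ DIM('a) \<le> 2 ^ DIM('a)"
  proof -
    have "(1 / 2) ^ DIM('a) \<le> c ^ DIM('a)" using c by (intro power_mono) auto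
    then show ?thesis using c by (simp add: field_simps power_one_over)
  qed
  moreover have "(\<integral>\<^sup>+y \<in> ball z (c * r). F y \<partial>lborel) \<le> (\<integral>\<^sup>+y \<in> ball x r. F y \<partial>lborel)"
    using sub by (intro nn_integral_mono mult_left_mono) (auto simp: indicator_def)
  ultimately show ?thesis
    using c by (subst nn_integral_ball_affine[OF F]) (auto intro!: mult_mono ennreal_leI)
qed

text \<open>The affine map of B(x, r) onto B(x + h, r - |h|) moves each point along a segment of
  length at most 2 |h| inside B(x, r). Integrating the gradient along the segments and changing
  variables at each time s costs 2^n, whence 2^(n + 1) |h|. This is done for mollifications, for
  which \<open>e0\<close> leaves room, and then passed to the limit.\<close>

lemma ball_shift_nn_comparison:
  fixes u :: "real^'n \<Rightarrow> real" and g :: "real^'n \<Rightarrow> real^'n"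
  assumes u: "integrable lborel u" and g: "integrable lborel g"
    and weak: "\<And>\<psi> i. test_function \<Omega> \<psi> \<Longrightarrow>
       (\<integral>x. u x * partial_deriv i \<psi> x \<partial>lborel) = - (\<integral>x. g x $ i * \<psi> x \<partial>lborel)"
    and r: "r > 0" "2 * norm h \<le> r" and e0: "e0 > 0" "ball x (r + e0) \<subseteq> \<Omega>"
  shows "(\<integral>\<^sup>+y \<in> ball x r. ennreal \<bar>u y - u ((x + h) + (1 - norm h / r) *\<^sub>R (y - x))\<bar> \<partial>lborel)
    \<le> ennreal (2 ^ (CARD('n) + 1) * norm h) * (\<integral>\<^sup>+y \<in> ball x r. ennreal (norm (g y)) \<partial>lborel)"
proof -
  have um[measurable]: "u \<in> borel_measurable borel" and gm[measurable]: "g \<in> borel_measurable borel"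
    using u g by auto
  define n where "n = CARD('n)"
  define B where "B = ball x r"
  have [measurable]: "B \<in> sets borel" by (simp add: B_def)
  define c where "c s = 1 - s * (norm h / r)" for s
  \<comment> \<open>\<open>T s\<close> interpolates between the identity at s = 0 and the map of the
    statement at s = 1; \<open>w y\<close> is the total displacement of y.\<close>
  define T where "T s y = (x + s *\<^sub>R h) + c s *\<^sub>R (y - x)" for s y
  define w where "w y = h - (norm h / r) *\<^sub>R (y - x)" for y
  have Tw: "T s y = y + s *\<^sub>R w y" for s y
    by (simp add: T_def w_def c_def algebra_simps)
  have T1: "T 1 y = (x + h) + (1 - norm h / r) *\<^sub>R (y - x)" for y
    by (simp add: T_def c_def)
  have Tm[measurable]: "T s \<in> borel_measurable borel" for s
    unfolding T_def by measurable
  have wm[measurable]: "w \<in> borel_measurable borel" unfolding w_def by measurable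
  have hr: "norm h / r \<le> 1 / 2" "0 \<le> norm h / r" using r by (auto simp: field_simps)
  have chalf: "c s \<ge> 1 / 2" if "s \<in> {0..1}" for s
  proof -
    have "s * (norm h / r) \<le> 1 * (1 / 2)" using that hr by (intro mult_mono) auto
    then show ?thesis by (simp add: c_def)
  qed
  have csub: "ball (x + s *\<^sub>R h) (c s * r) \<subseteq> ball x r" if "s \<in> {0..1}" for s
  proof
    fix y assume "y \<in> ball (x + s *\<^sub>R h) (c s * r)"
    then have "dist (x + s *\<^sub>R h) y < r - s * norm h"
      using r by (simp add: c_def algebra_simps)
    moreover have "dist x y \<le> dist x (x + s *\<^sub>R h) + dist (x + s *\<^sub>R h) y" by (rule dist_triangle)
    moreover have "dist x (x + s *\<^sub>R h) = s * norm h" using that by (simp add: dist_norm)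
    ultimately show "y \<in> ball x r" by simp
  qed
  have Tle: "(\<integral>\<^sup>+y \<in> B. F (T s y) \<partial>lborel) \<le> ennreal (2 ^ n) * (\<integral>\<^sup>+y \<in> B. F y \<partial>lborel)"
    if "F \<in> borel_measurable borel" "s \<in> {0..1}" for s and F :: "real^'n \<Rightarrow> ennreal"
    using nn_integral_ball_affine_le[OF that(1) chalf[OF that(2)] csub[OF that(2)]]
    by (simp add: B_def T_def n_def)
  have TB: "T s y \<in> ball x r" if "s \<in> {0..1}" "y \<in> B" for s y
  proof -
    have "dist (x + s *\<^sub>R h) (T s y) = c s * dist x y"
      using chalf[OF that(1)] by (simp add: T_def dist_norm norm_minus_commute)
    also have "\<dots> < c s * r" using that(2) chalf[OF that(1)] by (intro mult_strict_left_mono) (auto simp: B_def)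
    finally show ?thesis using csub[OF that(1)] by auto
  qed
  have wn: "norm (w y) \<le> 2 * norm h" if "y \<in> B" for y
  proof -
    have "norm (w y) \<le> norm h + (norm h / r) * norm (y - x)"
      unfolding w_def using norm_triangle_ineq4[of h "(norm h / r) *\<^sub>R (y - x)"] r by simp
    also have "\<dots> \<le> norm h + (norm h / r) * r"
      using that r by (intro add_left_mono mult_left_mono) (auto simp: B_def dist_norm norm_minus_commute)
    finally show ?thesis using r by simp
  qed
  define Y where "Y = (\<integral>\<^sup>+y \<in> B. ennreal (norm (g y)) \<partial>lborel)"
  have main: "(\<integral>\<^sup>+y \<in> B. ennreal \<bar>u y - u (T 1 y)\<bar> \<partial>lborel) \<le>
     ennreal \<delta> + ennreal (2 * norm h * 2 ^ n) * (Y + ennreal \<delta>) + ennreal (2 ^ n) * ennreal \<delta>" if "\<delta> > 0" for \<delta>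
  proof -
    obtain d1 where d1: "d1 > 0" "\<And>h. norm h < d1 \<Longrightarrow> (\<integral>x. norm (u (x + h) - u x) \<partial>lborel) < \<delta>"
      using translation_L1[OF u \<open>\<delta> > 0\<close>] by blast
    obtain d2 where d2: "d2 > 0" "\<And>h. norm h < d2 \<Longrightarrow> (\<integral>x. norm (g (x + h) - g x) \<partial>lborel) < \<delta>"
      using translation_L1[OF g \<open>\<delta> > 0\<close>] by blast
    \<comment> \<open>The bounds d1 and d2 make the mollifications of u and g accurate in L^1; e0 /
      2 keeps the supports of the test functions inside \<Omega>.\<close>
    define e where "e = min (min d1 d2) (e0 / 2)"
    have e: "e > 0" "e \<le> d1" "e \<le> d2" "e < e0" using d1 d2 e0 by (auto simp: e_def)
    obtain \<eta> :: "real^'n \<Rightarrow> real" where \<eta>: "\<And>x. 0 \<le> \<eta> x" "\<And>x. e \<le> norm x \<Longrightarrow> \<eta> x = 0" "integrable lborel \<eta>"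
      "(\<integral>x. \<eta> x \<partial>lborel) = 1" "\<And>k. C_k k \<eta>" "\<And>k y. C_k k (\<lambda>\<xi>. \<eta> (y - \<xi>))"
      using mollifier_exists[OF e(1)] by metis
    have \<eta>m[measurable]: "\<eta> \<in> borel_measurable borel" using \<eta>(3) by auto
    have "\<exists>K. \<forall>x. \<bar>\<eta> x\<bar> \<le> K"
      by (rule bounded_continuous_vanishing[OF C_k_all_partial_deriv(2)[OF \<eta>(5)] \<eta>(2)])
    then obtain K where "\<And>x. \<bar>\<eta> x\<bar> \<le> K" by blast
    then have K: "\<eta> x \<le> K" for x by (rule abs_le_D1)
    define v where "v = mollify \<eta> u"
    define k where "k = mollify \<eta> g"
    have [measurable]: "v \<in> borel_measurable borel" "k \<in> borel_measurable borel"
      by (auto simp: v_def k_def)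
    have vu: "(\<integral>\<^sup>+y. norm (v y - u y) \<partial>lborel) \<le> ennreal \<delta>"
      unfolding v_def using d1(2) e(2) by (intro mollify_L1_le[OF \<eta>(3,1) K \<eta>(2,4) u]) (auto intro: less_imp_le)
    have kg: "(\<integral>\<^sup>+y. norm (k y - g y) \<partial>lborel) \<le> ennreal \<delta>"
      unfolding k_def using d2(2) e(3) by (intro mollify_L1_le[OF \<eta>(3,1) K \<eta>(2,4) g]) (auto intro: less_imp_le)
    have vuB: "(\<integral>\<^sup>+y \<in> B. norm (v y - u y) \<partial>lborel) \<le> ennreal \<delta>"
      by (rule order_trans[OF _ vu], intro nn_integral_mono) (auto simp: indicator_def)
    have seg: "ennreal \<bar>v (T 1 y) - v y\<bar> \<le> (\<integral>\<^sup>+s \<in> {0..1}. ennreal (2 * norm h) * ennreal (norm (k (T s y))) \<partial>lborel)"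
      if y: "y \<in> B" for y
    proof -
      have "cball (y + s *\<^sub>R w y) e \<subseteq> \<Omega>" if "s \<in> {0..1}" for s
      proof -
        have "dist x (y + s *\<^sub>R w y) < r" using TB[OF that y] by (simp add: Tw)
        then have "cball (y + s *\<^sub>R w y) e \<subseteq> ball x (r + e0)"
        proof (intro subsetI)
          fix z assume "dist x (y + s *\<^sub>R w y) < r" "z \<in> cball (y + s *\<^sub>R w y) e"
          then show "z \<in> ball x (r + e0)"
            using dist_triangle[of x z "y + s *\<^sub>R w y"] e(4) by simp
        qed
        then show ?thesis using e0 by blast
      qed
      then have "ennreal \<bar>v (y + w y) - v y\<bar> \<le> (\<integral>\<^sup>+s \<in> {0..1}. ennreal (norm (w y) * norm (k (y + s *\<^sub>R w y))) \<partial>lborel)"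
        unfolding v_def k_def by (intro mollify_segment[OF \<eta>(5,6,2) u g weak])
      also have "\<dots> \<le> (\<integral>\<^sup>+s \<in> {0..1}. ennreal (2 * norm h) * ennreal (norm (k (T s y))) \<partial>lborel)"
        using wn[OF y] by (intro nn_integral_mono mult_right_mono)
          (auto simp: Tw ennreal_mult[symmetric] intro!: ennreal_leI mult_right_mono)
      finally show ?thesis by (simp add: Tw)
    qed
    have kT[measurable]: "(\<lambda>(y, s). k (T s y)) \<in> borel_measurable (lborel \<Otimes>\<^sub>M lborel)"
      unfolding Tw by measurable
    have "(\<integral>\<^sup>+y \<in> B. ennreal \<bar>v (T 1 y) - v y\<bar> \<partial>lborel) \<le>
      (\<integral>\<^sup>+y. \<integral>\<^sup>+s. (ennreal (2 * norm h) * ennreal (norm (k (T s y))) * indicator {0..1} s) * indicator B y \<partial>lborel \<partial>lborel)"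
    proof (intro nn_integral_mono)
      fix y
      show "ennreal \<bar>v (T 1 y) - v y\<bar> * indicator B y \<le>
        (\<integral>\<^sup>+s. (ennreal (2 * norm h) * ennreal (norm (k (T s y))) * indicator {0..1} s) * indicator B y \<partial>lborel)"
        using seg[of y] by (cases "y \<in> B") auto
    qed
    \<comment> \<open>For fixed s, \<open>T s\<close> maps the ball into itself, so
      \<open>Tle\<close> removes it at the cost of a factor \<open>2 ^ n\<close>.\<close>
    also have "\<dots> = (\<integral>\<^sup>+s. \<integral>\<^sup>+y. (ennreal (2 * norm h) * ennreal (norm (k (T s y))) * indicator {0..1} s) * indicator B y \<partial>lborel \<partial>lborel)"
      by (rule lborel_pair.Fubini') measurable
    also have "\<dots> \<le> (\<integral>\<^sup>+s. ennreal (2 * norm h * 2 ^ n) * (Y + ennreal \<delta>) * indicator {0..1::real} s \<partial>lborel)"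
    proof (intro nn_integral_mono)
      fix s :: real
      show "(\<integral>\<^sup>+y. (ennreal (2 * norm h) * ennreal (norm (k (T s y))) * indicator {0..1} s) * indicator B y \<partial>lborel)
        \<le> ennreal (2 * norm h * 2 ^ n) * (Y + ennreal \<delta>) * indicator {0..1} s"
      proof (cases "s \<in> {0..1}")
        case True
        have "(\<integral>\<^sup>+y \<in> B. ennreal (norm (k y)) \<partial>lborel) \<le> (\<integral>\<^sup>+y. ennreal (norm (g y)) * indicator B y + norm (k y - g y) \<partial>lborel)"
        proof (intro nn_integral_mono)
          fix y
          have "norm (k y) \<le> norm (g y) + norm (k y - g y)"
            using norm_triangle_ineq[of "g y" "k y - g y"] by simp
          then show "ennreal (norm (k y)) * indicator B y \<le> ennreal (norm (g y)) * indicator B y + ennreal (norm (k y - g y))"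
            by (auto simp: indicator_def ennreal_plus[symmetric] simp del: ennreal_plus intro!: ennreal_leI)
        qed
        also have "\<dots> \<le> Y + ennreal \<delta>"
          unfolding Y_def using kg by (subst nn_integral_add) (auto intro!: add_left_mono)
        finally have kB: "(\<integral>\<^sup>+y \<in> B. ennreal (norm (k y)) \<partial>lborel) \<le> Y + ennreal \<delta>" .
        have "(\<integral>\<^sup>+y. (ennreal (2 * norm h) * ennreal (norm (k (T s y))) * indicator {0..1} s) * indicator B y \<partial>lborel)
           = ennreal (2 * norm h) * (\<integral>\<^sup>+y \<in> B. ennreal (norm (k (T s y))) \<partial>lborel)"
          using True by (subst nn_integral_cmult[symmetric]) (auto simp: mult.assoc)
        also have "\<dots> \<le> ennreal (2 * norm h) * (ennreal (2 ^ n) * (\<integral>\<^sup>+y \<in> B. ennreal (norm (k y)) \<partial>lborel))"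
          by (intro mult_left_mono Tle[of "\<lambda>y. ennreal (norm (k y))"] True) auto
        also have "\<dots> \<le> ennreal (2 * norm h) * (ennreal (2 ^ n) * (Y + ennreal \<delta>))"
          by (intro mult_left_mono kB) auto
        finally show ?thesis using True by (simp add: ennreal_mult mult.assoc)
      qed simp
    qed
    also have "\<dots> = ennreal (2 * norm h * 2 ^ n) * (Y + ennreal \<delta>)"
      by (simp add: nn_integral_cmult_indicator)
    finally have mid: "(\<integral>\<^sup>+y \<in> B. ennreal \<bar>v (T 1 y) - v y\<bar> \<partial>lborel) \<le> ennreal (2 * norm h * 2 ^ n) * (Y + ennreal \<delta>)" .
    have last: "(\<integral>\<^sup>+y \<in> B. ennreal (norm (v (T 1 y) - u (T 1 y))) \<partial>lborel) \<le> ennreal (2 ^ n) * ennreal \<delta>"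
      using Tle[of "\<lambda>y. ennreal (norm (v y - u y))" 1] mult_left_mono[OF vuB, of "ennreal (2 ^ n)"] by auto
    have "(\<integral>\<^sup>+y \<in> B. ennreal \<bar>u y - u (T 1 y)\<bar> \<partial>lborel) \<le>
      (\<integral>\<^sup>+y. (ennreal (norm (v y - u y)) * indicator B y + ennreal \<bar>v (T 1 y) - v y\<bar> * indicator B y) + ennreal (norm (v (T 1 y) - u (T 1 y))) * indicator B y \<partial>lborel)"
      by (intro nn_integral_mono)
         (auto simp: indicator_def ennreal_plus[symmetric] simp del: ennreal_plus intro!: ennreal_leI)
    also have "\<dots> = (\<integral>\<^sup>+y. ennreal (norm (v y - u y)) * indicator B y + ennreal \<bar>v (T 1 y) - v y\<bar> * indicator B y \<partial>lborel) +
       (\<integral>\<^sup>+y \<in> B. ennreal (norm (v (T 1 y) - u (T 1 y))) \<partial>lborel)"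
      by (rule nn_integral_add) measurable
    also have "\<dots> = ((\<integral>\<^sup>+y \<in> B. norm (v y - u y) \<partial>lborel) + (\<integral>\<^sup>+y \<in> B. ennreal \<bar>v (T 1 y) - v y\<bar> \<partial>lborel)) +
       (\<integral>\<^sup>+y \<in> B. ennreal (norm (v (T 1 y) - u (T 1 y))) \<partial>lborel)"
      by (rule arg_cong[where f = "\<lambda>X. X + _"], rule nn_integral_add) measurable
    also have "\<dots> \<le> ennreal \<delta> + ennreal (2 * norm h * 2 ^ n) * (Y + ennreal \<delta>) + ennreal (2 ^ n) * ennreal \<delta>"
      by (intro add_mono vuB mid last)
    finally show ?thesis .
  qed
  have gB: "integrable lborel (\<lambda>y. indicator B y *\<^sub>R g y)"
    using integrable_mult_indicator[OF _ g, of B] by simp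
  obtain Y' where Y': "Y = ennreal Y'" "Y' \<ge> 0"
  proof -
    have "Y = (\<integral>\<^sup>+y. ennreal (norm (indicator B y *\<^sub>R g y)) \<partial>lborel)"
      unfolding Y_def by (intro nn_integral_cong) (auto simp: indicator_def)
    also have "\<dots> < \<infinity>" using gB unfolding integrable_iff_bounded by simp
    finally show ?thesis using that by (cases Y) auto
  qed
  have "(\<integral>\<^sup>+y \<in> B. ennreal \<bar>u y - u (T 1 y)\<bar> \<partial>lborel) \<le> ennreal (2 * norm h * 2 ^ n) * Y"
  proof (rule ennreal_le_epsilon)
    fix \<epsilon> :: real assume \<epsilon>: "\<epsilon> > 0"
    \<comment> \<open>The total coefficient of \<delta> in \<open>main\<close>, so that \<delta> =
      \<epsilon> / M produces the error \<epsilon>.\<close>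
    define M where "M = 1 + 2 * norm h * 2 ^ n + 2 ^ n"
    have M: "M > 0" by (simp add: M_def add_pos_nonneg)
    have "(\<integral>\<^sup>+y \<in> B. ennreal \<bar>u y - u (T 1 y)\<bar> \<partial>lborel) \<le>
      ennreal (\<epsilon> / M) + ennreal (2 * norm h * 2 ^ n) * (Y + ennreal (\<epsilon> / M)) + ennreal (2 ^ n) * ennreal (\<epsilon> / M)"
      using M \<epsilon> by (intro main) simp
    also have "\<dots> = ennreal (\<epsilon> / M + (2 * norm h * 2 ^ n) * (Y' + \<epsilon> / M) + 2 ^ n * (\<epsilon> / M))"
    proof -
      have e: "\<epsilon> / M \<ge> 0" using M \<epsilon> by simp
      have a: "Y + ennreal (\<epsilon> / M) = ennreal (Y' + \<epsilon> / M)"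
        using Y' e by simp
      have b: "ennreal (2 * norm h * 2 ^ n) * ennreal (Y' + \<epsilon> / M) = ennreal ((2 * norm h * 2 ^ n) * (Y' + \<epsilon> / M))"
        using Y' e by (intro ennreal_mult[symmetric]) auto
      have c: "ennreal (2 ^ n) * ennreal (\<epsilon> / M) = ennreal (2 ^ n * (\<epsilon> / M))"
        using e by (intro ennreal_mult[symmetric]) auto
      have d: "0 \<le> (2 * norm h * 2 ^ n) * (Y' + \<epsilon> / M)" "0 \<le> 2 ^ n * (\<epsilon> / M)"
        using Y' e by (auto intro!: mult_nonneg_nonneg simp del: times_divide_eq_right)
      show ?thesis
        unfolding a b c using e d by (simp add: ennreal_plus[symmetric] del: ennreal_plus times_divide_eq_right)
    qed
    also have "\<epsilon> / M + (2 * norm h * 2 ^ n) * (Y' + \<epsilon> / M) + 2 ^ n * (\<epsilon> / M) = (2 * norm h * 2 ^ n) * Y' + M * (\<epsilon> / M)"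
      by (simp add: M_def algebra_simps add_divide_distrib)
    also have "ennreal \<dots> = ennreal (2 * norm h * 2 ^ n) * Y + ennreal \<epsilon>"
      using M \<epsilon> Y' by (simp add: ennreal_mult''[symmetric] del: mult_pos_pos)
    finally show "(\<integral>\<^sup>+y \<in> B. ennreal \<bar>u y - u (T 1 y)\<bar> \<partial>lborel) \<le> ennreal (2 * norm h * 2 ^ n) * Y + ennreal \<epsilon>" .
  qed
  then show ?thesis by (simp add: T1 B_def Y_def n_def mult_ac)
qed

text \<open>The Jacobian cancels against the ratio of the volumes, so averages over the two balls
  become integrals over the same ball with the same normalisation.\<close>

lemma ball_avg_eq_affine:
  fixes f :: "'a::euclidean_space \<Rightarrow> real"
  assumes f: "integrable lborel f" and nn: "\<And>x. f x \<ge> 0" and c: "c > 0" and r: "r > 0"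
  shows "integrable lborel (\<lambda>y. indicator (ball x r) y * f (z + c *\<^sub>R (y - x)))"
    and "ball_avg f z (c * r) = (\<integral>y. indicator (ball x r) y * f (z + c *\<^sub>R (y - x)) \<partial>lborel) / measure lborel (ball x r)"
proof -
  have fm[measurable]: "f \<in> borel_measurable borel" using f by auto
  have i: "integrable lborel (\<lambda>y. indicator (ball z (c * r)) y * f y)"
    using integrable_mult_indicator[OF _ f, of "ball z (c * r)"] by simp
  define J where "J = (\<integral>y. indicator (ball z (c * r)) y * f y \<partial>lborel)"
  have J: "J \<ge> 0" unfolding J_def using nn by (intro Bochner_Integration.integral_nonneg) auto
  have "(\<integral>\<^sup>+y. ennreal (indicator (ball x r) y * f (z + c *\<^sub>R (y - x))) \<partial>lborel) =
    (\<integral>\<^sup>+y \<in> ball x r. ennreal (f (z + c *\<^sub>R (y - x))) \<partial>lborel)"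
    by (intro nn_integral_cong) (auto simp: indicator_def)
  also have "\<dots> = ennreal (1 / c ^ DIM('a)) * (\<integral>\<^sup>+y \<in> ball z (c * r). ennreal (f y) \<partial>lborel)"
    by (rule nn_integral_ball_affine[OF _ c]) measurable
  also have "(\<integral>\<^sup>+y \<in> ball z (c * r). ennreal (f y) \<partial>lborel) = (\<integral>\<^sup>+y. ennreal (indicator (ball z (c * r)) y * f y) \<partial>lborel)"
    by (intro nn_integral_cong) (auto simp: indicator_def)
  also have "\<dots> = ennreal J"
    unfolding J_def by (rule nn_integral_eq_integral[OF i]) (use nn in auto)
  also have "ennreal (1 / c ^ DIM('a)) * ennreal J = ennreal (J / c ^ DIM('a))"
    using c J by (simp add: ennreal_mult[symmetric])
  finally have eq: "(\<integral>\<^sup>+y. ennreal (indicator (ball x r) y * f (z + c *\<^sub>R (y - x))) \<partial>lborel) = ennreal (J / c ^ DIM('a))" .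
  have hb: "has_bochner_integral lborel (\<lambda>y. indicator (ball x r) y * f (z + c *\<^sub>R (y - x))) (J / c ^ DIM('a))"
    by (rule has_bochner_integral_nn_integral) (use eq nn J c in auto)
  then show "integrable lborel (\<lambda>y. indicator (ball x r) y * f (z + c *\<^sub>R (y - x)))"
    by (simp add: has_bochner_integral_iff)
  have "measure lborel (ball z (c * r)) = c ^ DIM('a) * measure lborel (ball x r)"
    using c r by (simp add: content_ball power_mult_distrib)
  then show "ball_avg f z (c * r) = (\<integral>y. indicator (ball x r) y * f (z + c *\<^sub>R (y - x)) \<partial>lborel) / measure lborel (ball x r)"
    using hb c by (simp add: has_bochner_integral_iff ball_avg_def J_def)
qed

text \<open>After \<open>ball_avg_eq_affine\<close> the difference of the averages is one integral
  over B(x, r), to which \<open>ball_shift_nn_comparison\<close> applies.\<close>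

lemma ball_shift_comparison:
  fixes u :: "real^'n \<Rightarrow> real" and g :: "real^'n \<Rightarrow> real^'n"
  assumes u: "integrable lborel u" and g: "integrable lborel g"
    and weak: "\<And>\<psi> i. test_function \<Omega> \<psi> \<Longrightarrow>
       (\<integral>x. u x * partial_deriv i \<psi> x \<partial>lborel) = - (\<integral>x. g x $ i * \<psi> x \<partial>lborel)"
    and r: "r > 0" "2 * norm h \<le> r" and e0: "e0 > 0" "ball x (r + e0) \<subseteq> \<Omega>"
  shows "\<bar>ball_avg (\<lambda>y. \<bar>u y\<bar>) x r - ball_avg (\<lambda>y. \<bar>u y\<bar>) (x + h) (r - norm h)\<bar>
    \<le> 2 ^ (CARD('n) + 1) * norm h * ball_avg (\<lambda>y. norm (g y)) x r"
proof -
  define c where "c = 1 - norm h / r"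
  have c: "c > 0" using r by (auto simp: c_def field_simps)
  have cr: "c * r = r - norm h" using r by (simp add: c_def field_simps)
  define V where "V = measure lborel (ball x r)"
  have V: "V > 0" unfolding V_def using r(1) by (rule content_ball_pos)
  have ua: "integrable lborel (\<lambda>y. \<bar>u y\<bar>)" and ga: "integrable lborel (\<lambda>y. norm (g y))" using u g by auto
  note aff = ball_avg_eq_affine[OF ua _ c r(1), where x = x and z = "x + h", unfolded cr]
  have i1: "integrable lborel (\<lambda>y. indicator (ball x r) y * \<bar>u y\<bar>)"
    using integrable_mult_indicator[OF _ ua, of "ball x r"] by simp
  have ig: "integrable lborel (\<lambda>y. indicator (ball x r) y * norm (g y))"
    using integrable_mult_indicator[OF _ ga, of "ball x r"] by simp
  define Jg where "Jg = (\<integral>y. indicator (ball x r) y * norm (g y) \<partial>lborel)"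
  have Jg: "Jg \<ge> 0" unfolding Jg_def by (intro Bochner_Integration.integral_nonneg) auto
  define T where "T y = (x + h) + c *\<^sub>R (y - x)" for y
  have i2: "integrable lborel (\<lambda>y. indicator (ball x r) y * \<bar>u (T y)\<bar>)"
    using aff(1) by (simp add: T_def)
  define J where "J = (\<integral>y. indicator (ball x r) y * \<bar>u y\<bar> - indicator (ball x r) y * \<bar>u (T y)\<bar> \<partial>lborel)"
  have "ennreal \<bar>J\<bar> \<le> (\<integral>\<^sup>+y. norm (indicator (ball x r) y * \<bar>u y\<bar> - indicator (ball x r) y * \<bar>u (T y)\<bar>) \<partial>lborel)"
    unfolding J_def real_norm_def[symmetric] by (rule integral_norm_bound_ennreal) (use i1 i2 in auto)
  \<comment> \<open>The reverse triangle inequality passes from the modulus of u to u itself, so no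
    weak gradient of the modulus enters.\<close>
  also have "\<dots> \<le> (\<integral>\<^sup>+y \<in> ball x r. ennreal \<bar>u y - u (T y)\<bar> \<partial>lborel)"
    by (intro nn_integral_mono) (auto simp: indicator_def intro!: ennreal_leI)
  also have "\<dots> \<le> ennreal (2 ^ (CARD('n) + 1) * norm h) * (\<integral>\<^sup>+y \<in> ball x r. ennreal (norm (g y)) \<partial>lborel)"
    unfolding T_def c_def by (rule ball_shift_nn_comparison[OF u g weak r e0])
  also have "(\<integral>\<^sup>+y \<in> ball x r. ennreal (norm (g y)) \<partial>lborel) = (\<integral>\<^sup>+y. ennreal (indicator (ball x r) y * norm (g y)) \<partial>lborel)"
    by (intro nn_integral_cong) (auto simp: indicator_def)
  also have "\<dots> = ennreal Jg"
    unfolding Jg_def by (rule nn_integral_eq_integral[OF ig]) auto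
  also have "ennreal (2 ^ (CARD('n) + 1) * norm h) * ennreal Jg = ennreal (2 ^ (CARD('n) + 1) * norm h * Jg)"
    using Jg by (simp add: ennreal_mult)
  finally have le: "\<bar>J\<bar> \<le> 2 ^ (CARD('n) + 1) * norm h * Jg"
    using Jg by (subst (asm) ennreal_le_iff) auto
  have "ball_avg (\<lambda>y. \<bar>u y\<bar>) x r - ball_avg (\<lambda>y. \<bar>u y\<bar>) (x + h) (r - norm h) = J / V"
    using i1 i2 aff(2) by (simp add: J_def V_def ball_avg_def[of _ x r] T_def diff_divide_distrib)
  then have "\<bar>ball_avg (\<lambda>y. \<bar>u y\<bar>) x r - ball_avg (\<lambda>y. \<bar>u y\<bar>) (x + h) (r - norm h)\<bar> = \<bar>J\<bar> / V"
    using V by simp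
  also have "\<dots> \<le> (2 ^ (CARD('n) + 1) * norm h * Jg) / V"
    using le V by (intro divide_right_mono) auto
  finally show ?thesis by (simp add: ball_avg_def Jg_def V_def)
qed

text \<open>With \<open>\<omega>\<close> the volume of the unit ball and \<open>s = \<gamma> \<beta> / n\<close>, this is the factor in front of the average
  over \<open>B(x, r)\<close> in the maximal operator.\<close>

definition max_weight :: "nat \<Rightarrow> real \<Rightarrow> real \<Rightarrow> real \<Rightarrow> real \<Rightarrow> real \<Rightarrow> real" where
  "max_weight n \<omega> \<gamma> \<beta> s r = r powr \<beta> * (1 + r ^ n) powr s / (1 + \<omega> * r ^ n) powr \<gamma>"

lemma max_weight_nonneg: "max_weight n \<omega> \<gamma> \<beta> s r \<ge> 0"
  by (simp add: max_weight_def)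

lemma max_weight_le:
  assumes r: "0 < r" "r \<le> R" and "s \<ge> 0" "\<gamma> \<ge> 0" "\<omega> \<ge> 0"
  shows "max_weight n \<omega> \<gamma> \<beta> s r \<le> (1 + R ^ n) powr s * r powr \<beta>"
proof -
  have "1 \<le> (1 + \<omega> * r ^ n) powr \<gamma>" using assms by (intro ge_one_powr_ge_zero) auto
  then have "max_weight n \<omega> \<gamma> \<beta> s r \<le> r powr \<beta> * (1 + r ^ n) powr s / 1"
    unfolding max_weight_def by (intro divide_left_mono) auto
  also have "\<dots> \<le> r powr \<beta> * (1 + R ^ n) powr s"
    using assms by (auto intro!: mult_left_mono powr_mono2 power_mono add_nonneg_nonneg)
  finally show ?thesis by (simp add: mult.commute)
qed

text \<open>The denominator is increasing, so only the numerator contributes to an upper bound.\<close>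

lemma max_weight_diff_le:
  assumes r: "0 < r'" "r' \<le> r" "r \<le> R" and "s \<ge> 0" "\<gamma> \<ge> 0" "\<omega> \<ge> 0" "\<beta> \<ge> 1" "n \<ge> 1"
  shows "max_weight n \<omega> \<gamma> \<beta> s r - max_weight n \<omega> \<gamma> \<beta> s r' \<le>
    (\<beta> + n * s) * (1 + R ^ n) powr s * r powr (\<beta> - 1) * (r - r')"
proof -
  define P where "P r = r powr \<beta> * (1 + r ^ n) powr s" for r :: real
  define P' where "P' r = \<beta> * r powr (\<beta> - 1) * (1 + r ^ n) powr s + r powr \<beta> * (s * (1 + r ^ n) powr (s - 1) * (n * r ^ (n - 1)))" for r :: real
  have pos: "1 + x ^ n > 0" if "x > 0" for x :: real using that by (simp add: add_pos_pos)
  have D: "(P has_real_derivative P' x) (at x)" if "x > 0" for x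
    unfolding P_def[abs_def] P'_def using that pos[OF that]
    by (auto intro!: derivative_eq_intros simp: mult_ac)
  have P0: "P x \<ge> 0" for x by (simp add: P_def)
  have P'le: "P' x \<le> (\<beta> + n * s) * (1 + R ^ n) powr s * r powr (\<beta> - 1)" if "0 < x" "x \<le> r" for x
  proof -
    have xr: "x \<le> R" using that r by simp
    \<comment> \<open>Moving one power of x makes both terms of the derivative carry
      \<open>x powr (\<beta> - 1)\<close>.\<close>
    have "x powr \<beta> * x ^ (n - 1) = x powr (\<beta> - 1) * x ^ n"
    proof -
      have "x powr \<beta> = x powr (\<beta> - 1) * x"
        using that powr_mult_base[of x "\<beta> - 1"] by (simp add: mult.commute)
      moreover have "x ^ n = x * x ^ (n - 1)" using \<open>n \<ge> 1\<close> by (cases n) auto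
      ultimately show ?thesis by simp
    qed
    then have "P' x = \<beta> * x powr (\<beta> - 1) * (1 + x ^ n) powr s + x powr (\<beta> - 1) * (n * s) * ((1 + x ^ n) powr (s - 1) * x ^ n)"
      unfolding P'_def by (simp add: mult_ac)
    \<comment> \<open>Enlarging \<open>x ^ n\<close> to \<open>1 + x ^ n\<close> restores the
      exponent s, whatever the sign of \<open>s - 1\<close>.\<close>
    also have "(1 + x ^ n) powr (s - 1) * x ^ n \<le> (1 + x ^ n) powr (s - 1) * (1 + x ^ n)"
      by (intro mult_left_mono) auto
    also have "\<dots> = (1 + x ^ n) powr s"
      using pos[OF that(1)] powr_mult_base[of "1 + x ^ n" "s - 1"] by (simp add: mult.commute)
    finally have "P' x \<le> \<beta> * x powr (\<beta> - 1) * (1 + x ^ n) powr s + x powr (\<beta> - 1) * (n * s) * (1 + x ^ n) powr s"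
      using assms by (simp add: mult_left_mono)
    also have "\<dots> = (\<beta> + n * s) * (1 + x ^ n) powr s * x powr (\<beta> - 1)" by (simp add: algebra_simps)
    also have "\<dots> \<le> (\<beta> + n * s) * (1 + R ^ n) powr s * r powr (\<beta> - 1)"
      using assms that xr by (auto intro!: mult_mono powr_mono2 power_mono add_nonneg_nonneg mult_nonneg_nonneg)
    finally show ?thesis .
  qed
  have diff: "P r - P r' \<le> (\<beta> + n * s) * (1 + R ^ n) powr s * r powr (\<beta> - 1) * (r - r')"
  proof (cases "r' = r")
    case False
    then have "r' < r" using r by simp
    then obtain z where z: "r' < z" "z < r" "P r - P r' = (r - r') * P' z"
      using MVT2[of r' r P P'] D r by (meson less_le_trans)
    then show ?thesis
      using mult_left_mono[OF P'le[of z], of "r - r'"] r by (simp add: mult.commute)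
  qed simp
  define d where "d r = (1 + \<omega> * r ^ n) powr \<gamma>" for r :: real
  have d1: "1 \<le> d x" if "x > 0" for x unfolding d_def using assms that by (intro ge_one_powr_ge_zero) auto
  have dm: "d r' \<le> d r"
    unfolding d_def using assms by (auto intro!: powr_mono2 mult_left_mono power_mono add_nonneg_nonneg)
  have "P r' \<le> P r" unfolding P_def using assms by (auto intro!: mult_mono powr_mono2 power_mono)
  have "max_weight n \<omega> \<gamma> \<beta> s r - max_weight n \<omega> \<gamma> \<beta> s r' = P r / d r - P r' / d r'"
    by (simp add: max_weight_def P_def d_def)
  \<comment> \<open>The smaller \<open>d r'\<close> becomes the common denominator; as it is at
    least 1 and P is increasing, it can then be dropped.\<close>
  also have "\<dots> \<le> P r / d r' - P r' / d r'"
    using dm d1[of r'] r P0[of r] by (auto intro!: divide_left_mono mult_pos_pos)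
  also have "\<dots> = (P r - P r') / d r'" by (simp add: diff_divide_distrib)
  also have "\<dots> \<le> (P r - P r') / 1"
    using d1[of r'] r \<open>P r' \<le> P r\<close> by (intro divide_left_mono) auto
  finally show ?thesis using diff by simp
qed

text \<open>The local maximal operator in terms of averages, for an arbitrary weight. There is no
  case distinction for the whole space, which finite measure excludes. Off \<Omega> no radius is
  admissible and the value is 0.\<close>

definition radius_sup :: "(real \<Rightarrow> real) \<Rightarrow> (real^'n) set \<Rightarrow> (real^'n \<Rightarrow> real) \<Rightarrow> real^'n \<Rightarrow> ennreal" where
  "radius_sup \<kappa> \<Omega> u x = (SUP r \<in> {r. 0 < r \<and> r < infdist x (- \<Omega>)}. ennreal (\<kappa> r * ball_avg (\<lambda>y. \<bar>u y\<bar>) x r))"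

lemma ball_infdist_subset:
  assumes "r \<le> infdist x (- \<Omega>)"
  shows "ball x r \<subseteq> \<Omega>"
proof
  fix y assume y: "y \<in> ball x r"
  show "y \<in> \<Omega>"
  proof (rule ccontr)
    assume "y \<notin> \<Omega>"
    then have "infdist x (- \<Omega>) \<le> dist x y" by (intro infdist_le) auto
    with assms y show False by simp
  qed
qed

lemma ball_avg_nonneg: "(\<And>y. 0 \<le> f y) \<Longrightarrow> 0 \<le> ball_avg f x r"
  unfolding ball_avg_def by (intro divide_nonneg_nonneg Bochner_Integration.integral_nonneg) auto

lemma powr_eq_mult_powr_minus_one: "r > 0 \<Longrightarrow> r powr \<beta> = r * r powr (\<beta> - 1)" for r :: real
  using powr_mult_base[of r "\<beta> - 1"] by simp

text \<open>One factor r of \<open>r powr \<beta>\<close> is bounded by R, which leaves the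
  fractional average of order \<beta> - 1.\<close>

lemma radius_sup_le:
  fixes u :: "real^'n \<Rightarrow> real"
  assumes par: "s \<ge> 0" "\<gamma> \<ge> 0" "\<omega> \<ge> 0"
    and R: "\<And>r. 0 < r \<Longrightarrow> r < infdist x (- \<Omega>) \<Longrightarrow> r \<le> R"
    and G: "\<And>r. r > 0 \<Longrightarrow> r powr (\<beta> - 1) * ball_avg (\<lambda>y. \<bar>u y\<bar>) x r \<le> G"
  shows "radius_sup (max_weight n \<omega> \<gamma> \<beta> s) \<Omega> u x \<le> ennreal ((1 + R ^ n) powr s * R * G)"
  unfolding radius_sup_def
proof (rule SUP_least, rule ennreal_leI)
  fix r assume "r \<in> {r. 0 < r \<and> r < infdist x (- \<Omega>)}"
  then have r: "0 < r" "r \<le> R" using R by auto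
  define A where "A = ball_avg (\<lambda>y. \<bar>u y\<bar>) x r"
  have A: "A \<ge> 0" unfolding A_def by (intro ball_avg_nonneg) auto
  have G0: "G \<ge> 0" by (rule order_trans[OF _ G[OF r(1)]]) (use A in \<open>simp add: A_def\<close>)
  have "max_weight n \<omega> \<gamma> \<beta> s r * A \<le> ((1 + R ^ n) powr s * r powr \<beta>) * A"
    using A r par by (intro mult_right_mono max_weight_le) auto
  also have "\<dots> = (1 + R ^ n) powr s * r * (r powr (\<beta> - 1) * A)"
    by (simp add: powr_eq_mult_powr_minus_one[OF r(1), of \<beta>] mult_ac)
  also have "\<dots> \<le> (1 + R ^ n) powr s * R * G"
    using G[OF r(1)] r A G0 by (intro mult_mono) (auto simp: A_def)
  finally show "max_weight n \<omega> \<gamma> \<beta> s r * ball_avg (\<lambda>y. \<bar>u y\<bar>) x r \<le> (1 + R ^ n) powr s * R * G"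
    by (simp add: A_def)
qed

text \<open>Radii \<open>r < 2 \<bar>h\<bar>\<close> are harmless, since then \<open>r\<^sup>\<beta> \<le> 2 \<bar>h\<bar> r\<^bsup>\<beta> - 1\<^esup>\<close>; otherwise \<open>r\<close> is compared with the
  radius \<open>r - \<bar>h\<bar>\<close> at the other point, which is admissible because the distance function is 1-Lipschitz.\<close>

lemma radius_sup_diff_le:
  fixes u :: "real^'n \<Rightarrow> real" and g :: "real^'n \<Rightarrow> real^'n"
  assumes u: "integrable lborel u" and g: "integrable lborel g"
    and weak: "\<And>\<psi> i. test_function \<Omega> \<psi> \<Longrightarrow>
       (\<integral>x. u x * partial_deriv i \<psi> x \<partial>lborel) = - (\<integral>x. g x $ i * \<psi> x \<partial>lborel)"
    and par: "s \<ge> 0" "\<gamma> \<ge> 0" "\<omega> \<ge> 0" "\<beta> \<ge> 1" "n \<ge> 1"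
    and R: "\<And>r. 0 < r \<Longrightarrow> r < infdist x (- \<Omega>) \<Longrightarrow> r \<le> R" and R0: "R \<ge> 0"
    and G1: "\<And>r. r > 0 \<Longrightarrow> r powr (\<beta> - 1) * ball_avg (\<lambda>y. \<bar>u y\<bar>) x r \<le> G1"
    and G2: "\<And>r. r > 0 \<Longrightarrow> r powr (\<beta> - 1) * ball_avg (\<lambda>y. norm (g y)) x r \<le> G2"
  shows "radius_sup (max_weight n \<omega> \<gamma> \<beta> s) \<Omega> u x \<le> radius_sup (max_weight n \<omega> \<gamma> \<beta> s) \<Omega> u x' +
    ennreal ((2 + (\<beta> + n * s) + R * 2 ^ (CARD('n) + 1)) * (1 + R ^ n) powr s * dist x x' * (G1 + G2))"
  unfolding radius_sup_def[of _ _ _ x]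
proof (rule SUP_least)
  define \<kappa> where "\<kappa> = max_weight n \<omega> \<gamma> \<beta> s"
  define K where "K = (1 + R ^ n) powr s"
  have K: "K \<ge> 0" by (simp add: K_def)
  define P where "P = (2 :: real) ^ (CARD('n) + 1)"
  have P: "P \<ge> 0" by (simp add: P_def)
  define M where "M = \<beta> + n * s"
  have M: "M \<ge> 0" using par by (simp add: M_def)
  fix r assume "r \<in> {r. 0 < r \<and> r < infdist x (- \<Omega>)}"
  then have r: "0 < r" "r \<le> R" "r < infdist x (- \<Omega>)" using R by auto
  define h where "h = x' - x"
  have h: "dist x x' = norm h" by (simp add: h_def dist_norm norm_minus_commute)
  define A where "A = ball_avg (\<lambda>y. \<bar>u y\<bar>) x r"
  have A: "A \<ge> 0" unfolding A_def by (intro ball_avg_nonneg) auto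
  define D where "D = ball_avg (\<lambda>y. norm (g y)) x r"
  have D: "D \<ge> 0" unfolding D_def by (intro ball_avg_nonneg) auto
  have G10: "G1 \<ge> 0" by (rule order_trans[OF _ G1[OF r(1)]]) (use A in \<open>simp add: A_def\<close>)
  have G20: "G2 \<ge> 0" by (rule order_trans[OF _ G2[OF r(1)]]) (use D in \<open>simp add: D_def\<close>)
  \<comment> \<open>The 2 accounts for short radii, M for the variation of the weight and
    \<open>R * P\<close> for the shift of the average.\<close>
  define E where "E = (2 + M + R * P) * K * norm h * (G1 + G2)"
  have E0: "E \<ge> 0" unfolding E_def using M R0 P K G10 G20 by (intro mult_nonneg_nonneg add_nonneg_nonneg) auto
  have "ennreal (\<kappa> r * A) \<le> radius_sup \<kappa> \<Omega> u x' + ennreal E"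
  proof (cases "r < 2 * norm h")
    case True
    have "\<kappa> r * A \<le> (K * r powr \<beta>) * A"
      unfolding \<kappa>_def K_def using A r par by (intro mult_right_mono max_weight_le) auto
    also have "\<dots> = K * r * (r powr (\<beta> - 1) * A)"
      by (simp add: powr_eq_mult_powr_minus_one[OF r(1), of \<beta>] mult_ac)
    also have "\<dots> \<le> K * (2 * norm h) * G1"
      using True r K A G1[OF r(1)] by (intro mult_mono) (auto simp: A_def)
    also have "\<dots> = 2 * K * norm h * G1" by simp
    also have "\<dots> \<le> E"
      unfolding E_def using M R0 P K G10 G20 by (intro mult_mono mult_nonneg_nonneg add_nonneg_nonneg) auto
    finally have "ennreal (\<kappa> r * A) \<le> ennreal E" by (rule ennreal_leI)
    then show ?thesis by (rule add_increasing[OF zero_le])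
  next
    case False
    then have rh: "2 * norm h \<le> r" by simp
    define r' where "r' = r - norm h"
    have r': "0 < r'" "r' \<le> r" using rh r by (auto simp: r'_def)
    have r'd: "r' < infdist x' (- \<Omega>)"
      using infdist_triangle_abs[of x "- \<Omega>" x'] r(3) h by (simp add: r'_def)
    define A' where "A' = ball_avg (\<lambda>y. \<bar>u y\<bar>) x' r'"
    have "x + h = x'" by (simp add: h_def)
    moreover have "\<bar>ball_avg (\<lambda>y. \<bar>u y\<bar>) x r - ball_avg (\<lambda>y. \<bar>u y\<bar>) (x + h) (r - norm h)\<bar>
      \<le> 2 ^ (CARD('n) + 1) * norm h * ball_avg (\<lambda>y. norm (g y)) x r"
    proof (rule ball_shift_comparison[OF u g weak r(1) rh])
      \<comment> \<open>The slack between r and the distance to the complement is the room in which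
        \<open>ball_shift_nn_comparison\<close> mollifies.\<close>
      show "0 < infdist x (- \<Omega>) - r" using r by simp
      show "ball x (r + (infdist x (- \<Omega>) - r)) \<subseteq> \<Omega>" by (rule ball_infdist_subset) simp
    qed
    ultimately have AA': "A - A' \<le> P * norm h * D"
      unfolding A_def A'_def P_def D_def r'_def by (simp add: abs_le_iff)
    have k': "\<kappa> r' \<le> K * r powr \<beta>"
    proof -
      have "\<kappa> r' \<le> K * r' powr \<beta>"
        unfolding \<kappa>_def K_def using r r' par by (intro max_weight_le) auto
      also have "\<dots> \<le> K * r powr \<beta>" using r' K par by (intro mult_left_mono powr_mono2) auto
      finally show ?thesis .
    qed
    have k0: "\<kappa> r' \<ge> 0" by (simp add: \<kappa>_def max_weight_nonneg)
    have "(\<kappa> r - \<kappa> r') * A \<le> (M * K * r powr (\<beta> - 1) * (r - r')) * A"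
      unfolding \<kappa>_def M_def K_def using A r r' par by (intro mult_right_mono max_weight_diff_le) auto
    also have "\<dots> = M * K * norm h * (r powr (\<beta> - 1) * A)" by (simp add: r'_def mult_ac)
    also have "\<dots> \<le> M * K * norm h * (G1 + G2)"
      using G1[OF r(1)] M K G20 by (intro mult_left_mono mult_nonneg_nonneg) (auto simp: A_def)
    finally have 1: "(\<kappa> r - \<kappa> r') * A \<le> M * K * norm h * (G1 + G2)" .
    have "\<kappa> r' * (A - A') \<le> \<kappa> r' * (P * norm h * D)" using AA' k0 by (rule mult_left_mono)
    also have "\<dots> \<le> (K * r powr \<beta>) * (P * norm h * D)"
      using k' P D by (intro mult_right_mono) auto
    also have "\<dots> = P * K * norm h * (r * (r powr (\<beta> - 1) * D))"
      by (simp add: powr_eq_mult_powr_minus_one[OF r(1), of \<beta>] mult_ac)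
    also have "\<dots> \<le> P * K * norm h * (R * (G1 + G2))"
      using G2[OF r(1)] r P K G10 G20 D
      by (intro mult_left_mono mult_mono mult_nonneg_nonneg) (auto simp: D_def)
    finally have 2: "\<kappa> r' * (A - A') \<le> R * P * K * norm h * (G1 + G2)" by (simp add: mult_ac)
    have 3: "0 \<le> 2 * K * norm h * (G1 + G2)" using K G10 G20 by simp
    \<comment> \<open>Apart from the term \<open>\<kappa> r' * A'\<close> everything is controlled
      at x alone. As A is nonnegative, the one-sided bound for the weights suffices.\<close>
    have "\<kappa> r * A = \<kappa> r' * A' + (\<kappa> r - \<kappa> r') * A + \<kappa> r' * (A - A')" by (simp add: algebra_simps)
    also have "\<dots> \<le> \<kappa> r' * A' + E"
      using 1 2 3 unfolding E_def distrib_right by argo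
    finally have "ennreal (\<kappa> r * A) \<le> ennreal (\<kappa> r' * A' + E)" by (rule ennreal_leI)
    also have "\<dots> = ennreal (\<kappa> r' * A') + ennreal E"
      using k0 E0 ball_avg_nonneg[of "\<lambda>y. \<bar>u y\<bar>" x' r'] by (intro ennreal_plus mult_nonneg_nonneg) (auto simp: A'_def)
    also have "ennreal (\<kappa> r' * A') \<le> radius_sup \<kappa> \<Omega> u x'"
      unfolding radius_sup_def A'_def using r' r'd by (intro SUP_upper) auto
    finally show ?thesis by (simp add: add_right_mono)
  qed
  then show "ennreal (max_weight n \<omega> \<gamma> \<beta> s r * ball_avg (\<lambda>y. \<bar>u y\<bar>) x r) \<le> radius_sup (max_weight n \<omega> \<gamma> \<beta> s) \<Omega> u x' +
    ennreal ((2 + (\<beta> + n * s) + R * 2 ^ (CARD('n) + 1)) * (1 + R ^ n) powr s * dist x x' * (G1 + G2))"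
    by (simp add: \<kappa>_def A_def E_def M_def P_def K_def h)
qed

section \<open>Weak derivatives from pointwise estimates\<close>

lemma test_function_facts:
  assumes "test_function \<Omega> \<psi>"
  obtains B R where "\<And>x. R \<le> norm x \<Longrightarrow> \<psi> x = 0" "\<And>x. \<bar>\<psi> x\<bar> \<le> B" "\<And>i x. \<bar>partial_deriv i \<psi> x\<bar> \<le> B"
    "continuous_on UNIV \<psi>" "\<And>i. continuous_on UNIV (partial_deriv i \<psi>)" "\<And>x. \<psi> differentiable (at x)"
proof -
  have C: "\<And>k. C_k k \<psi>" and cmp: "compact (closure {x. \<psi> x \<noteq> 0})"
    using assms by (auto simp: test_function_def)
  note C' = C_k_all_partial_deriv[OF C]
  obtain R where R: "\<And>x. x \<in> closure {x. \<psi> x \<noteq> 0} \<Longrightarrow> norm x \<le> R"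
    using compact_imp_bounded[OF cmp] by (auto simp: bounded_iff)
  have 0: "\<psi> x = 0" if "R + 1 \<le> norm x" for x
    using R[of x] closure_subset[of "{x. \<psi> x \<noteq> 0}"] that by force
  have 1: "partial_deriv i \<psi> x = 0" if "R + 2 \<le> norm x" for i x
    using partial_deriv_vanish[where e = "R + 1" and f = \<psi> and x = x] 0 that by auto
  obtain B0 where B0: "\<And>x. \<bar>\<psi> x\<bar> \<le> B0"
    using bounded_continuous_vanishing[OF C'(2) 0] by blast
  have "\<forall>i. \<exists>B. \<forall>x. \<bar>partial_deriv i \<psi> x\<bar> \<le> B"
    using bounded_continuous_vanishing[OF C'(3) 1] by blast
  then obtain Bi where Bi: "\<And>i x. \<bar>partial_deriv i \<psi> x\<bar> \<le> Bi i" by metis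
  define B where "B = \<bar>B0\<bar> + (\<Sum>i\<in>UNIV. \<bar>Bi i\<bar>)"
  have sn: "0 \<le> (\<Sum>i\<in>UNIV. \<bar>Bi i\<bar>)" by (intro sum_nonneg) auto
  have b0: "\<bar>\<psi> x\<bar> \<le> B" for x
    unfolding B_def using order_trans[OF B0[of x] abs_ge_self] sn by argo
  have bi: "\<bar>partial_deriv i \<psi> x\<bar> \<le> B" for i x
  proof -
    have "\<bar>Bi i\<bar> \<le> (\<Sum>i\<in>UNIV. \<bar>Bi i\<bar>)" by (rule member_le_sum) auto
    then show ?thesis using Bi[of i x] by (simp add: B_def)
  qed
  show ?thesis by (rule that[OF 0 b0 bi C'(2,3,1)])
qed

lemma has_real_derivative_partial_deriv:
  fixes \<psi> :: "real^'n \<Rightarrow> real"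
  assumes "\<And>x. \<psi> differentiable (at x)"
  shows "((\<lambda>s. \<psi> (x + s *\<^sub>R axis i 1)) has_real_derivative partial_deriv i \<psi> (x + s *\<^sub>R axis i 1)) (at s)"
proof -
  let ?y = "x + s *\<^sub>R axis i 1"
  have d: "(\<psi> has_derivative frechet_derivative \<psi> (at ?y)) (at ?y)"
    using assms by (simp add: frechet_derivative_works[symmetric])
  have "((\<lambda>s. x + s *\<^sub>R axis i 1) has_derivative (\<lambda>h. h *\<^sub>R axis i 1)) (at s)"
    by (auto intro!: derivative_eq_intros)
  from has_derivative_compose[OF this d]
  have "((\<lambda>s. \<psi> (x + s *\<^sub>R axis i 1)) has_derivative (\<lambda>h. frechet_derivative \<psi> (at ?y) (h *\<^sub>R axis i 1))) (at s)" .
  moreover have "frechet_derivative \<psi> (at ?y) (h *\<^sub>R axis i 1) = partial_deriv i \<psi> ?y * h" for h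
    using linear_cmul[OF has_derivative_linear[OF d], of h "axis i 1"] by (simp add: partial_deriv_def mult.commute)
  ultimately show ?thesis by (simp add: has_field_derivative_def)
qed

lemma AE_translation:
  fixes h :: "'a::euclidean_space"
  assumes "AE x in lborel. P x"
  shows "AE x in lborel. P (x + h)"
proof -
  have "AE x in distr lborel borel ((+) h). P x" unfolding lborel_distr_plus by (rule assms)
  then have "AE x in lborel. P (h + x)" by (rule AE_distrD[rotated]) simp
  then show ?thesis by (simp add: add.commute)
qed

lemma integrable_mult_bounded:
  fixes f h :: "'a::euclidean_space \<Rightarrow> real"
  assumes f: "integrable lborel f" and h[measurable]: "h \<in> borel_measurable borel" and B: "\<And>x. \<bar>h x\<bar> \<le> B"
  shows "integrable lborel (\<lambda>x. f x * h x)"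
proof (rule Bochner_Integration.integrable_bound[of _ "\<lambda>x. B * f x"])
  have "\<bar>f x\<bar> * \<bar>h x\<bar> \<le> \<bar>f x\<bar> * \<bar>B\<bar>" for x
    by (intro mult_left_mono order_trans[OF B abs_ge_self]) auto
  then show "AE x in lborel. norm (f x * h x) \<le> norm (B * f x)"
    by (simp add: abs_mult mult.commute[of "\<bar>B\<bar>"])
qed (use f in auto)

text \<open>The quotients converge pointwise, with a sign because the step is negative, and by the
  mean value theorem they are bounded by the supremum of the partial derivative.\<close>

lemma difference_quotient_test_limit:
  fixes v :: "real^'n \<Rightarrow> real"
  assumes v: "integrable lborel v" and \<psi>: "test_function \<Omega> \<psi>"
  shows "(\<lambda>k. \<integral>x. v x * ((\<psi> (x + (- inverse (real (Suc k))) *\<^sub>R axis i 1) - \<psi> x) / inverse (real (Suc k))) \<partial>lborel)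
     \<longlonglongrightarrow> - (\<integral>x. v x * partial_deriv i \<psi> x \<partial>lborel)"
proof -
  obtain B R where B: "\<And>x. R \<le> norm x \<Longrightarrow> \<psi> x = 0" "\<And>x. \<bar>\<psi> x\<bar> \<le> B" "\<And>i x. \<bar>partial_deriv i \<psi> x\<bar> \<le> B"
    "continuous_on UNIV \<psi>" "\<And>i. continuous_on UNIV (partial_deriv i \<psi>)" "\<And>x. \<psi> differentiable (at x)"
    by (rule test_function_facts[OF \<psi>]) blast
  have [measurable]: "\<psi> \<in> borel_measurable borel" "\<And>i. partial_deriv i \<psi> \<in> borel_measurable borel"
    using B(4,5) by (auto intro: borel_measurable_continuous_onI)
  have [measurable]: "v \<in> borel_measurable borel" using v by auto
  define t where "t k = inverse (real (Suc k))" for k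
  have t: "t k > 0" for k by (simp add: t_def)
  have t0: "t \<longlonglongrightarrow> 0" unfolding t_def by (rule LIMSEQ_inverse_real_of_nat)
  define q where "q k x = (\<psi> (x + (- t k) *\<^sub>R axis i 1) - \<psi> x) / t k" for k x
  have qlim: "(\<lambda>k. q k x) \<longlonglongrightarrow> - partial_deriv i \<psi> x" for x
  proof -
    have "((\<lambda>s. (\<psi> (x + s *\<^sub>R axis i 1) - \<psi> (x + 0 *\<^sub>R axis i 1)) / (s - 0)) \<longlongrightarrow> partial_deriv i \<psi> (x + 0 *\<^sub>R axis i 1)) (at 0)"
      using has_real_derivative_partial_deriv[OF B(6), of x i 0] unfolding has_field_derivative_iff .
    moreover have "filterlim (\<lambda>k. - t k) (at 0) sequentially"
      using tendsto_minus[OF t0] t by (intro filterlim_atI) (auto simp: less_imp_neq[symmetric])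
    ultimately have "(\<lambda>k. (\<psi> (x + (- t k) *\<^sub>R axis i 1) - \<psi> (x + 0 *\<^sub>R axis i 1)) / (- t k - 0)) \<longlonglongrightarrow> partial_deriv i \<psi> (x + 0 *\<^sub>R axis i 1)"
      by (rule filterlim_compose)
    from tendsto_minus[OF this] show ?thesis by (simp add: q_def)
  qed
  have qB: "\<bar>q k x\<bar> \<le> B" for k x
  proof -
    obtain z where z: "\<psi> (x + 0 *\<^sub>R axis i 1) - \<psi> (x + (- t k) *\<^sub>R axis i 1) = (0 - (- t k)) * partial_deriv i \<psi> (x + z *\<^sub>R axis i 1)"
      using MVT2[of "- t k" 0 "\<lambda>s. \<psi> (x + s *\<^sub>R axis i 1)" "\<lambda>s. partial_deriv i \<psi> (x + s *\<^sub>R axis i 1)"]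
        has_real_derivative_partial_deriv[OF B(6)] t[of k] by auto
    then have "q k x = - partial_deriv i \<psi> (x + z *\<^sub>R axis i 1)"
      using t[of k] by (simp add: q_def field_simps)
    then show ?thesis using B(3) by simp
  qed
  have qm[measurable]: "q k \<in> borel_measurable borel" for k unfolding q_def by measurable
  have "(\<lambda>k. \<integral>x. v x * q k x \<partial>lborel) \<longlonglongrightarrow> (\<integral>x. v x * (- partial_deriv i \<psi> x) \<partial>lborel)"
  proof (rule integral_dominated_convergence[where w = "\<lambda>x. \<bar>v x\<bar> * B"])
    show "AE x in lborel. (\<lambda>k. v x * q k x) \<longlonglongrightarrow> v x * (- partial_deriv i \<psi> x)"
      using qlim by (intro AE_I2 tendsto_intros)
    show "AE x in lborel. norm (v x * q k x) \<le> \<bar>v x\<bar> * B" for k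
      using qB by (intro AE_I2) (simp add: abs_mult mult_left_mono)
    show "integrable lborel (\<lambda>x. \<bar>v x\<bar> * B)" using v by auto
  qed measurable
  then show ?thesis by (simp add: q_def t_def)
qed

text \<open>The difference quotients are bounded by G(x) + G(x + e_k), which is no fixed multiple of
  G(x). Truncating them at 2 G(x) costs at most |G(x + e_k) - G(x)|, which tends to 0 in L^1.
  Divided by 2 G they are bounded by 1, and \<open>bounded_weak_limit\<close> applies in the finite
  measure 2 G dx.\<close>

theorem hajlasz_weak_partial_deriv:
  fixes v G :: "real^'n \<Rightarrow> real"
  assumes \<Omega>: "open \<Omega>" and v: "integrable lborel v" and G: "integrable lborel G" "\<And>x. 0 \<le> G x"
    and N: "N \<in> null_sets lborel"
    and haj: "\<And>x x'. x \<in> \<Omega> - N \<Longrightarrow> x' \<in> \<Omega> - N \<Longrightarrow> \<bar>v x - v x'\<bar> \<le> dist x x' * (G x + G x')"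
  shows "\<exists>w. w \<in> borel_measurable borel \<and> (\<forall>x. \<bar>w x\<bar> \<le> 2 * G x) \<and>
    (\<forall>\<psi>. test_function \<Omega> \<psi> \<longrightarrow> (\<integral>x. v x * partial_deriv i \<psi> x \<partial>lborel) = - (\<integral>x. w x * \<psi> x \<partial>lborel))"
proof -
  have [measurable]: "v \<in> borel_measurable borel" "G \<in> borel_measurable borel" using v G by auto
  have [measurable]: "\<Omega> \<in> sets borel" using \<Omega> by simp
  define t where "t k = inverse (real (Suc k))" for k
  have t: "t k > 0" for k by (simp add: t_def)
  have t0: "t \<longlonglongrightarrow> 0" unfolding t_def by (rule LIMSEQ_inverse_real_of_nat)
  define e where "e k = t k *\<^sub>R (axis i 1 :: real^'n)" for k
  have ne: "norm (e k) = t k" for k using t[of k] by (simp add: e_def)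
  \<comment> \<open>The quotient is kept where both points lie in \<Omega>, the only place where the
    pointwise estimate is assumed.\<close>
  define d where "d k x = indicator (\<Omega> \<inter> {x. x + e k \<in> \<Omega>}) x * ((v (x + e k) - v x) / t k)" for k x
  have [measurable]: "{x. x + e k \<in> \<Omega>} \<in> sets borel" for k by measurable
  have dm[measurable]: "d k \<in> borel_measurable borel" for k unfolding d_def by measurable
  have di: "integrable lborel (d k)" for k
  proof (rule Bochner_Integration.integrable_bound[of _ "\<lambda>x. (v (x + e k) - v x) / t k"])
    show "integrable lborel (\<lambda>x. (v (x + e k) - v x) / t k)"
      using v integrable_translation[OF v] by auto
  qed (auto simp: d_def indicator_def)
  define c where "c k x = (if G x = 0 then 0 else max (- 1) (min 1 (d k x / (2 * G x))))" for k x
  have cm[measurable]: "c k \<in> borel_measurable borel" for k unfolding c_def by measurable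
  have c1: "\<bar>c k x\<bar> \<le> 1" for k x by (auto simp: c_def)
  have AEN: "AE x in lborel. x \<notin> N" using N by (rule AE_not_in)
  \<comment> \<open>The estimate needs both x and x + e k outside N, hence the translated null set
    as well. It includes points with \<open>G x = 0\<close>, where \<open>d k x\<close> is at most
    \<open>G (x + e k)\<close>.\<close>
  have diff: "AE x in lborel. \<bar>2 * G x * c k x - d k x\<bar> \<le> \<bar>G (x + e k) - G x\<bar>" for k
    using AEN AE_translation[OF AEN, of "e k"]
  proof eventually_elim
    case (elim x)
    have dle: "\<bar>d k x\<bar> \<le> G x + G (x + e k)"
    proof (cases "x \<in> \<Omega> \<and> x + e k \<in> \<Omega>")
      case True
      then have "\<bar>v x - v (x + e k)\<bar> \<le> t k * (G x + G (x + e k))"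
        using haj[of x "x + e k"] elim ne[of k] by (simp add: dist_norm)
      then show ?thesis
        using True t[of k] by (simp add: d_def divide_le_eq mult.commute abs_minus_commute)
    next
      case False
      then show ?thesis using G(2)[of x] G(2)[of "x + e k"] by (auto simp: d_def)
    qed
    show ?case
    proof (cases "G x = 0")
      case True
      then show ?thesis using dle by (simp add: c_def)
    next
      case False
      then have pos: "G x > 0" using G(2)[of x] by simp
      have "2 * G x * c k x = max (- (2 * G x)) (min (2 * G x) (d k x))"
        using pos by (auto simp: c_def max_def min_def field_simps)
      then show ?thesis using dle G(2)[of x] G(2)[of "x + e k"] by (auto simp: max_def min_def abs_if split: if_splits)
    qed
  qed
  have tr0: "(\<lambda>k. \<integral>x. \<bar>G (x + e k) - G x\<bar> \<partial>lborel) \<longlonglongrightarrow> 0"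
  proof (rule LIMSEQ_I)
    fix \<epsilon> :: real assume "\<epsilon> > 0"
    from translation_L1[OF G(1) this] obtain \<delta> where \<delta>: "\<delta> > 0"
      "\<And>h. norm h < \<delta> \<Longrightarrow> (\<integral>x. norm (G (x + h) - G x) \<partial>lborel) < \<epsilon>" by blast
    from LIMSEQ_D[OF t0 \<delta>(1)] obtain n0 where n0: "\<And>k. k \<ge> n0 \<Longrightarrow> norm (t k - 0) < \<delta>"
      by blast
    then have "norm (e k) < \<delta>" if "k \<ge> n0" for k
      using that ne[of k] t[of k] by force
    then have "norm ((\<integral>x. \<bar>G (x + e k) - G x\<bar> \<partial>lborel) - 0) < \<epsilon>" if "k \<ge> n0" for k
      using \<delta>(2)[of "e k"] that by (simp add: Bochner_Integration.integral_nonneg)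
    then show "\<exists>n0. \<forall>k\<ge>n0. norm ((\<integral>x. \<bar>G (x + e k) - G x\<bar> \<partial>lborel) - 0) < \<epsilon>" by blast
  qed
  define \<mu> where "\<mu> = density lborel (\<lambda>x. ennreal (2 * G x))"
  have \<mu>m: "borel_measurable \<mu> = borel_measurable borel" by (simp add: \<mu>_def cong: measurable_cong_sets)
  have \<mu>int: "(\<integral>x. f x \<partial>\<mu>) = (\<integral>x. 2 * G x * f x \<partial>lborel)" if "f \<in> borel_measurable borel" for f :: "real^'n \<Rightarrow> real"
    unfolding \<mu>_def using that G(2) by (subst integral_density) auto
  have "finite_measure \<mu>"
  proof
    have "(\<integral>\<^sup>+x. ennreal (2 * G x) \<partial>lborel) = ennreal (\<integral>x. 2 * G x \<partial>lborel)"
      using G by (intro nn_integral_eq_integral) auto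
    then show "emeasure \<mu> (space \<mu>) \<noteq> \<infinity>"
      by (simp add: \<mu>_def emeasure_density)
  qed
  have lim: "(\<lambda>k. \<integral>x. c k x * \<psi> x \<partial>\<mu>) \<longlonglongrightarrow> - (\<integral>x. v x * partial_deriv i \<psi> x \<partial>lborel)" if \<psi>: "test_function \<Omega> \<psi>" for \<psi>
  proof -
    obtain B R where B: "\<And>x. R \<le> norm x \<Longrightarrow> \<psi> x = 0" "\<And>x. \<bar>\<psi> x\<bar> \<le> B" "continuous_on UNIV \<psi>"
      by (rule test_function_facts[OF \<psi>]) blast
    have [measurable]: "\<psi> \<in> borel_measurable borel"
      using B(3) by (rule borel_measurable_continuous_onI)
    have B0: "B \<ge> 0" using order_trans[OF abs_ge_zero B(2)] .
    have i1: "integrable lborel (\<lambda>x. 2 * G x * (c k x * \<psi> x))" for k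
    proof (rule integrable_mult_bounded[of _ _ B])
      show "\<bar>c k x * \<psi> x\<bar> \<le> B" for x using mult_mono[OF c1[of k x] B(2)[of x]] by (simp add: abs_mult)
    qed (use G in auto)
    have i2: "integrable lborel (\<lambda>x. d k x * \<psi> x)" for k
      by (rule integrable_mult_bounded[OF di _ B(2)]) measurable
    have ig: "integrable lborel (\<lambda>x. \<bar>G (x + e k) - G x\<bar>)" for k
      using G(1) integrable_translation[OF G(1)] by auto
    have bd: "\<bar>(\<integral>x. c k x * \<psi> x \<partial>\<mu>) - (\<integral>x. d k x * \<psi> x \<partial>lborel)\<bar> \<le> B * (\<integral>x. \<bar>G (x + e k) - G x\<bar> \<partial>lborel)" for k
    proof -
      have "(\<integral>x. c k x * \<psi> x \<partial>\<mu>) - (\<integral>x. d k x * \<psi> x \<partial>lborel) = (\<integral>x. 2 * G x * (c k x * \<psi> x) - d k x * \<psi> x \<partial>lborel)"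
        using i1 i2 by (subst \<mu>int) auto
      also have "\<bar>\<dots>\<bar> \<le> (\<integral>x. \<bar>2 * G x * (c k x * \<psi> x) - d k x * \<psi> x\<bar> \<partial>lborel)"
        by (rule integral_abs_bound)
      also have "\<dots> \<le> (\<integral>x. B * \<bar>G (x + e k) - G x\<bar> \<partial>lborel)"
      proof (rule integral_mono_AE)
        show "AE x in lborel. \<bar>2 * G x * (c k x * \<psi> x) - d k x * \<psi> x\<bar> \<le> B * \<bar>G (x + e k) - G x\<bar>"
          using diff[of k]
        proof eventually_elim
          case (elim x)
          have "\<bar>2 * G x * (c k x * \<psi> x) - d k x * \<psi> x\<bar> = \<bar>\<psi> x\<bar> * \<bar>2 * G x * c k x - d k x\<bar>"
            by (simp add: abs_mult[symmetric] algebra_simps)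
          also have "\<dots> \<le> B * \<bar>G (x + e k) - G x\<bar>"
            using elim B(2)[of x] B0 by (intro mult_mono) auto
          finally show ?case .
        qed
      qed (use i1 i2 ig in auto)
      finally show ?thesis by simp
    qed
    have to0: "(\<lambda>k. B * (\<integral>x. \<bar>G (x + e k) - G x\<bar> \<partial>lborel)) \<longlonglongrightarrow> 0"
      using tr0 by (rule tendsto_mult_right_zero)
    have close: "(\<lambda>k. (\<integral>x. c k x * \<psi> x \<partial>\<mu>) - (\<integral>x. d k x * \<psi> x \<partial>lborel)) \<longlonglongrightarrow> 0"
      by (rule Lim_null_comparison[OF _ to0]) (simp only: real_norm_def bd eventually_True)
    \<comment> \<open>Once \<open>t k\<close> is below the distance of the support of \<psi> from
      the complement, the indicator in \<open>d k\<close> is 1 wherever \<psi> is nonzero.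
      Translating the integral then moves the difference quotient from v to \<psi>.\<close>
    have "eventually (\<lambda>k. (\<integral>x. v x * ((\<psi> (x + (- t k) *\<^sub>R axis i 1) - \<psi> x) / t k) \<partial>lborel) = (\<integral>x. d k x * \<psi> x \<partial>lborel)) sequentially"
    proof -
      define S where "S = closure {x. \<psi> x \<noteq> 0}"
      have S: "compact S" "S \<subseteq> \<Omega>" using \<psi> by (auto simp: test_function_def S_def)
      obtain \<delta> where \<delta>: "\<delta> > 0" "(\<Union>x\<in>S. ball x \<delta>) \<subseteq> \<Omega>"
        using compact_subset_open_imp_ball_epsilon_subset[OF S(1) \<Omega> S(2)] by blast
      have "eventually (\<lambda>k. t k < \<delta>) sequentially" using order_tendstoD(2)[OF t0 \<delta>(1)] .
      then show ?thesis
      proof eventually_elim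
        case (elim k)
        have "d k x * \<psi> x = v (x + e k) * \<psi> x / t k - v x * \<psi> x / t k" for x
        proof (cases "\<psi> x = 0")
          case False
          then have xS: "x \<in> S" unfolding S_def by (intro subsetD[OF closure_subset]) simp
          moreover have "dist x (x + e k) < \<delta>" using elim ne[of k] by (simp add: dist_norm)
          ultimately have "x + e k \<in> (\<Union>x\<in>S. ball x \<delta>)" by (intro UN_I[of x]) auto
          then have "x + e k \<in> \<Omega>" "x \<in> \<Omega>" using subsetD[OF \<delta>(2)] subsetD[OF S(2) xS] by blast+
          then show ?thesis by (simp add: d_def algebra_simps diff_divide_distrib)
        qed simp
        then have "(\<integral>x. d k x * \<psi> x \<partial>lborel) = (\<integral>x. v (x + e k) * \<psi> x / t k - v x * \<psi> x / t k \<partial>lborel)"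
          by simp
        also have "\<dots> = (\<integral>x. v (x + e k) * \<psi> x / t k \<partial>lborel) - (\<integral>x. v x * \<psi> x / t k \<partial>lborel)"
          by (intro Bochner_Integration.integral_diff integrable_divide integrable_mult_bounded[OF _ _ B(2)] integrable_translation v) auto
        also have "(\<integral>x. v (x + e k) * \<psi> x / t k \<partial>lborel) = (\<integral>x. v x * \<psi> (x - e k) / t k \<partial>lborel)"
          using integral_translation[of "\<lambda>x. v x * \<psi> (x - e k) / t k" "e k"] by simp
        also have "\<dots> - (\<integral>x. v x * \<psi> x / t k \<partial>lborel) = (\<integral>x. v x * \<psi> (x - e k) / t k - v x * \<psi> x / t k \<partial>lborel)"
          by (intro Bochner_Integration.integral_diff[symmetric] integrable_divide integrable_mult_bounded[OF _ _ B(2)] v) auto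
        also have "\<dots> = (\<integral>x. v x * ((\<psi> (x + (- t k) *\<^sub>R axis i 1) - \<psi> x) / t k) \<partial>lborel)"
          by (simp add: e_def algebra_simps diff_divide_distrib)
        finally show ?case by simp
      qed
    qed
    from Lim_transform_eventually[OF difference_quotient_test_limit[OF v \<psi>, of i, folded t_def] this]
    have "(\<lambda>k. \<integral>x. d k x * \<psi> x \<partial>lborel) \<longlonglongrightarrow> - (\<integral>x. v x * partial_deriv i \<psi> x \<partial>lborel)" .
    from tendsto_add[OF close this] show ?thesis by simp
  qed
  have "\<exists>w. w \<in> borel_measurable \<mu> \<and> (\<forall>x. \<bar>w x\<bar> \<le> 1) \<and>
      (\<forall>\<psi>\<in>{\<psi>. test_function \<Omega> \<psi>}. (\<integral>x. w x * \<psi> x \<partial>\<mu>) = - (\<integral>x. v x * partial_deriv i \<psi> x \<partial>lborel))"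
  proof (rule bounded_weak_limit[OF \<open>finite_measure \<mu>\<close>])
    show "c k \<in> borel_measurable \<mu>" for k unfolding \<mu>m by measurable
    show "\<psi> \<in> borel_measurable \<mu>" if "\<psi> \<in> {\<psi>. test_function \<Omega> \<psi>}" for \<psi>
      using that by (auto elim!: test_function_facts simp: \<mu>m intro: borel_measurable_continuous_onI)
    show "\<exists>B. \<forall>x. \<bar>\<psi> x\<bar> \<le> B" if "\<psi> \<in> {\<psi>. test_function \<Omega> \<psi>}" for \<psi>
      using that by (auto elim!: test_function_facts)
  qed (use c1 lim in auto)
  then obtain w where w: "w \<in> borel_measurable borel" "\<And>x. \<bar>w x\<bar> \<le> 1"
    "\<And>\<psi>. test_function \<Omega> \<psi> \<Longrightarrow> (\<integral>x. w x * \<psi> x \<partial>\<mu>) = - (\<integral>x. v x * partial_deriv i \<psi> x \<partial>lborel)"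
    unfolding \<mu>m by auto
  note w(1)[measurable]
  show ?thesis
  \<comment> \<open>The weak limit is a density relative to 2 G dx, so the derivative relative to
    Lebesgue measure is its product with 2 G.\<close>
  proof (intro exI[of _ "\<lambda>x. 2 * G x * w x"] conjI allI impI)
    show "(\<lambda>x. 2 * G x * w x) \<in> borel_measurable borel" by measurable
    show "\<bar>2 * G x * w x\<bar> \<le> 2 * G x" for x
      using mult_left_mono[OF w(2)[of x], of "2 * G x"] G(2)[of x] by (simp add: abs_mult)
    fix \<psi> assume \<psi>: "test_function \<Omega> \<psi>"
    have [measurable]: "\<psi> \<in> borel_measurable borel"
      using \<psi> by (auto elim!: test_function_facts intro: borel_measurable_continuous_onI)
    show "(\<integral>x. v x * partial_deriv i \<psi> x \<partial>lborel) = - (\<integral>x. 2 * G x * w x * \<psi> x \<partial>lborel)"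
      using w(3)[OF \<psi>] by (subst (asm) \<mu>int) (auto simp: mult.assoc)
  qed
qed

section \<open>Borel representatives vanishing off the domain\<close>

lemma borel_representative:
  fixes f :: "real^'n \<Rightarrow> real"
  assumes \<Omega>: "\<Omega> \<in> sets borel" and f: "f \<in> borel_measurable (lebesgue_on \<Omega>)"
  obtains u where "u \<in> borel_measurable borel" "\<And>x. x \<notin> \<Omega> \<Longrightarrow> u x = 0" "AE x in lborel. x \<in> \<Omega> \<longrightarrow> f x = u x"
proof -
  have "(\<lambda>x. indicator \<Omega> x *\<^sub>R f x) \<in> borel_measurable lebesgue"
    using f \<Omega> by (subst (asm) borel_measurable_restrict_space_iff) auto
  then have "(\<lambda>x. indicator \<Omega> x *\<^sub>R f x) \<in> borel_measurable (completion lborel)" .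
  from completion_ex_borel_measurable_real[OF this] obtain h where
    h: "h \<in> borel_measurable lborel" "AE x in lborel. indicator \<Omega> x *\<^sub>R f x = h x" by blast
  show ?thesis
  proof (rule that[of "\<lambda>x. indicator \<Omega> x * h x"])
    show "(\<lambda>x. indicator \<Omega> x * h x) \<in> borel_measurable borel" using h(1) \<Omega> by simp
    show "AE x in lborel. x \<in> \<Omega> \<longrightarrow> f x = indicator \<Omega> x * h x"
      using h(2) by eventually_elim (auto simp: indicator_def)
  qed simp
qed

lemma lebesgue_on_transfer:
  fixes h k :: "real^'n \<Rightarrow> 'b::{banach, second_countable_topology}"
  assumes \<Omega>: "\<Omega> \<in> sets borel" and h: "h \<in> borel_measurable (lebesgue_on \<Omega>)" and k: "k \<in> borel_measurable borel"
    and 0: "\<And>x. x \<notin> \<Omega> \<Longrightarrow> k x = 0" and AE: "AE x in lborel. x \<in> \<Omega> \<longrightarrow> h x = k x"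
  shows "integrable (lebesgue_on \<Omega>) h \<longleftrightarrow> integrable lborel k"
    and "(\<integral>x. h x \<partial>lebesgue_on \<Omega>) = (\<integral>x. k x \<partial>lborel)"
proof -
  have m: "(\<lambda>x. indicator \<Omega> x *\<^sub>R h x) \<in> borel_measurable lebesgue"
    using h \<Omega> by (subst (asm) borel_measurable_restrict_space_iff) auto
  have kl: "k \<in> borel_measurable lebesgue" using k by (simp add: measurable_completion)
  have AE': "AE x in lebesgue. indicator \<Omega> x *\<^sub>R h x = k x"
  proof (rule AE_completion)
    show "AE x in lborel. indicator \<Omega> x *\<^sub>R h x = k x"
      using AE by eventually_elim (auto simp: 0 indicator_def)
  qed
  have "integrable (lebesgue_on \<Omega>) h \<longleftrightarrow> integrable lebesgue (\<lambda>x. indicator \<Omega> x *\<^sub>R h x)"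
    using \<Omega> by (intro integrable_restrict_space) auto
  also have "\<dots> \<longleftrightarrow> integrable lebesgue k"
    by (rule integrable_cong_AE[OF m kl AE'])
  also have "\<dots> \<longleftrightarrow> integrable lborel k"
    using k by (intro integrable_completion) simp
  finally show "integrable (lebesgue_on \<Omega>) h \<longleftrightarrow> integrable lborel k" .
  have "(\<integral>x. h x \<partial>lebesgue_on \<Omega>) = (\<integral>x. indicator \<Omega> x *\<^sub>R h x \<partial>lebesgue)"
    using \<Omega> by (intro integral_restrict_space) auto
  also have "\<dots> = (\<integral>x. k x \<partial>lebesgue)"
    by (rule integral_cong_AE[OF m kl AE'])
  also have "\<dots> = (\<integral>x. k x \<partial>lborel)"
    using k by (intro integral_completion) simp
  finally show "(\<integral>x. h x \<partial>lebesgue_on \<Omega>) = (\<integral>x. k x \<partial>lborel)" .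
qed

section \<open>Uniqueness of the weak gradient\<close>

text \<open>The fundamental lemma of the calculus of variations on a ball: a mollification at a
  point of the ball is a test integral, hence 0, while mollifications converge in L^1. The doubled
  radius leaves room for the mollifier and gives a compact set on which h is integrable.\<close>

lemma vanishing_test_integrals_ball:
  fixes h :: "real^'n \<Rightarrow> real"
  assumes li: "locally_integrable \<Omega> h" and \<Omega>: "open \<Omega>"
    and 0: "\<And>\<psi>. test_function \<Omega> \<psi> \<Longrightarrow> (\<integral>x. h x * \<psi> x \<partial>lebesgue_on \<Omega>) = 0"
    and \<rho>: "\<rho> > 0" "cball z (2 * \<rho>) \<subseteq> \<Omega>"
  shows "AE x in lborel. x \<in> ball z \<rho> \<longrightarrow> h x = 0"
proof -
  define K where "K = cball z (2 * \<rho>)"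
  have KB: "K \<in> sets borel" by (simp add: K_def)
  have hi: "integrable (lebesgue_on K) h" using li \<rho>(2) by (auto simp: locally_integrable_def K_def)
  then have hK: "h \<in> borel_measurable (lebesgue_on K)" by auto
  obtain k where k: "k \<in> borel_measurable borel" "\<And>x. x \<notin> K \<Longrightarrow> k x = 0" "AE x in lborel. x \<in> K \<longrightarrow> h x = k x"
    by (rule borel_representative[OF KB hK]) blast
  note k(1)[measurable]
  have ki: "integrable lborel k"
    using lebesgue_on_transfer(1)[OF KB hK k] hi by simp
  have small: "(\<integral>\<^sup>+x \<in> ball z \<rho>. ennreal \<bar>k x\<bar> \<partial>lborel) \<le> ennreal \<delta>" if \<delta>: "\<delta> > 0" for \<delta>
  proof -
    obtain d where d: "d > 0" "\<And>h. norm h < d \<Longrightarrow> (\<integral>x. norm (k (x + h) - k x) \<partial>lborel) < \<delta>"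
      using translation_L1[OF ki \<delta>] by blast
    define e where "e = min d (\<rho> / 2)"
    have e: "e > 0" "e \<le> d" "e < \<rho>" using d \<rho> by (auto simp: e_def)
    obtain \<eta> :: "real^'n \<Rightarrow> real" where \<eta>: "\<And>x. 0 \<le> \<eta> x" "\<And>x. e \<le> norm x \<Longrightarrow> \<eta> x = 0" "integrable lborel \<eta>"
      "(\<integral>x. \<eta> x \<partial>lborel) = 1" "\<And>k. C_k k \<eta>" "\<And>k y. C_k k (\<lambda>\<xi>. \<eta> (y - \<xi>))"
      using mollifier_exists[OF e(1)] by metis
    have \<eta>c: "continuous_on UNIV \<eta>" by (rule C_k_all_partial_deriv(2)[OF \<eta>(5)])
    have [measurable]: "\<eta> \<in> borel_measurable borel" using \<eta>(3) by auto
    have "\<exists>K. \<forall>x. \<bar>\<eta> x\<bar> \<le> K"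
      by (rule bounded_continuous_vanishing[OF \<eta>c \<eta>(2)])
    then obtain M where "\<And>x. \<bar>\<eta> x\<bar> \<le> M" by blast
    then have M: "\<eta> x \<le> M" for x by (rule abs_le_D1)
    have moll: "mollify \<eta> k y = 0" if y: "y \<in> ball z \<rho>" for y
    proof -
      have sub: "cball y e \<subseteq> K"
      proof
        fix x assume "x \<in> cball y e"
        then show "x \<in> K" using y e dist_triangle[of z x y] by (simp add: K_def)
      qed
      then have tf: "test_function \<Omega> (\<lambda>\<xi>. \<eta> (y - \<xi>))"
        using \<rho>(2) by (intro test_function_reflect \<eta>) (auto simp: K_def)
      have van: "\<eta> (y - x) = 0" if "x \<notin> K" for x
      proof -
        have "x \<notin> cball y e" using sub that by blast
        then show ?thesis using \<eta>(2)[of "y - x"] by (simp add: dist_norm)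
      qed
      have cont: "continuous_on UNIV (\<lambda>x. \<eta> (y - x))"
        by (rule continuous_on_compose2[OF \<eta>c]) (auto intro!: continuous_intros)
      have hm: "(\<lambda>x. h x * \<eta> (y - x)) \<in> borel_measurable (lebesgue_on \<Omega>)"
      proof -
        have "(\<lambda>x. indicator K x *\<^sub>R h x) \<in> borel_measurable lebesgue"
          using hK KB by (subst (asm) borel_measurable_restrict_space_iff) auto
        moreover have "(\<lambda>x. \<eta> (y - x)) \<in> borel_measurable lebesgue"
          using borel_measurable_continuous_onI[OF cont] by (simp add: measurable_completion)
        ultimately have "(\<lambda>x. (indicator K x *\<^sub>R h x) * \<eta> (y - x)) \<in> borel_measurable lebesgue"
          by (rule borel_measurable_times)
        also have "(\<lambda>x. (indicator K x *\<^sub>R h x) * \<eta> (y - x)) = (\<lambda>x. h x * \<eta> (y - x))"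
          by (rule ext) (use van in \<open>auto simp: indicator_def\<close>)
        finally show ?thesis by (rule measurable_restrict_space1)
      qed
      have AE: "AE x in lborel. x \<in> \<Omega> \<longrightarrow> h x * \<eta> (y - x) = \<eta> (y - x) * k x"
        using k(3)
      proof eventually_elim
        case (elim x)
        then show ?case using van[of x] by (cases "x \<in> K") auto
      qed
      have "(\<integral>x. h x * \<eta> (y - x) \<partial>lebesgue_on \<Omega>) = (\<integral>x. \<eta> (y - x) * k x \<partial>lborel)"
      proof (rule lebesgue_on_transfer(2)[OF _ hm _ _ AE])
        show "\<eta> (y - x) * k x = 0" if "x \<notin> \<Omega>" for x
        proof -
          have "x \<notin> K" using that \<rho>(2) unfolding K_def by blast
          then show ?thesis by (simp add: van)
        qed
      qed (use \<Omega> in auto)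
      then show ?thesis using 0[OF tf] by (simp add: mollify_def)
    qed
    have "(\<integral>\<^sup>+x \<in> ball z \<rho>. ennreal \<bar>k x\<bar> \<partial>lborel) \<le> (\<integral>\<^sup>+x. norm (mollify \<eta> k x - k x) \<partial>lborel)"
      by (intro nn_integral_mono) (auto simp: indicator_def moll)
    also have "\<dots> \<le> ennreal \<delta>"
      using d(2) e(2) by (intro mollify_L1_le[OF \<eta>(3,1) M \<eta>(2,4) ki]) (auto intro: less_imp_le)
    finally show ?thesis .
  qed
  have "(\<integral>\<^sup>+x \<in> ball z \<rho>. ennreal \<bar>k x\<bar> \<partial>lborel) \<le> 0"
    by (rule ennreal_le_epsilon) (simp add: small)
  then have "(\<integral>\<^sup>+x \<in> ball z \<rho>. ennreal \<bar>k x\<bar> \<partial>lborel) = 0" by simp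
  then have "AE x in lborel. ennreal \<bar>k x\<bar> * indicator (ball z \<rho>) x = 0"
    by (subst (asm) nn_integral_0_iff_AE) auto
  then show ?thesis
    using k(3)
  proof eventually_elim
    case (elim x)
    show ?case
    proof
      assume x: "x \<in> ball z \<rho>"
      then have "x \<in> K" using \<rho>(1) by (simp add: K_def)
      then show "h x = 0" using elim x by simp
    qed
  qed
qed

text \<open>The local statement yields one null set for each ball; Lindelof reduces the cover of
  \<Omega> to countably many.\<close>

lemma vanishing_test_integrals:
  fixes h :: "real^'n \<Rightarrow> real"
  assumes li: "locally_integrable \<Omega> h" and \<Omega>: "open \<Omega>"
    and 0: "\<And>\<psi>. test_function \<Omega> \<psi> \<Longrightarrow> (\<integral>x. h x * \<psi> x \<partial>lebesgue_on \<Omega>) = 0"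
  shows "AE x in lborel. x \<in> \<Omega> \<longrightarrow> h x = 0"
proof -
  define F where "F = {B. \<exists>z \<rho>. B = ball z \<rho> \<and> \<rho> > 0 \<and> cball z (2 * \<rho>) \<subseteq> \<Omega>}"
  obtain F' where F': "F' \<subseteq> F" "countable F'" "\<Union>F' = \<Union>F"
    by (rule Lindelof[of F]) (auto simp: F_def)
  have cover: "\<Omega> \<subseteq> \<Union>F"
  proof
    fix x assume "x \<in> \<Omega>"
    then obtain e where e: "e > 0" "cball x e \<subseteq> \<Omega>" using \<Omega> open_contains_cball by blast
    then have "ball x (e / 2) \<in> F" unfolding F_def by (intro CollectI exI[of _ x] exI[of _ "e / 2"]) auto
    then show "x \<in> \<Union>F" using e(1) by (intro UnionI[of "ball x (e / 2)"]) auto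
  qed
  have "AE x in lborel. x \<in> B \<longrightarrow> h x = 0" if "B \<in> F'" for B
    using that F'(1) vanishing_test_integrals_ball[OF li \<Omega> 0] by (auto simp: F_def)
  then have "AE x in lborel. \<forall>B\<in>F'. x \<in> B \<longrightarrow> h x = 0"
    by (subst AE_ball_countable[OF F'(2)]) blast
  then show ?thesis
  proof eventually_elim
    case (elim x)
    then show ?case using cover F'(3) by blast
  qed
qed

lemma locally_integrable_component:
  fixes g :: "real^'n \<Rightarrow> real^'m"
  assumes "locally_integrable \<Omega> g"
  shows "locally_integrable \<Omega> (\<lambda>x. g x $ i)"
  unfolding locally_integrable_def
proof (intro allI impI)
  fix K assume "compact K \<and> K \<subseteq> \<Omega>"
  then have "integrable (lebesgue_on K) g" using assms by (simp add: locally_integrable_def)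
  then show "integrable (lebesgue_on K) (\<lambda>x. g x $ i)"
    by (rule integrable_bounded_linear[OF bounded_linear_vec_nth])
qed

lemma integrable_locally_integrable_test:
  fixes h :: "real^'n \<Rightarrow> real"
  assumes li: "locally_integrable \<Omega> h" and \<Omega>: "open \<Omega>" and \<psi>: "test_function \<Omega> \<psi>"
  shows "integrable (lebesgue_on \<Omega>) (\<lambda>x. h x * \<psi> x)"
proof -
  define K where "K = closure {x. \<psi> x \<noteq> 0}"
  have K: "compact K" "K \<subseteq> \<Omega>" using \<psi> by (auto simp: test_function_def K_def)
  have KB: "K \<in> sets lebesgue" using K(1) by (simp add: borel_compact)
  have van: "\<psi> x = 0" if "x \<notin> K" for x using closure_subset[of "{x. \<psi> x \<noteq> 0}"] that unfolding K_def by blast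
  obtain B where B: "\<And>x. \<bar>\<psi> x\<bar> \<le> B" "continuous_on UNIV \<psi>"
    by (rule test_function_facts[OF \<psi>]) blast
  have hi: "integrable lebesgue (\<lambda>x. indicator K x *\<^sub>R h x)"
    using li K KB by (subst integrable_restrict_space[symmetric]) (auto simp: locally_integrable_def)
  have pm: "\<psi> \<in> borel_measurable lebesgue"
    using borel_measurable_continuous_onI[OF B(2)] by (simp add: measurable_completion)
  have eq: "(\<lambda>x. indicator \<Omega> x *\<^sub>R (h x * \<psi> x)) = (\<lambda>x. (indicator K x *\<^sub>R h x) * \<psi> x)"
    using van K(2) by (auto simp: indicator_def fun_eq_iff)
  have "integrable lebesgue (\<lambda>x. (indicator K x *\<^sub>R h x) * \<psi> x)"
  proof (rule Bochner_Integration.integrable_bound[of _ "\<lambda>x. B * (indicator K x *\<^sub>R h x)"])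
    have "\<bar>indicator K x *\<^sub>R h x\<bar> * \<bar>\<psi> x\<bar> \<le> \<bar>indicator K x *\<^sub>R h x\<bar> * \<bar>B\<bar>" for x
      by (intro mult_left_mono order_trans[OF B(1) abs_ge_self]) auto
    then show "AE x in lebesgue. norm ((indicator K x *\<^sub>R h x) * \<psi> x) \<le> norm (B * (indicator K x *\<^sub>R h x))"
      by (simp add: abs_mult mult.commute[of "\<bar>B\<bar>"])
  qed (use hi pm in auto)
  then have "integrable lebesgue (\<lambda>x. indicator \<Omega> x *\<^sub>R (h x * \<psi> x))" unfolding eq .
  then show ?thesis
    using \<Omega> by (subst integrable_restrict_space) auto
qed

text \<open>Through this lemma any weak gradient at hand can replace the one chosen by
  \<open>weak_gradient\<close> when norms are computed.\<close>

lemma has_weak_gradient_unique: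
  fixes f :: "real^'n \<Rightarrow> real"
  assumes \<Omega>: "open \<Omega>" and g: "has_weak_gradient \<Omega> f g" and g': "has_weak_gradient \<Omega> f g'"
  shows "AE x in lborel. x \<in> \<Omega> \<longrightarrow> g x = g' x"
proof -
  have li: "locally_integrable \<Omega> (\<lambda>x. g x $ i)" "locally_integrable \<Omega> (\<lambda>x. g' x $ i)" for i
    using g g' by (auto simp: has_weak_gradient_def intro: locally_integrable_component)
  have "AE x in lborel. x \<in> \<Omega> \<longrightarrow> g x $ i - g' x $ i = 0" for i
  proof (rule vanishing_test_integrals[OF _ \<Omega>])
    show "locally_integrable \<Omega> (\<lambda>x. g x $ i - g' x $ i)"
      using li unfolding locally_integrable_def by auto
    fix \<psi> assume \<psi>: "test_function \<Omega> \<psi>"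
    have "(\<integral>x. (g x $ i - g' x $ i) * \<psi> x \<partial>lebesgue_on \<Omega>) = (\<integral>x. g x $ i * \<psi> x - g' x $ i * \<psi> x \<partial>lebesgue_on \<Omega>)"
      by (simp add: left_diff_distrib)
    also have "\<dots> = (\<integral>x. g x $ i * \<psi> x \<partial>lebesgue_on \<Omega>) - (\<integral>x. g' x $ i * \<psi> x \<partial>lebesgue_on \<Omega>)"
      by (intro Bochner_Integration.integral_diff integrable_locally_integrable_test li \<Omega> \<psi>)
    also have "\<dots> = 0"
    proof -
      have "(\<integral>x. f x * partial_deriv i \<psi> x \<partial>lebesgue_on \<Omega>) = - (\<integral>x. g x $ i * \<psi> x \<partial>lebesgue_on \<Omega>)"
        using g \<psi> unfolding has_weak_gradient_def by blast
      moreover have "(\<integral>x. f x * partial_deriv i \<psi> x \<partial>lebesgue_on \<Omega>) = - (\<integral>x. g' x $ i * \<psi> x \<partial>lebesgue_on \<Omega>)"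
        using g' \<psi> unfolding has_weak_gradient_def by blast
      ultimately show ?thesis by simp
    qed
    finally show "(\<integral>x. (g x $ i - g' x $ i) * \<psi> x \<partial>lebesgue_on \<Omega>) = 0" .
  qed
  then have "AE x in lborel. \<forall>i. x \<in> \<Omega> \<longrightarrow> g x $ i - g' x $ i = 0"
    by (rule eventually_all_finite)
  then show ?thesis by eventually_elim (auto simp: vec_eq_iff)
qed

section \<open>The maximal function of a Sobolev function\<close>

lemma powr_add_le:
  fixes x y t :: real
  assumes "0 \<le> x" "0 \<le> y" "0 \<le> t"
  shows "(x + y) powr t \<le> 2 powr t * (x powr t + y powr t)"
proof -
  have "(x + y) powr t \<le> (2 * max x y) powr t"
    using assms by (intro powr_mono2) auto
  also have "\<dots> = 2 powr t * max x y powr t" using assms by (simp add: powr_mult)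
  also have "\<dots> \<le> 2 powr t * (x powr t + y powr t)"
    using assms by (intro mult_left_mono) (auto simp: max_def)
  finally show ?thesis .
qed

lemma le_one_add_powr:
  fixes x q :: real
  assumes "x \<ge> 0" "q \<ge> 1"
  shows "x \<le> 1 + x powr q"
proof (cases "x \<le> 1")
  case False
  then have "x powr 1 \<le> x powr q" using assms by (intro powr_mono) auto
  then show ?thesis using False by simp
qed (simp add: add_increasing2)

text \<open>Since |f| is at most 1 + |f|^q and f vanishes off a set of finite measure, L^q functions
  are integrable.\<close>

lemma integrable_of_powr:
  fixes f :: "'a::euclidean_space \<Rightarrow> 'b::{banach, second_countable_topology}"
  assumes \<Omega>: "\<Omega> \<in> sets borel" "emeasure lborel \<Omega> < \<infinity>" and f: "f \<in> borel_measurable borel"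
    and 0: "\<And>x. x \<notin> \<Omega> \<Longrightarrow> f x = 0" and q: "q \<ge> 1" and i: "integrable lborel (\<lambda>x. norm (f x) powr q)"
  shows "integrable lborel f"
proof (rule Bochner_Integration.integrable_bound)
  show "integrable lborel (\<lambda>x. indicator \<Omega> x + norm (f x) powr q)"
    using i \<Omega> by (intro Bochner_Integration.integrable_add integrable_real_indicator) auto
  have "norm (f x) \<le> indicator \<Omega> x + norm (f x) powr q" for x
    using le_one_add_powr[OF norm_ge_zero q, of "f x"] 0[of x] by (cases "x \<in> \<Omega>") auto
  then show "AE x in lborel. norm (f x) \<le> norm (indicator \<Omega> x + norm (f x) powr q)"
    by (intro AE_I2) (auto intro: order_trans[OF _ abs_ge_self])
qed (use f in auto)

lemma Lq_norm_mono:
  fixes f :: "'a::euclidean_space \<Rightarrow> 'b::{banach, second_countable_topology}"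
  assumes f: "f \<in> borel_measurable borel" and h: "integrable lborel (\<lambda>x. h x powr q)" "\<And>x. 0 \<le> h x"
    and le: "AE x in lborel. norm (f x) \<le> c * h x" and c: "c \<ge> 0" and q: "q > 0"
  shows "integrable lborel (\<lambda>x. norm (f x) powr q)"
    and "(\<integral>x. norm (f x) powr q \<partial>lborel) powr (1 / q) \<le> c * (\<integral>x. h x powr q \<partial>lborel) powr (1 / q)"
proof -
  have le': "AE x in lborel. norm (f x) powr q \<le> c powr q * h x powr q"
    using le
  proof eventually_elim
    case (elim x)
    then have "norm (f x) powr q \<le> (c * h x) powr q" using q by (intro powr_mono2) auto
    then show ?case using c h(2)[of x] by (simp add: powr_mult)
  qed
  have hi: "integrable lborel (\<lambda>x. c powr q * h x powr q)" using h(1) by simp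
  show i: "integrable lborel (\<lambda>x. norm (f x) powr q)"
  proof (rule Bochner_Integration.integrable_bound[OF hi])
    show "AE x in lborel. norm (norm (f x) powr q) \<le> norm (c powr q * h x powr q)"
      using le' by eventually_elim (simp add: abs_mult)
  qed (use f in measurable)
  have "(\<integral>x. norm (f x) powr q \<partial>lborel) \<le> (\<integral>x. c powr q * h x powr q \<partial>lborel)"
    by (rule integral_mono_AE[OF i hi le'])
  then have "(\<integral>x. norm (f x) powr q \<partial>lborel) powr (1 / q) \<le> (c powr q * (\<integral>x. h x powr q \<partial>lborel)) powr (1 / q)"
    using q by (intro powr_mono2) (auto intro: Bochner_Integration.integral_nonneg)
  also have "\<dots> = c * (\<integral>x. h x powr q \<partial>lborel) powr (1 / q)"
    using c q by (simp add: powr_mult powr_powr Bochner_Integration.integral_nonneg)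
  finally show "(\<integral>x. norm (f x) powr q \<partial>lborel) powr (1 / q) \<le> c * (\<integral>x. h x powr q \<partial>lborel) powr (1 / q)" .
qed

text \<open>A quasi-triangle inequality in place of Minkowski: \<open>powr_add_le\<close> is used
  twice, costing 2 after the q-th root and at most 2 again for the exponent 1 / q.\<close>

lemma Lq_norm_add:
  fixes f h :: "'a::euclidean_space \<Rightarrow> real"
  assumes f: "f \<in> borel_measurable borel" "integrable lborel (\<lambda>x. f x powr q)" "\<And>x. 0 \<le> f x"
    and h: "h \<in> borel_measurable borel" "integrable lborel (\<lambda>x. h x powr q)" "\<And>x. 0 \<le> h x" and q: "q \<ge> 1"
  shows "integrable lborel (\<lambda>x. (f x + h x) powr q)"
    and "(\<integral>x. (f x + h x) powr q \<partial>lborel) powr (1 / q) \<le>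
      4 * ((\<integral>x. f x powr q \<partial>lborel) powr (1 / q) + (\<integral>x. h x powr q \<partial>lborel) powr (1 / q))"
proof -
  have le: "(f x + h x) powr q \<le> 2 powr q * (f x powr q + h x powr q)" for x
    using f(3) h(3) q by (intro powr_add_le) auto
  have ib: "integrable lborel (\<lambda>x. 2 powr q * (f x powr q + h x powr q))" using f(2) h(2) by auto
  show i: "integrable lborel (\<lambda>x. (f x + h x) powr q)"
  proof (rule Bochner_Integration.integrable_bound[OF ib])
    show "AE x in lborel. norm ((f x + h x) powr q) \<le> norm (2 powr q * (f x powr q + h x powr q))"
      using le by (intro AE_I2) (auto intro: order_trans[OF _ abs_ge_self])
  qed (use f h in measurable)
  define X where "X = (\<integral>x. f x powr q \<partial>lborel)"
  define Y where "Y = (\<integral>x. h x powr q \<partial>lborel)"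
  have XY: "X \<ge> 0" "Y \<ge> 0" by (auto simp: X_def Y_def intro!: Bochner_Integration.integral_nonneg)
  have "(\<integral>x. (f x + h x) powr q \<partial>lborel) \<le> (\<integral>x. 2 powr q * (f x powr q + h x powr q) \<partial>lborel)"
    by (rule Bochner_Integration.integral_mono[OF i ib le])
  also have "\<dots> = 2 powr q * (X + Y)" using f(2) h(2) by (simp add: X_def Y_def)
  finally have "(\<integral>x. (f x + h x) powr q \<partial>lborel) powr (1 / q) \<le> (2 powr q * (X + Y)) powr (1 / q)"
    using q by (intro powr_mono2) (auto intro: Bochner_Integration.integral_nonneg)
  also have "\<dots> = 2 * (X + Y) powr (1 / q)" using q XY by (simp add: powr_mult powr_powr)
  also have "\<dots> \<le> 2 * (2 powr (1 / q) * (X powr (1 / q) + Y powr (1 / q)))"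
    using q XY by (intro mult_left_mono powr_add_le) auto
  also have "\<dots> \<le> 2 * (2 powr 1 * (X powr (1 / q) + Y powr (1 / q)))"
    using q by (intro mult_left_mono mult_right_mono powr_mono add_nonneg_nonneg) auto
  finally show "(\<integral>x. (f x + h x) powr q \<partial>lborel) powr (1 / q) \<le>
      4 * ((\<integral>x. f x powr q \<partial>lborel) powr (1 / q) + (\<integral>x. h x powr q \<partial>lborel) powr (1 / q))"
    by (simp add: X_def Y_def)
qed

lemma set_nn_integral_ball_eq_avg:
  fixes u :: "real^'n \<Rightarrow> real"
  assumes u: "integrable lborel u" and r: "r > 0"
  shows "(\<integral>\<^sup>+y \<in> ball x r. ennreal \<bar>u y\<bar> \<partial>lborel) = ennreal (measure lborel (ball x r) * ball_avg (\<lambda>y. \<bar>u y\<bar>) x r)"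
proof -
  have ua: "integrable lborel (\<lambda>y. \<bar>u y\<bar>)" using u by auto
  have i: "integrable lborel (\<lambda>y. indicator (ball x r) y * \<bar>u y\<bar>)"
    using integrable_mult_indicator[OF _ ua, of "ball x r"] by simp
  have "(\<integral>\<^sup>+y \<in> ball x r. ennreal \<bar>u y\<bar> \<partial>lborel) = (\<integral>\<^sup>+y. ennreal (indicator (ball x r) y * \<bar>u y\<bar>) \<partial>lborel)"
    by (intro nn_integral_cong) (auto simp: indicator_def)
  also have "\<dots> = ennreal (\<integral>y. indicator (ball x r) y * \<bar>u y\<bar> \<partial>lborel)"
    by (rule nn_integral_eq_integral[OF i]) auto
  finally show ?thesis using content_ball_pos[OF r, of x] by (simp add: ball_avg_def)
qed

lemma radius_sup_outside:
  assumes "x \<notin> \<Omega>"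
  shows "radius_sup \<kappa> \<Omega> u x = 0"
proof -
  have "infdist x (- \<Omega>) = 0" using assms by simp
  then have "{r. 0 < r \<and> r < infdist x (- \<Omega>)} = {}" by auto
  then show ?thesis unfolding radius_sup_def by (simp only: image_empty Sup_empty bot_ennreal)
qed

text \<open>For each r the weighted average is the measure of B(x, r) under a density with the
  weight folded in. The superlevel sets are therefore unions of open sets, and no regularity of
  \<kappa> in r enters.\<close>

lemma borel_measurable_radius_sup:
  fixes u :: "real^'n \<Rightarrow> real"
  assumes u: "integrable lborel u" and \<kappa>: "\<And>r. \<kappa> r \<ge> 0"
  shows "radius_sup \<kappa> \<Omega> u \<in> borel_measurable borel"
proof (rule borel_measurableI_greater)
  fix t
  define M where "M r = density lborel (\<lambda>y. ennreal (\<kappa> r / measure lborel (ball (0::real^'n) r)) * ennreal \<bar>u y\<bar>)" for r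
  have um[measurable]: "u \<in> borel_measurable borel" using u by auto
  have eq: "ennreal (\<kappa> r * ball_avg (\<lambda>y. \<bar>u y\<bar>) x r) = emeasure (M r) (ball x r)" if r: "r > 0" for r x
  proof -
    have V: "measure lborel (ball x r) = measure lborel (ball (0::real^'n) r)" "measure lborel (ball (0::real^'n) r) > 0"
      using r content_ball_pos[OF r, of "0::real^'n"] by (auto simp: content_ball)
    have "emeasure (M r) (ball x r) = ennreal (\<kappa> r / measure lborel (ball (0::real^'n) r)) * (\<integral>\<^sup>+y \<in> ball x r. ennreal \<bar>u y\<bar> \<partial>lborel)"
      unfolding M_def by (subst emeasure_density) (auto simp: mult.assoc nn_integral_cmult)
    also have "\<dots> = ennreal (\<kappa> r / measure lborel (ball (0::real^'n) r)) * ennreal (measure lborel (ball x r) * ball_avg (\<lambda>y. \<bar>u y\<bar>) x r)"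
      by (simp only: set_nn_integral_ball_eq_avg[OF u r])
    also have "\<dots> = ennreal (\<kappa> r / measure lborel (ball (0::real^'n) r) * (measure lborel (ball x r) * ball_avg (\<lambda>y. \<bar>u y\<bar>) x r))"
      using V \<kappa>[of r] ball_avg_nonneg[of "\<lambda>y. \<bar>u y\<bar>" x r] by (intro ennreal_mult[symmetric]) auto
    finally show ?thesis using V by simp
  qed
  have "{x. t < radius_sup \<kappa> \<Omega> u x} = (\<Union>r\<in>{0<..}. {x. r < infdist x (- \<Omega>)} \<inter> {x. t < emeasure (M r) (ball x r)})"
    unfolding radius_sup_def less_SUP_iff using eq by auto
  moreover have "open \<dots>"
  proof (intro open_UN ballI open_Int)
    fix r :: real
    show "open {x. r < infdist x (- \<Omega>)}" by (intro open_Collect_less continuous_intros)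
    show "open {x. t < emeasure (M r) (ball x r)}" by (rule open_ball_emeasure_gt) (simp add: M_def)
  qed
  ultimately show "{x \<in> space borel. t < radius_sup \<kappa> \<Omega> u x} \<in> sets borel" by simp
qed

text \<open>Equality holds at every x although f and u agree only almost everywhere, because they
  enter through integrals over balls inside \<Omega>. The volume in the denominator turns the
  integral into an average, and \<phi> of the volume is the denominator of
  \<open>max_weight\<close>.\<close>

lemma local_frac_maximal_eq_radius_sup:
  fixes f u :: "real^'n \<Rightarrow> real"
  assumes \<Omega>: "- \<Omega> \<noteq> {}" and u: "integrable lborel u" and AE: "AE x in lborel. x \<in> \<Omega> \<longrightarrow> f x = u x"
  shows "local_frac_maximal \<gamma> \<beta> \<Omega> f x =
    radius_sup (max_weight CARD('n) (measure lborel (ball (0::real^'n) 1)) \<gamma> \<beta> (\<gamma> * \<beta> / real CARD('n))) \<Omega> u x"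
proof -
  define \<omega> where "\<omega> = measure lborel (ball (0::real^'n) 1)"
  have um[measurable]: "u \<in> borel_measurable borel" using u by auto
  have "ennreal (r powr \<beta> * (1 + r ^ CARD('n)) powr (\<gamma> * \<beta> / real CARD('n)) /
        (growth_phi \<gamma> (measure lebesgue (ball x r)) * measure lebesgue (ball x r))) *
        (\<integral>\<^sup>+ y \<in> ball x r. ennreal \<bar>f y\<bar> \<partial>lebesgue) =
      ennreal (max_weight CARD('n) \<omega> \<gamma> \<beta> (\<gamma> * \<beta> / real CARD('n)) r * ball_avg (\<lambda>y. \<bar>u y\<bar>) x r)"
    if r: "0 < r" "r < infdist x (- \<Omega>)" for r
  proof -
    define V where "V = measure lborel (ball x r)"
    have V: "V > 0" unfolding V_def using r(1) by (rule content_ball_pos)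
    have Vl: "measure lebesgue (ball x r) = V" by (simp add: V_def)
    have V\<omega>: "V = \<omega> * r ^ CARD('n)"
      using content_ball_conv_unit_ball[of r x] r by (simp add: V_def \<omega>_def)
    have sub: "ball x r \<subseteq> \<Omega>" using r by (intro ball_infdist_subset) simp
    have "(\<integral>\<^sup>+ y \<in> ball x r. ennreal \<bar>f y\<bar> \<partial>lebesgue) = (\<integral>\<^sup>+ y \<in> ball x r. ennreal \<bar>u y\<bar> \<partial>lebesgue)"
    proof (rule nn_integral_cong_AE, rule AE_completion)
      show "AE y in lborel. ennreal \<bar>f y\<bar> * indicator (ball x r) y = ennreal \<bar>u y\<bar> * indicator (ball x r) y"
        using AE by eventually_elim (use sub in \<open>auto simp: indicator_def\<close>)
    qed
    also have "\<dots> = (\<integral>\<^sup>+ y \<in> ball x r. ennreal \<bar>u y\<bar> \<partial>lborel)"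
      by (rule nn_integral_completion)
    also have "\<dots> = ennreal (V * ball_avg (\<lambda>y. \<bar>u y\<bar>) x r)"
      unfolding V_def by (rule set_nn_integral_ball_eq_avg[OF u r(1)])
    finally have eq: "(\<integral>\<^sup>+ y \<in> ball x r. ennreal \<bar>f y\<bar> \<partial>lebesgue) = ennreal (V * ball_avg (\<lambda>y. \<bar>u y\<bar>) x r)" .
    show ?thesis
      unfolding eq Vl using V ball_avg_nonneg[of "\<lambda>y. \<bar>u y\<bar>" x r]
      by (subst ennreal_mult[symmetric])
         (auto simp: max_weight_def growth_phi_def V\<omega>[symmetric] field_simps intro!: divide_nonneg_nonneg mult_nonneg_nonneg)
  qed
  then show ?thesis
    using \<Omega> unfolding local_frac_maximal_def radius_sup_def \<omega>_def by (intro SUP_cong) auto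
qed

text \<open>The estimate for zero extensions: u and g are tied only by the weak identity against
  test functions of \<Omega>, so g need not be a gradient across the boundary.\<close>

theorem radius_sup_sobolev:
  fixes \<Omega> :: "(real^'n) set" and p q \<beta> \<gamma> s \<omega> :: real
  assumes \<Omega>: "open \<Omega>" "- \<Omega> \<noteq> {}" and fin: "emeasure lborel \<Omega> < \<infinity>"
    and p: "1 < p" and q: "1 / q = 1 / p - (\<beta> - 1) / real CARD('n)" "1 \<le> q"
    and par: "s \<ge> 0" "\<gamma> \<ge> 0" "\<omega> \<ge> 0" "\<beta> \<ge> 1"
  defines "W \<equiv> radius_sup (max_weight CARD('n) \<omega> \<gamma> \<beta> s) \<Omega>"
  shows "\<exists>C>0. \<forall>(u :: real^'n \<Rightarrow> real) (g :: real^'n \<Rightarrow> real^'n).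
    integrable lborel u \<and> integrable lborel g \<and> integrable lborel (\<lambda>x. \<bar>u x\<bar> powr p) \<and> integrable lborel (\<lambda>x. norm (g x) powr p) \<and>
    (\<forall>\<psi> i. test_function \<Omega> \<psi> \<longrightarrow> (\<integral>x. u x * partial_deriv i \<psi> x \<partial>lborel) = - (\<integral>x. g x $ i * \<psi> x \<partial>lborel)) \<longrightarrow>
    (AE x in lborel. W u x < \<infinity>) \<and> integrable lborel (\<lambda>x. enn2real (W u x)) \<and>
    integrable lborel (\<lambda>x. enn2real (W u x) powr q) \<and>
    (\<integral>x. enn2real (W u x) powr q \<partial>lborel) powr (1 / q) \<le> C * (\<integral>x. \<bar>u x\<bar> powr p \<partial>lborel) powr (1 / p) \<and>
    (\<exists>w :: real^'n \<Rightarrow> real^'n. integrable lborel w \<and> (\<forall>x. x \<notin> \<Omega> \<longrightarrow> w x = 0) \<and> integrable lborel (\<lambda>x. norm (w x) powr q) \<and>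
      (\<forall>\<psi> i. test_function \<Omega> \<psi> \<longrightarrow> (\<integral>x. enn2real (W u x) * partial_deriv i \<psi> x \<partial>lborel) = - (\<integral>x. w x $ i * \<psi> x \<partial>lborel)) \<and>
      (\<integral>x. norm (w x) powr q \<partial>lborel) powr (1 / q) \<le>
        C * ((\<integral>x. \<bar>u x\<bar> powr p \<partial>lborel) powr (1 / p) + (\<integral>x. norm (g x) powr p \<partial>lborel) powr (1 / p)))"
proof -
  define n where "n = CARD('n)"
  have n: "n \<ge> 1" by (simp add: n_def Suc_leI)
  have \<Omega>B: "\<Omega> \<in> sets borel" using \<Omega> by simp
  define \<omega>1 where "\<omega>1 = measure lborel (ball (0::real^'n) 1)"
  have \<omega>1: "\<omega>1 > 0" unfolding \<omega>1_def by (rule content_ball_pos) simp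
  \<comment> \<open>A ball of radius r > 1 inside \<Omega> has volume \<omega>1 r^n \<ge> \<omega>1
    r, so r is at most the measure of \<Omega> divided by \<omega>1.\<close>
  define R where "R = max 1 (measure lborel \<Omega> / \<omega>1)"
  have R0: "R \<ge> 0" by (simp add: R_def)
  have R: "r \<le> R" if r: "0 < r" "r < infdist x (- \<Omega>)" for r x
  proof (cases "r \<le> 1")
    case False
    have "ball x r \<subseteq> \<Omega>" using r by (intro ball_infdist_subset) simp
    then have "measure lborel (ball x r) \<le> measure lborel \<Omega>"
      using \<Omega>B fin by (intro measure_mono_fmeasurable) (auto simp: fmeasurable_def)
    moreover have "measure lborel (ball x r) = \<omega>1 * r ^ n"
      using content_ball_conv_unit_ball[of r x] r by (simp add: \<omega>1_def n_def)
    moreover have "\<omega>1 * r \<le> \<omega>1 * r ^ n"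
      using False n \<omega>1 by (intro mult_left_mono self_le_power) auto
    ultimately have "\<omega>1 * r \<le> measure lborel \<Omega>" by simp
    then show ?thesis using \<omega>1 by (simp add: R_def field_simps le_max_iff_disj)
  qed (simp add: R_def)
  obtain Cf where Cf: "Cf > 0" "\<forall>f :: real^'n \<Rightarrow> real.
    (\<forall>x. 0 \<le> f x) \<and> integrable lborel f \<and> integrable lborel (\<lambda>x. f x powr p) \<longrightarrow>
    (\<exists>G. G \<in> borel_measurable borel \<and> (\<forall>x. 0 \<le> G x) \<and>
      (AE x in lborel. \<forall>r>0. r powr (\<beta> - 1) * ball_avg f x r \<le> G x) \<and>
      integrable lborel (\<lambda>x. G x powr q) \<and>
      (\<integral>x. G x powr q \<partial>lborel) powr (1 / q) \<le> Cf * (\<integral>x. f x powr p \<partial>lborel) powr (1 / p))"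
    using fractional_maximal_bound[of p "\<beta> - 1" q, where 'a = "real^'n"] p par q by auto
  define C0 where "C0 = (1 + R ^ n) powr s * R"
  have C0: "C0 \<ge> 0" using R0 by (simp add: C0_def)
  define K2 where "K2 = (2 + (\<beta> + n * s) + R * 2 ^ (n + 1)) * (1 + R ^ n) powr s"
  have K2: "K2 \<ge> 0" unfolding K2_def using par R0 by (intro mult_nonneg_nonneg add_nonneg_nonneg) auto
  \<comment> \<open>The first summand serves the maximal function itself. In the second, 8 n is 2
    from the bound 2 G, n from the l^1 norm of the gradient and 4 from \<open>Lq_norm_add\<close>.
    The last makes C positive.\<close>
  define C where "C = C0 * Cf + 8 * n * K2 * Cf + 1"
  have C: "C > 0" unfolding C_def using C0 K2 Cf by (intro add_nonneg_pos add_nonneg_nonneg) auto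
  have CC: "C0 * Cf \<le> C" "8 * n * K2 * Cf \<le> C" unfolding C_def using C0 K2 Cf by (auto simp: add_increasing)
  show ?thesis
  proof (intro exI[of _ C] conjI[OF C] allI impI, elim conjE)
    fix u :: "real^'n \<Rightarrow> real" and g :: "real^'n \<Rightarrow> real^'n"
    assume u: "integrable lborel u" and g: "integrable lborel g"
      and up: "integrable lborel (\<lambda>x. \<bar>u x\<bar> powr p)" and gp: "integrable lborel (\<lambda>x. norm (g x) powr p)"
      and weak: "\<forall>\<psi> i. test_function \<Omega> \<psi> \<longrightarrow> (\<integral>x. u x * partial_deriv i \<psi> x \<partial>lborel) = - (\<integral>x. g x $ i * \<psi> x \<partial>lborel)"
    define X where "X = (\<integral>x. \<bar>u x\<bar> powr p \<partial>lborel) powr (1 / p)"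
    define Y where "Y = (\<integral>x. norm (g x) powr p \<partial>lborel) powr (1 / p)"
    have XY: "X \<ge> 0" "Y \<ge> 0" by (auto simp: X_def Y_def)
    obtain G1 where G1: "G1 \<in> borel_measurable borel" "\<And>x. 0 \<le> G1 x"
      "AE x in lborel. \<forall>r>0. r powr (\<beta> - 1) * ball_avg (\<lambda>y. \<bar>u y\<bar>) x r \<le> G1 x"
      "integrable lborel (\<lambda>x. G1 x powr q)" "(\<integral>x. G1 x powr q \<partial>lborel) powr (1 / q) \<le> Cf * X"
      using Cf(2)[rule_format, of "\<lambda>y. \<bar>u y\<bar>"] u up unfolding X_def by auto
    obtain G2 where G2: "G2 \<in> borel_measurable borel" "\<And>x. 0 \<le> G2 x"
      "AE x in lborel. \<forall>r>0. r powr (\<beta> - 1) * ball_avg (\<lambda>y. norm (g y)) x r \<le> G2 x"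
      "integrable lborel (\<lambda>x. G2 x powr q)" "(\<integral>x. G2 x powr q \<partial>lborel) powr (1 / q) \<le> Cf * Y"
      using Cf(2)[rule_format, of "\<lambda>y. norm (g y)"] g gp unfolding Y_def by auto
    note G1(1)[measurable] G2(1)[measurable]
    define v where "v x = enn2real (W u x)" for x
    have Wm[measurable]: "W u \<in> borel_measurable borel"
      unfolding W_def by (rule borel_measurable_radius_sup[OF u max_weight_nonneg])
    have vm[measurable]: "v \<in> borel_measurable borel" unfolding v_def by measurable
    have v0: "v x = 0" if "x \<notin> \<Omega>" for x
      using radius_sup_outside[OF that] by (simp add: v_def W_def)
    have vnn: "v x \<ge> 0" for x by (simp add: v_def)
    \<comment> \<open>All radii are quantified inside the almost-everywhere statement, so a single
      null set N serves both maximal bounds.\<close>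
    define Q where "Q x \<longleftrightarrow> (\<forall>r>0. r powr (\<beta> - 1) * ball_avg (\<lambda>y. \<bar>u y\<bar>) x r \<le> G1 x) \<and>
        (\<forall>r>0. r powr (\<beta> - 1) * ball_avg (\<lambda>y. norm (g y)) x r \<le> G2 x)" for x
    have "AE x in lborel. Q x"
      unfolding Q_def using G1(3) G2(3) by (rule AE_conjI)
    then obtain N where good: "\<And>x. x \<in> space lborel - N \<Longrightarrow> Q x" and N: "N \<in> null_sets lborel"
      by (rule AE_E3) blast
    have good1: "r powr (\<beta> - 1) * ball_avg (\<lambda>y. \<bar>u y\<bar>) x r \<le> G1 x"
      and good2: "r powr (\<beta> - 1) * ball_avg (\<lambda>y. norm (g y)) x r \<le> G2 x" if "x \<notin> N" "r > 0" for x r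
      using good[of x] that unfolding Q_def by auto
    have AEN: "AE x in lborel. x \<notin> N" using N by (rule AE_not_in)
    have Wle: "W u x \<le> ennreal (C0 * G1 x)" if "x \<notin> N" for x
      unfolding W_def C0_def n_def by (rule radius_sup_le[OF par(1,2,3) R good1[OF that]])
    have Wfin: "W u x < \<infinity>" if "x \<notin> N" for x
      using Wle[OF that] by (simp add: le_less_trans)
    have Wv: "W u x = ennreal (v x)" if "x \<notin> N" for x
      using Wfin[OF that] by (simp add: v_def)
    have vle: "v x \<le> C0 * G1 x" if "x \<notin> N" for x
      using Wle[OF that] C0 G1(2)[of x] unfolding Wv[OF that] by (subst (asm) ennreal_le_iff) auto
    have haj1: "v x \<le> v x' + dist x x' * (K2 * (G1 x + G2 x))" if x: "x \<notin> N" "x' \<notin> N" for x x'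
    proof -
      have "W u x \<le> W u x' + ennreal (K2 * dist x x' * (G1 x + G2 x))"
        unfolding W_def K2_def n_def
        by (rule radius_sup_diff_le[OF u g weak[rule_format] par(1,2,3,4) n[unfolded n_def] R R0 good1[OF x(1)] good2[OF x(1)]])
      also have "\<dots> = ennreal (v x' + K2 * dist x x' * (G1 x + G2 x))"
        using Wv[OF x(2)] vnn[of x'] K2 G1(2)[of x] G2(2)[of x] by (simp add: ennreal_plus)
      finally have "ennreal (v x) \<le> ennreal (v x' + K2 * dist x x' * (G1 x + G2 x))"
        by (simp only: Wv[OF x(1)])
      then have "v x \<le> v x' + K2 * dist x x' * (G1 x + G2 x)"
        using vnn[of x'] K2 G1(2)[of x] G2(2)[of x] by (subst (asm) ennreal_le_iff) auto
      then show ?thesis by (simp add: mult_ac)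
    qed
    \<comment> \<open>The indicator makes G integrable, as \<Omega> has finite measure, and makes
      the weak derivatives, bounded by 2 G, vanish off \<Omega>.\<close>
    define G where "G x = indicator \<Omega> x * (K2 * (G1 x + G2 x))" for x
    have G0: "G x \<ge> 0" for x using K2 G1(2)[of x] G2(2)[of x] by (simp add: G_def)
    have [measurable]: "\<Omega> \<in> sets borel" by (rule \<Omega>B)
    have Gm[measurable]: "G \<in> borel_measurable borel" unfolding G_def by measurable
    have haj: "\<bar>v x - v x'\<bar> \<le> dist x x' * (G x + G x')" if "x \<in> \<Omega> - N" "x' \<in> \<Omega> - N" for x x'
    proof -
      have "v x - v x' \<le> dist x x' * G x" "v x' - v x \<le> dist x x' * G x'"
        using haj1[of x x'] haj1[of x' x] that by (auto simp: G_def dist_commute)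
      moreover have "0 \<le> dist x x' * G x" "0 \<le> dist x x' * G x'" using G0 by auto
      ultimately show ?thesis unfolding distrib_left abs_le_iff by argo
    qed
    have H: "integrable lborel (\<lambda>x. (G1 x + G2 x) powr q)"
      "(\<integral>x. (G1 x + G2 x) powr q \<partial>lborel) powr (1 / q) \<le> 4 * (Cf * X + Cf * Y)"
    proof -
      note add = Lq_norm_add[OF G1(1,4,2) G2(1,4,2) q(2)]
      show "integrable lborel (\<lambda>x. (G1 x + G2 x) powr q)" by (rule add(1))
      show "(\<integral>x. (G1 x + G2 x) powr q \<partial>lborel) powr (1 / q) \<le> 4 * (Cf * X + Cf * Y)"
        using add(2) G1(5) G2(5) by argo
    qed
    have q0: "q > 0" using q(2) by simp
    have vAE: "AE x in lborel. norm (v x) \<le> C0 * G1 x"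
      using AEN by eventually_elim (use vle vnn in auto)
    note vq = Lq_norm_mono[OF vm G1(4,2) vAE C0 q0]
    have vi: "integrable lborel v"
      by (rule integrable_of_powr[OF \<Omega>B fin vm v0 q(2) vq(1)])
    have Gi: "integrable lborel G"
    proof (rule integrable_of_powr[OF \<Omega>B fin Gm _ q(2)])
      have "AE x in lborel. norm (G x) \<le> K2 * (G1 x + G2 x)"
        using K2 G1(2) G2(2) by (intro AE_I2) (auto simp: G_def indicator_def)
      then show "integrable lborel (\<lambda>x. norm (G x) powr q)"
        using G1(2) G2(2) by (intro Lq_norm_mono(1)[OF Gm H(1) _ _ K2 q0]) auto
    qed (simp add: G_def)
    have "\<forall>i. \<exists>w. w \<in> borel_measurable borel \<and> (\<forall>x. \<bar>w x\<bar> \<le> 2 * G x) \<and>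
      (\<forall>\<psi>. test_function \<Omega> \<psi> \<longrightarrow> (\<integral>x. v x * partial_deriv i \<psi> x \<partial>lborel) = - (\<integral>x. w x * \<psi> x \<partial>lborel))"
      using hajlasz_weak_partial_deriv[OF \<Omega>(1) vi Gi G0 N haj] by blast
    then obtain wi where wi: "\<And>i. wi i \<in> borel_measurable borel" "\<And>i x. \<bar>wi i x\<bar> \<le> 2 * G x"
      "\<And>i \<psi>. test_function \<Omega> \<psi> \<Longrightarrow> (\<integral>x. v x * partial_deriv i \<psi> x \<partial>lborel) = - (\<integral>x. wi i x * \<psi> x \<partial>lborel)"
      by metis
    define w where "w x = (\<chi> i. wi i x)" for x
    have wm: "w \<in> borel_measurable borel"
    proof (subst borel_measurable_euclidean_space, intro ballI)
      fix b :: "real^'n" assume "b \<in> Basis"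
      then obtain i where "b = axis i 1" by (auto simp: Basis_vec_def)
      then show "(\<lambda>x. w x \<bullet> b) \<in> borel_measurable borel"
        using wi(1)[of i] by (simp add: w_def inner_axis)
    qed
    have w0: "w x = 0" if "x \<notin> \<Omega>" for x
      using wi(2)[of _ x] that by (simp add: w_def G_def vec_eq_iff)
    have wle: "norm (w x) \<le> (2 * n * K2) * (G1 x + G2 x)" for x
    proof -
      have "norm (w x) \<le> (\<Sum>i\<in>UNIV. \<bar>w x $ i\<bar>)" by (rule norm_le_l1_cart)
      also have "\<dots> \<le> (\<Sum>i\<in>(UNIV::'n set). 2 * (K2 * (G1 x + G2 x)))"
      proof (rule sum_mono)
        fix i
        have "G x \<le> K2 * (G1 x + G2 x)" using K2 G1(2)[of x] G2(2)[of x] by (simp add: G_def indicator_def)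
        then show "\<bar>w x $ i\<bar> \<le> 2 * (K2 * (G1 x + G2 x))" using wi(2)[of i x] by (simp add: w_def)
      qed
      also have "\<dots> = (2 * n * K2) * (G1 x + G2 x)" by (simp add: n_def)
      finally show ?thesis .
    qed
    have nK: "0 \<le> 2 * n * K2" using K2 by simp
    have wAE: "AE x in lborel. norm (w x) \<le> (2 * n * K2) * (G1 x + G2 x)" using wle by (rule AE_I2)
    have wq: "integrable lborel (\<lambda>x. norm (w x) powr q)"
      "(\<integral>x. norm (w x) powr q \<partial>lborel) powr (1 / q) \<le> (2 * n * K2) * (\<integral>x. (G1 x + G2 x) powr q \<partial>lborel) powr (1 / q)"
      using Lq_norm_mono[OF wm H(1) _ wAE nK q0] G1(2) G2(2) by auto
    have wint: "integrable lborel w"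
      by (rule integrable_of_powr[OF \<Omega>B fin wm w0 q(2) wq(1)])
    have vnorm: "(\<integral>x. v x powr q \<partial>lborel) powr (1 / q) \<le> C * X"
    proof -
      have "(\<integral>x. v x powr q \<partial>lborel) powr (1 / q) \<le> C0 * (\<integral>x. G1 x powr q \<partial>lborel) powr (1 / q)"
        using vq(2) vnn by simp
      also have "\<dots> \<le> C0 * (Cf * X)" by (intro mult_left_mono G1(5) C0)
      also have "\<dots> = (C0 * Cf) * X" by simp
      also have "\<dots> \<le> C * X" by (intro mult_right_mono CC XY)
      finally show ?thesis .
    qed
    have wnorm: "(\<integral>x. norm (w x) powr q \<partial>lborel) powr (1 / q) \<le> C * (X + Y)"
    proof -
      note wq(2)
      also have "(2 * n * K2) * (\<integral>x. (G1 x + G2 x) powr q \<partial>lborel) powr (1 / q) \<le> (2 * n * K2) * (4 * (Cf * X + Cf * Y))"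
        by (intro mult_left_mono H(2) nK)
      also have "\<dots> = (8 * n * K2 * Cf) * (X + Y)" by (simp add: algebra_simps)
      also have "\<dots> \<le> C * (X + Y)" using XY by (intro mult_right_mono CC) auto
      finally show ?thesis .
    qed
    have vq1: "integrable lborel (\<lambda>x. v x powr q)" using vq(1) vnn by simp
    have Wfin': "AE x in lborel. W u x < \<infinity>" using AEN by eventually_elim (rule Wfin)
    have wweak: "\<forall>\<psi> i. test_function \<Omega> \<psi> \<longrightarrow> (\<integral>x. v x * partial_deriv i \<psi> x \<partial>lborel) = - (\<integral>x. w x $ i * \<psi> x \<partial>lborel)"
      using wi(3) by (simp add: w_def)
    show "(AE x in lborel. W u x < \<infinity>) \<and> integrable lborel (\<lambda>x. enn2real (W u x)) \<and>
    integrable lborel (\<lambda>x. enn2real (W u x) powr q) \<and>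
    (\<integral>x. enn2real (W u x) powr q \<partial>lborel) powr (1 / q) \<le> C * (\<integral>x. \<bar>u x\<bar> powr p \<partial>lborel) powr (1 / p) \<and>
    (\<exists>w :: real^'n \<Rightarrow> real^'n. integrable lborel w \<and> (\<forall>x. x \<notin> \<Omega> \<longrightarrow> w x = 0) \<and> integrable lborel (\<lambda>x. norm (w x) powr q) \<and>
      (\<forall>\<psi> i. test_function \<Omega> \<psi> \<longrightarrow> (\<integral>x. enn2real (W u x) * partial_deriv i \<psi> x \<partial>lborel) = - (\<integral>x. w x $ i * \<psi> x \<partial>lborel)) \<and>
      (\<integral>x. norm (w x) powr q \<partial>lborel) powr (1 / q) \<le>
        C * ((\<integral>x. \<bar>u x\<bar> powr p \<partial>lborel) powr (1 / p) + (\<integral>x. norm (g x) powr p \<partial>lborel) powr (1 / p)))"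
      unfolding v_def[symmetric] X_def[symmetric] Y_def[symmetric]
      using Wfin' vi vq1 vnorm wint w0 wq(1) wweak wnorm by blast
  qed
qed

section \<open>Transfer to Lebesgue measure on the domain and conclusion\<close>

lemma borel_representative_vec:
  fixes g :: "real^'n \<Rightarrow> real^'m"
  assumes \<Omega>: "\<Omega> \<in> sets borel" and g: "g \<in> borel_measurable (lebesgue_on \<Omega>)"
  obtains h where "h \<in> borel_measurable borel" "\<And>x. x \<notin> \<Omega> \<Longrightarrow> h x = 0" "AE x in lborel. x \<in> \<Omega> \<longrightarrow> g x = h x"
proof -
  have ex: "\<forall>i. \<exists>u. u \<in> borel_measurable borel \<and> (\<forall>x. x \<notin> \<Omega> \<longrightarrow> u x = 0) \<and> (AE x in lborel. x \<in> \<Omega> \<longrightarrow> g x $ i = u x)"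
  proof
    fix i
    have "(\<lambda>x. g x $ i) \<in> borel_measurable (lebesgue_on \<Omega>)"
      by (rule measurable_compose[OF g borel_measurable_continuous_onI]) (intro continuous_intros)
    then obtain u where "u \<in> borel_measurable borel" "\<And>x. x \<notin> \<Omega> \<Longrightarrow> u x = 0"
      "AE x in lborel. x \<in> \<Omega> \<longrightarrow> g x $ i = u x"
      by (rule borel_representative[OF \<Omega>]) blast
    then show "\<exists>u. u \<in> borel_measurable borel \<and> (\<forall>x. x \<notin> \<Omega> \<longrightarrow> u x = 0) \<and> (AE x in lborel. x \<in> \<Omega> \<longrightarrow> g x $ i = u x)"
      by blast
  qed
  obtain u where u: "\<forall>i. u i \<in> borel_measurable borel \<and> (\<forall>x. x \<notin> \<Omega> \<longrightarrow> u i x = 0) \<and> (AE x in lborel. x \<in> \<Omega> \<longrightarrow> g x $ i = u i x)"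
    using choice[OF ex] by blast
  have u1: "u i \<in> borel_measurable borel" and u2: "x \<notin> \<Omega> \<Longrightarrow> u i x = 0"
    and u3: "AE x in lborel. x \<in> \<Omega> \<longrightarrow> g x $ i = u i x" for i x
    using u by blast+
  show ?thesis
  proof (rule that[of "\<lambda>x. \<chi> i. u i x"])
    show "(\<lambda>x. \<chi> i. u i x) \<in> borel_measurable borel"
    proof (subst borel_measurable_euclidean_space, intro ballI)
      fix b :: "real^'m" assume "b \<in> Basis"
      then obtain i where "b = axis i 1" by (auto simp: Basis_vec_def)
      then show "(\<lambda>x. (\<chi> i. u i x) \<bullet> b) \<in> borel_measurable borel"
        using u1[of i] by (simp add: inner_axis)
    qed
    have "AE x in lborel. \<forall>i. x \<in> \<Omega> \<longrightarrow> g x $ i = u i x"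
      using u3 by (rule eventually_all_finite)
    then show "AE x in lborel. x \<in> \<Omega> \<longrightarrow> g x = (\<chi> i. u i x)"
      by eventually_elim (auto simp: vec_eq_iff)
  qed (simp add: u2 vec_eq_iff)
qed

lemma lebesgue_on_powr_transfer:
  fixes f h :: "real^'n \<Rightarrow> 'b::euclidean_space"
  assumes \<Omega>: "\<Omega> \<in> sets borel" and f: "f \<in> borel_measurable (lebesgue_on \<Omega>)" and h: "h \<in> borel_measurable borel"
    and 0: "\<And>x. x \<notin> \<Omega> \<Longrightarrow> h x = 0" and AE: "AE x in lborel. x \<in> \<Omega> \<longrightarrow> f x = h x"
  shows "in_Lp p \<Omega> f \<longleftrightarrow> integrable lborel (\<lambda>x. norm (h x) powr p)"
    and "Lp_norm p \<Omega> f = (\<integral>x. norm (h x) powr p \<partial>lborel) powr (1 / p)"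
proof -
  have fm: "(\<lambda>x. norm (f x) powr p) \<in> borel_measurable (lebesgue_on \<Omega>)" using f by measurable
  have hm: "(\<lambda>x. norm (h x) powr p) \<in> borel_measurable borel" using h by measurable
  have z: "norm (h x) powr p = 0" if "x \<notin> \<Omega>" for x using 0[OF that] by simp
  have AE': "AE x in lborel. x \<in> \<Omega> \<longrightarrow> norm (f x) powr p = norm (h x) powr p"
    using AE by eventually_elim simp
  note tr = lebesgue_on_transfer[OF \<Omega> fm hm z AE']
  show "in_Lp p \<Omega> f \<longleftrightarrow> integrable lborel (\<lambda>x. norm (h x) powr p)"
    using tr(1) f by (simp add: in_Lp_def)
  show "Lp_norm p \<Omega> f = (\<integral>x. norm (h x) powr p \<partial>lborel) powr (1 / p)"
    using tr(2) by (simp add: Lp_norm_def)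
qed

lemma in_Lp_cong_AE:
  fixes f h :: "real^'n \<Rightarrow> 'b::euclidean_space"
  assumes \<Omega>: "\<Omega> \<in> sets borel" and m: "f \<in> borel_measurable (lebesgue_on \<Omega>)" "h \<in> borel_measurable (lebesgue_on \<Omega>)"
    and AE: "AE x in lborel. x \<in> \<Omega> \<longrightarrow> f x = h x"
  shows "in_Lp p \<Omega> f \<longleftrightarrow> in_Lp p \<Omega> h" and "Lp_norm p \<Omega> f = Lp_norm p \<Omega> h"
proof -
  have "AE x in lebesgue. x \<in> \<Omega> \<longrightarrow> f x = h x" using AE by (rule AE_completion)
  then have "AE x in lebesgue_on \<Omega>. f x = h x"
    using \<Omega> by (subst AE_restrict_space_iff) auto
  then have AE': "AE x in lebesgue_on \<Omega>. norm (f x) powr p = norm (h x) powr p"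
    by eventually_elim simp
  have pm: "(\<lambda>x. norm (f x) powr p) \<in> borel_measurable (lebesgue_on \<Omega>)"
    "(\<lambda>x. norm (h x) powr p) \<in> borel_measurable (lebesgue_on \<Omega>)" using m by measurable
  show "in_Lp p \<Omega> f \<longleftrightarrow> in_Lp p \<Omega> h"
    using integrable_cong_AE[OF pm AE'] m by (simp add: in_Lp_def)
  show "Lp_norm p \<Omega> f = Lp_norm p \<Omega> h"
    using integral_cong_AE[OF pm AE'] by (simp add: Lp_norm_def)
qed

text \<open>This holds because an open set is a countable union of compact sets.\<close>

lemma locally_integrable_measurable:
  fixes f :: "real^'n \<Rightarrow> 'b::euclidean_space"
  assumes \<Omega>: "open \<Omega>" and li: "locally_integrable \<Omega> f"
  shows "f \<in> borel_measurable (lebesgue_on \<Omega>)"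
proof -
  obtain K where K: "\<And>n. compact (K n)" "\<And>n. K n \<subseteq> \<Omega>" "\<Union>(range (K :: nat \<Rightarrow> (real^'n) set)) = \<Omega>"
    using open_Union_compact_subsets[OF \<Omega>] by metis
  have KB: "K n \<in> sets lebesgue" for n using K(1) by (simp add: borel_compact)
  show ?thesis
  proof (rule measurable_piecewise_restrict[of "range K"])
    show "countable (range K)" by simp
    show "A \<inter> space (lebesgue_on \<Omega>) \<in> sets (lebesgue_on \<Omega>)" if "A \<in> range K" for A
      using that K(2) KB \<Omega> by (auto simp: sets_restrict_space_iff Int_absorb2)
    show "space (lebesgue_on \<Omega>) \<subseteq> \<Union>(range K)" using K(3) by simp
    fix A assume "A \<in> range K"
    then obtain n where n: "A = K n" by blast
    have "integrable (lebesgue_on (K n)) f" using li K by (simp add: locally_integrable_def)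
    moreover have "restrict_space (lebesgue_on \<Omega>) (K n) = lebesgue_on (K n)"
      using KB K(2) \<Omega> by (subst restrict_restrict_space) (auto simp: Int_absorb1)
    ultimately show "f \<in> borel_measurable (restrict_space (lebesgue_on \<Omega>) A)" by (simp add: n)
  qed
qed

lemma integrable_imp_locally_integrable:
  fixes f :: "real^'n \<Rightarrow> 'b::euclidean_space"
  assumes "integrable lborel f"
  shows "locally_integrable \<Omega> f"
  unfolding locally_integrable_def
proof (intro allI impI)
  fix K assume K: "compact K \<and> K \<subseteq> \<Omega>"
  have "integrable lebesgue f" using assms by (subst integrable_completion) auto
  then have "integrable lebesgue (\<lambda>x. indicator K x *\<^sub>R f x)"
    using K by (intro integrable_mult_indicator) (auto simp: borel_compact)
  then show "integrable (lebesgue_on K) f"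
    using K by (subst integrable_restrict_space) (auto simp: borel_compact)
qed

lemma has_weak_gradient_iff_lborel:
  fixes f u :: "real^'n \<Rightarrow> real" and g h :: "real^'n \<Rightarrow> real^'n"
  assumes \<Omega>: "open \<Omega>"
    and f: "f \<in> borel_measurable (lebesgue_on \<Omega>)" and g: "g \<in> borel_measurable (lebesgue_on \<Omega>)"
    and u: "u \<in> borel_measurable borel" "\<And>x. x \<notin> \<Omega> \<Longrightarrow> u x = 0" "AE x in lborel. x \<in> \<Omega> \<longrightarrow> f x = u x"
    and h: "h \<in> borel_measurable borel" "\<And>x. x \<notin> \<Omega> \<Longrightarrow> h x = 0" "AE x in lborel. x \<in> \<Omega> \<longrightarrow> g x = h x"
  shows "has_weak_gradient \<Omega> f g \<longleftrightarrow> locally_integrable \<Omega> f \<and> locally_integrable \<Omega> g \<and>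
    (\<forall>\<psi> i. test_function \<Omega> \<psi> \<longrightarrow> (\<integral>x. u x * partial_deriv i \<psi> x \<partial>lborel) = - (\<integral>x. h x $ i * \<psi> x \<partial>lborel))"
proof -
  have \<Omega>B: "\<Omega> \<in> sets borel" using \<Omega> by simp
  have cont: "\<phi> \<in> borel_measurable (lebesgue_on \<Omega>)" "\<phi> \<in> borel_measurable borel"
    if "continuous_on UNIV \<phi>" for \<phi> :: "real^'n \<Rightarrow> real"
  proof -
    show b: "\<phi> \<in> borel_measurable borel" using that by (rule borel_measurable_continuous_onI)
    then have "\<phi> \<in> borel_measurable lebesgue" by (simp add: measurable_completion)
    then show "\<phi> \<in> borel_measurable (lebesgue_on \<Omega>)" by (rule measurable_restrict_space1)
  qed
  have gi: "(\<lambda>x. g x $ i) \<in> borel_measurable (lebesgue_on \<Omega>)" "(\<lambda>x. h x $ i) \<in> borel_measurable borel" for i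
    by (rule measurable_compose[OF g borel_measurable_continuous_onI] measurable_compose[OF h(1) borel_measurable_continuous_onI], intro continuous_intros)+
  have "(\<integral>x. f x * partial_deriv i \<psi> x \<partial>lebesgue_on \<Omega>) = (\<integral>x. u x * partial_deriv i \<psi> x \<partial>lborel)"
    "(\<integral>x. g x $ i * \<psi> x \<partial>lebesgue_on \<Omega>) = (\<integral>x. h x $ i * \<psi> x \<partial>lborel)" if \<psi>: "test_function \<Omega> \<psi>" for \<psi> i
  proof -
    obtain B R where B: "continuous_on UNIV \<psi>" "\<And>i. continuous_on UNIV (partial_deriv i \<psi>)"
      by (rule test_function_facts[OF \<psi>]) blast
    show "(\<integral>x. f x * partial_deriv i \<psi> x \<partial>lebesgue_on \<Omega>) = (\<integral>x. u x * partial_deriv i \<psi> x \<partial>lborel)"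
    proof (rule lebesgue_on_transfer(2)[OF \<Omega>B])
      show "AE x in lborel. x \<in> \<Omega> \<longrightarrow> f x * partial_deriv i \<psi> x = u x * partial_deriv i \<psi> x"
        using u(3) by eventually_elim simp
    qed (use f u cont[OF B(2)] in auto)
    show "(\<integral>x. g x $ i * \<psi> x \<partial>lebesgue_on \<Omega>) = (\<integral>x. h x $ i * \<psi> x \<partial>lborel)"
    proof (rule lebesgue_on_transfer(2)[OF \<Omega>B])
      show "AE x in lborel. x \<in> \<Omega> \<longrightarrow> g x $ i * \<psi> x = h x $ i * \<psi> x"
        using h(3) by eventually_elim simp
    qed (use gi h cont[OF B(1)] in auto)
  qed
  then show ?thesis unfolding has_weak_gradient_def by simp
qed

lemma has_weak_gradient_weak_gradient:
  "has_weak_gradient \<Omega> f g \<Longrightarrow> has_weak_gradient \<Omega> f (weak_gradient \<Omega> f)"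
  unfolding weak_gradient_def by (rule someI[of "has_weak_gradient \<Omega> f"])

theorem theorem1p7:
  fixes \<Omega> :: "(real^'n) set" and p q \<beta> \<gamma> :: real
  assumes "domain_Rn \<Omega>"
    and "emeasure lebesgue \<Omega> < \<infinity>"
    and "1 < p" and "p < real CARD('n)"
    and "1 \<le> \<beta>" and "\<beta> < real CARD('n) / p"
    and "1 / q = 1 / p - (\<beta> - 1) / real CARD('n)"
    and "0 \<le> \<gamma>" and "\<gamma> \<le> real CARD('n)"
  shows "\<exists>C>0. \<forall>f. in_W1p p \<Omega> f \<longrightarrow>
    (AE x in lebesgue_on \<Omega>. local_frac_maximal \<gamma> \<beta> \<Omega> f x < \<infinity>) \<and>
    in_W1p q \<Omega> (\<lambda>x. enn2real (local_frac_maximal \<gamma> \<beta> \<Omega> f x)) \<and>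
    W1p_norm q \<Omega> (\<lambda>x. enn2real (local_frac_maximal \<gamma> \<beta> \<Omega> f x)) \<le> C * W1p_norm p \<Omega> f"
proof -
  have \<Omega>: "open \<Omega>" using assms(1) by (simp add: domain_Rn_def)
  have \<Omega>B: "\<Omega> \<in> sets borel" using \<Omega> by simp
  have fin: "emeasure lborel \<Omega> < \<infinity>" using assms(2) \<Omega>B by simp
  \<comment> \<open>Finite measure excludes the whole space, so \<open>infdist\<close> to the
    complement is the true distance and the first alternative in \<open>local_frac_maximal\<close>
    never occurs.\<close>
  have ne: "- \<Omega> \<noteq> {}"
  proof
    assume "- \<Omega> = {}"
    then have "\<Omega> = UNIV" by blast
    then show False using fin by simp
  qed
  define n where "n = real CARD('n)"
  have n: "n > 0" by (simp add: n_def)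
  define \<omega> where "\<omega> = measure lborel (ball (0::real^'n) 1)"
  define s where "s = \<gamma> * \<beta> / real CARD('n)"
  \<comment> \<open>The chain (\<beta> - 1) / n < \<beta> / n < 1 / p shows that q is positive, and
    \<beta> \<ge> 1 gives q \<ge> p.\<close>
  have q1: "1 \<le> q"
  proof -
    have "\<beta> / n < 1 / p" using assms(3,6) n by (simp add: field_simps n_def)
    moreover have "(\<beta> - 1) / n < \<beta> / n" using n by (intro divide_strict_right_mono) auto
    ultimately have "0 < 1 / q" using assms(7) by (simp add: n_def)
    then have "q > 0" by simp
    have "0 \<le> (\<beta> - 1) / n" using n assms(5) by simp
    then have "1 / q \<le> 1 / p" using assms(7) by (simp add: n_def)
    also have "\<dots> \<le> 1" using assms(3) by simp
    finally show ?thesis using \<open>q > 0\<close> by (simp add: field_simps)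
  qed
  define W where "W = radius_sup (max_weight CARD('n) \<omega> \<gamma> \<beta> s) \<Omega>"
  have par: "s \<ge> 0" "\<gamma> \<ge> 0" "\<omega> \<ge> 0" "\<beta> \<ge> 1"
    using assms by (auto simp: s_def \<omega>_def)
  obtain C where C: "C > 0" "\<forall>(u :: real^'n \<Rightarrow> real) (g :: real^'n \<Rightarrow> real^'n).
    integrable lborel u \<and> integrable lborel g \<and> integrable lborel (\<lambda>x. \<bar>u x\<bar> powr p) \<and> integrable lborel (\<lambda>x. norm (g x) powr p) \<and>
    (\<forall>\<psi> i. test_function \<Omega> \<psi> \<longrightarrow> (\<integral>x. u x * partial_deriv i \<psi> x \<partial>lborel) = - (\<integral>x. g x $ i * \<psi> x \<partial>lborel)) \<longrightarrow>
    (AE x in lborel. W u x < \<infinity>) \<and> integrable lborel (\<lambda>x. enn2real (W u x)) \<and>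
    integrable lborel (\<lambda>x. enn2real (W u x) powr q) \<and>
    (\<integral>x. enn2real (W u x) powr q \<partial>lborel) powr (1 / q) \<le> C * (\<integral>x. \<bar>u x\<bar> powr p \<partial>lborel) powr (1 / p) \<and>
    (\<exists>w :: real^'n \<Rightarrow> real^'n. integrable lborel w \<and> (\<forall>x. x \<notin> \<Omega> \<longrightarrow> w x = 0) \<and> integrable lborel (\<lambda>x. norm (w x) powr q) \<and>
      (\<forall>\<psi> i. test_function \<Omega> \<psi> \<longrightarrow> (\<integral>x. enn2real (W u x) * partial_deriv i \<psi> x \<partial>lborel) = - (\<integral>x. w x $ i * \<psi> x \<partial>lborel)) \<and>
      (\<integral>x. norm (w x) powr q \<partial>lborel) powr (1 / q) \<le>
        C * ((\<integral>x. \<bar>u x\<bar> powr p \<partial>lborel) powr (1 / p) + (\<integral>x. norm (g x) powr p \<partial>lborel) powr (1 / p)))"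
    using radius_sup_sobolev[OF \<Omega> ne fin assms(3,7) q1 par, folded W_def] by (elim exE conjE) (rule that)
  show ?thesis
  \<comment> \<open>The function contributes C times the norm of f, its gradient C times the norms
    of f and of the gradient of f; hence 2 C.\<close>
  proof (intro exI[of _ "2 * C"] conjI allI impI)
    show "2 * C > 0" using C(1) by simp
    fix f assume f: "in_W1p p \<Omega> f"
    then obtain g0 where fp: "in_Lp p \<Omega> f" and g0: "has_weak_gradient \<Omega> f g0" "in_Lp p \<Omega> g0"
      by (auto simp: in_W1p_def)
    \<comment> \<open>\<open>in_W1p\<close> provides some gradient g0 in L^p, whereas the norm is
      formed with the chosen \<open>weak_gradient\<close>; uniqueness almost everywhere carries
      integrability over.\<close>
    define g where "g = weak_gradient \<Omega> f"
    have g: "has_weak_gradient \<Omega> f g"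
      unfolding g_def using g0(1) by (rule has_weak_gradient_weak_gradient)
    have fm: "f \<in> borel_measurable (lebesgue_on \<Omega>)" using fp by (simp add: in_Lp_def)
    have gm: "g \<in> borel_measurable (lebesgue_on \<Omega>)" "g0 \<in> borel_measurable (lebesgue_on \<Omega>)"
      using g g0(1) by (auto simp: has_weak_gradient_def intro: locally_integrable_measurable[OF \<Omega>])
    have gp: "in_Lp p \<Omega> g"
      using in_Lp_cong_AE(1)[OF \<Omega>B gm has_weak_gradient_unique[OF \<Omega> g g0(1)]] g0(2) by simp
    obtain u where u: "u \<in> borel_measurable borel" "\<And>x. x \<notin> \<Omega> \<Longrightarrow> u x = 0" "AE x in lborel. x \<in> \<Omega> \<longrightarrow> f x = u x"
      by (rule borel_representative[OF \<Omega>B fm]) blast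
    obtain h where h: "h \<in> borel_measurable borel" "\<And>x. x \<notin> \<Omega> \<Longrightarrow> h x = 0" "AE x in lborel. x \<in> \<Omega> \<longrightarrow> g x = h x"
      by (rule borel_representative_vec[OF \<Omega>B gm(1)]) blast
    have fu: "in_Lp p \<Omega> f \<longleftrightarrow> integrable lborel (\<lambda>x. norm (u x) powr p)"
      "Lp_norm p \<Omega> f = (\<integral>x. norm (u x) powr p \<partial>lborel) powr (1 / p)"
      by (rule lebesgue_on_powr_transfer[OF \<Omega>B fm u(1) _ u(3)], rule u(2), assumption)+
    have gh: "in_Lp p \<Omega> g \<longleftrightarrow> integrable lborel (\<lambda>x. norm (h x) powr p)"
      "Lp_norm p \<Omega> g = (\<integral>x. norm (h x) powr p \<partial>lborel) powr (1 / p)"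
      by (rule lebesgue_on_powr_transfer[OF \<Omega>B gm(1) h(1) _ h(3)], rule h(2), assumption)+
    have up: "integrable lborel (\<lambda>x. norm (u x) powr p)" using fu(1) fp by simp
    have hp: "integrable lborel (\<lambda>x. norm (h x) powr p)" using gh(1) gp by simp
    have p1: "1 \<le> p" using assms(3) by simp
    have ui: "integrable lborel u" by (rule integrable_of_powr[OF \<Omega>B fin u(1,2) p1 up])
    have hi: "integrable lborel h" by (rule integrable_of_powr[OF \<Omega>B fin h(1,2) p1 hp])
    have weak: "\<forall>\<psi> i. test_function \<Omega> \<psi> \<longrightarrow> (\<integral>x. u x * partial_deriv i \<psi> x \<partial>lborel) = - (\<integral>x. h x $ i * \<psi> x \<partial>lborel)"
      using g has_weak_gradient_iff_lborel[OF \<Omega> fm gm(1) u h] by blast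
    have Meq: "local_frac_maximal \<gamma> \<beta> \<Omega> f = W u"
      by (rule ext) (simp add: W_def \<omega>_def s_def local_frac_maximal_eq_radius_sup[OF ne ui u(3)])
    define v where "v x = enn2real (W u x)" for x
    have up': "integrable lborel (\<lambda>x. \<bar>u x\<bar> powr p)" using up by (simp only: real_norm_def)
    have Lf: "(\<integral>x. \<bar>u x\<bar> powr p \<partial>lborel) powr (1 / p) = Lp_norm p \<Omega> f"
      using fu(2) by (simp only: real_norm_def)
    note bound = mp[OF spec[OF spec[OF C(2)]] conjI[OF ui conjI[OF hi conjI[OF up' conjI[OF hp weak]]]],
        folded v_def, unfolded Lf gh(2)[symmetric]]
    note res = bound[THEN conjunct1] bound[THEN conjunct2, THEN conjunct1]
      bound[THEN conjunct2, THEN conjunct2, THEN conjunct1]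
      bound[THEN conjunct2, THEN conjunct2, THEN conjunct2, THEN conjunct1]
    obtain w :: "real^'n \<Rightarrow> real^'n" where w: "integrable lborel w" "\<And>x. x \<notin> \<Omega> \<Longrightarrow> w x = 0" "integrable lborel (\<lambda>x. norm (w x) powr q)"
      "\<forall>\<psi> i. test_function \<Omega> \<psi> \<longrightarrow> (\<integral>x. v x * partial_deriv i \<psi> x \<partial>lborel) = - (\<integral>x. w x $ i * \<psi> x \<partial>lborel)"
      "(\<integral>x. norm (w x) powr q \<partial>lborel) powr (1 / q) \<le> C * (Lp_norm p \<Omega> f + Lp_norm p \<Omega> g)"
      using bound[THEN conjunct2, THEN conjunct2, THEN conjunct2, THEN conjunct2] by (elim exE conjE) (rule that, auto)
    have vB: "v \<in> borel_measurable borel" and wB: "w \<in> borel_measurable borel" using res(2) w(1) by auto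
    have v0: "v x = 0" if "x \<notin> \<Omega>" for x
      using radius_sup_outside[OF that] by (simp add: v_def W_def)
    have to_leb: "\<phi> \<in> borel_measurable (lebesgue_on \<Omega>)" if "\<phi> \<in> borel_measurable borel" for \<phi> :: "real^'n \<Rightarrow> 'c::euclidean_space"
    proof -
      have "\<phi> \<in> borel_measurable lebesgue" using that by (simp add: measurable_completion)
      then show ?thesis by (rule measurable_restrict_space1)
    qed
    have vt: "in_Lp q \<Omega> v \<longleftrightarrow> integrable lborel (\<lambda>x. norm (v x) powr q)"
      "Lp_norm q \<Omega> v = (\<integral>x. norm (v x) powr q \<partial>lborel) powr (1 / q)"
      by (rule lebesgue_on_powr_transfer[OF \<Omega>B to_leb[OF vB] vB]; simp add: v0)+
    have wt: "in_Lp q \<Omega> w \<longleftrightarrow> integrable lborel (\<lambda>x. norm (w x) powr q)"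
      "Lp_norm q \<Omega> w = (\<integral>x. norm (w x) powr q \<partial>lborel) powr (1 / q)"
      by (rule lebesgue_on_powr_transfer[OF \<Omega>B to_leb[OF wB] wB]; simp add: w(2))+
    have hw: "has_weak_gradient \<Omega> v w"
      using has_weak_gradient_iff_lborel[OF \<Omega> to_leb[OF vB] to_leb[OF wB] vB v0 _ wB w(2)] w(4)
        integrable_imp_locally_integrable[OF res(2)] integrable_imp_locally_integrable[OF w(1)] by simp
    have vnn: "\<bar>v x\<bar> = v x" for x by (simp add: v_def)
    have vLp: "in_Lp q \<Omega> v" using vt(1) res(3) by (simp add: vnn)
    have wLp: "in_Lp q \<Omega> w" using wt(1) w(3) by simp
    \<comment> \<open>The gradient in the norm of v is again a choice; by uniqueness its norm is
      that of w, for which the bound is known.\<close>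
    define w' where "w' = weak_gradient \<Omega> v"
    have hw': "has_weak_gradient \<Omega> v w'"
      unfolding w'_def using hw by (rule has_weak_gradient_weak_gradient)
    have w'm: "w' \<in> borel_measurable (lebesgue_on \<Omega>)"
      using hw' by (auto simp: has_weak_gradient_def intro: locally_integrable_measurable[OF \<Omega>])
    have w'w: "Lp_norm q \<Omega> w' = Lp_norm q \<Omega> w"
      by (rule in_Lp_cong_AE(2)[OF \<Omega>B w'm to_leb[OF wB] has_weak_gradient_unique[OF \<Omega> hw' hw]])
    have "AE x in lebesgue. x \<in> \<Omega> \<longrightarrow> W u x < \<infinity>"
      by (rule AE_completion) (use res(1) in eventually_elim, simp)
    then show "AE x in lebesgue_on \<Omega>. local_frac_maximal \<gamma> \<beta> \<Omega> f x < \<infinity>"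
      unfolding Meq using \<Omega>B by (subst AE_restrict_space_iff) auto
    show "in_W1p q \<Omega> (\<lambda>x. enn2real (local_frac_maximal \<gamma> \<beta> \<Omega> f x))"
      unfolding Meq v_def[symmetric] in_W1p_def using vLp wLp hw by blast
    have "W1p_norm q \<Omega> v \<le> C * Lp_norm p \<Omega> f + C * (Lp_norm p \<Omega> f + Lp_norm p \<Omega> g)"
      unfolding W1p_norm_def w'_def[symmetric] w'w
      using res(4) w(5) vt(2) wt(2) by (intro add_mono) (simp_all add: vnn)
    also have "\<dots> \<le> 2 * C * W1p_norm p \<Omega> f"
    proof -
      have "0 \<le> C * Lp_norm p \<Omega> g" using C(1) by (simp add: Lp_norm_def)
      then show ?thesis by (simp add: W1p_norm_def g_def[symmetric] algebra_simps)
    qed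
    finally show "W1p_norm q \<Omega> (\<lambda>x. enn2real (local_frac_maximal \<gamma> \<beta> \<Omega> f x)) \<le> 2 * C * W1p_norm p \<Omega> f"
      unfolding Meq v_def[symmetric] .
  qed
qed

end
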